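(* Let $r\ge 0$ be an integer and let $\mathcal{F}$ be a holomorphic foliation of degree $d=(d_1,d_2)$ on the Hirzebruch surface $\mathcal{H}_r$, with at most isolated singularities. Then $\mathcal{F}$ is regular if and only if one of the following holds: (1) $r=0$, $d_1=0$ and $d_2=2$; then, in homogeneous coordinates, $\mathcal{F}$ is induced by $\omega=z_{2,2}\,dz_{1,2}-z_{1,2}\,dz_{2,2}$; or (2) $r\ge0$, $d_1=2$ and $d_2=0$; then, in homogeneous coordinates, $\mathcal{F}$ is induced by $\omega=z_{2,1}\,dz_{1,1}-z_{1,1}\,dz_{2,1}$. In particular, a regular $\mathcal{F}$ is a $\mathbb{P}^1$-fibration over $\mathbb{P}^1$; $\mathcal{F}$ is given by the canonical projection $\mathcal{H}_r\rightarrow\mathbb{P}^1$. Moreover, there are no holomorphic foliations on $\mathcal{H}_r$ with a unique singularity (with multiplicity $1$).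
   Context: The Hirzebruch surface is $\mathcal{H}_r=(\mathbb{C}^2\times\mathbb{C}^2-\mathcal{Z})/(\mathbb{C}^* )^2$, where $$(\lambda,\mu)\cdot(z_{1,1},z_{1,2},z_{2,1},z_{2,2})=(\lambda z_{1,1},\mu z_{1,2},\lambda z_{2,1},\mu\lambda^rz_{2,2}),\qquad \mathcal{Z}=\{z_{1,1}=z_{2,1}=0\}\cup\{z_{1,2}=z_{2,2}=0\}.$$ Its divisor class group is $\mathbb{Z}^2=\mathbb{Z}h_1\oplus\mathbb{Z}h_2$ with $h_1^2=0$, $h_1\cdot h_2=1$, $h_2^2=-r$, and its homogeneous coordinate ring $\mathrm{S}=\mathbb{C}[z_{1,1},z_{1,2},z_{2,1},z_{2,2}]$ is graded by $\deg z_{1,1}=\deg z_{2,1}=(1,0)$, $\deg z_{1,2}=(0,1)$, $\deg z_{2,2}=(r,1)$. The map $[z]\mapsto[z_{1,1}:z_{2,1}]$ is the canonical projection to $\mathbb{P}^1$ (for $r=0$, $\mathcal{H}_0\simeq\mathbb{P}^1\times\mathbb{P}^1$ also has the projection $[z]\mapsto[z_{1,2}:z_{2,2}]$). A (codimension one) holomorphic foliation of degree $d=(d_1,d_2)=d_1h_1+d_2h_2$ on $\mathcal{H}_r$ is a global section of $\Omega^1_{\mathcal{H}_r}(d)=\Omega^1_{\mathcal{H}_r}\otimes\mathcal{O}_{\mathcal{H}_r}(d_1,d_2)$ with at most isolated zeros, considered up to a nonzero constant factor. In homogeneous coordinates it is a form $\omega=\sum P_{i,j}\,dz_{i,j}$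 with $P_{i,j}\in\mathrm{S}$ homogeneous of degree $d-\deg z_{i,j}$ and $i_{R_1}\omega=i_{R_2}\omega=0$, where $R_1=z_{1,1}\frac{\partial}{\partial z_{1,1}}+z_{2,1}\frac{\partial}{\partial z_{2,1}}+rz_{2,2}\frac{\partial}{\partial z_{2,2}}$ and $R_2=z_{1,2}\frac{\partial}{\partial z_{1,2}}+z_{2,2}\frac{\partial}{\partial z_{2,2}}$. $\mathrm{Sing}(\mathcal{F})$ is the image in $\mathcal{H}_r$ of the zeros of $\omega$ outside $\mathcal{Z}$; $\mathcal{F}$ is regular if $\mathrm{Sing}(\mathcal{F})=\varnothing$. The multiplicity of a singularity is the local multiplicity of the zero scheme of the section. *)

theory Defs
  imports "HOL-Analysis.Analysis" "HOL-Library.Poly_Mapping"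
begin

section \<open>Hirzebruch surfaces\<close>

text \<open>
  The index \<open>(i, j)\<close> stands for the coordinate \<open>z\<^sub>i\<^sub>,\<^sub>j\<close>, so \<open>\<complex>\<^sup>2 \<times> \<complex>\<^sup>2\<close> is \<open>cpt\<close>, its first factor
  being the coordinates with \<open>i = 1\<close>. In the numeral type \<open>2\<close> the element 2 is the same as 0.
\<close>

type_synonym idx = "2 \<times> 2"
type_synonym cpt = "complex ^ idx"

definition zdeg :: "nat \<Rightarrow> idx \<Rightarrow> nat \<times> nat" where
  "zdeg r v = (if v = (2,2) then (r, 1) else if v = (1,2) then (0, 1) else (1, 0))"

text \<open>The torus acts with weights \<open>zdeg\<close>, i.e.
  \<open>(\<lambda>, \<mu>) \<cdot> z = (\<lambda> z\<^sub>1\<^sub>,\<^sub>1, \<mu> z\<^sub>1\<^sub>,\<^sub>2, \<lambda> z\<^sub>2\<^sub>,\<^sub>1, \<mu> \<lambda>\<^sup>r z\<^sub>2\<^sub>,\<^sub>2)\<close>.\<close>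

definition act :: "nat \<Rightarrow> complex \<Rightarrow> complex \<Rightarrow> cpt \<Rightarrow> cpt" where
  "act r l m z = (\<chi> v. l ^ fst (zdeg r v) * m ^ snd (zdeg r v) * z $ v)"

definition irrelevant :: "cpt set" where
  "irrelevant = {z. z $ (1,1) = 0 \<and> z $ (2,1) = 0} \<union> {z. z $ (1,2) = 0 \<and> z $ (2,2) = 0}"

text \<open>Points of the quotient are orbits.\<close>

definition hpoint :: "nat \<Rightarrow> cpt \<Rightarrow> cpt set" where
  "hpoint r z = {act r l m z | l m. l \<noteq> 0 \<and> m \<noteq> 0}"

definition hirzebruch :: "nat \<Rightarrow> cpt set set" where
  "hirzebruch r = hpoint r ` (- irrelevant)"

definition ppoint :: "complex ^ 2 \<Rightarrow> (complex ^ 2) set" where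
  "ppoint w = {c *s w | c. c \<noteq> 0}"

definition proj_line :: "(complex ^ 2) set set" where
  "proj_line = ppoint ` (- {0})"

definition quotient_top :: "'a::topological_space set \<Rightarrow> ('a \<Rightarrow> 'b) \<Rightarrow> 'b topology" where
  "quotient_top A q = topology (\<lambda>U. U \<subseteq> q ` A \<and> open {a \<in> A. q a \<in> U})"

lemma openin_quotient_top:
  "openin (quotient_top A q) U \<longleftrightarrow> U \<subseteq> q ` A \<and> open {a \<in> A. q a \<in> U}"
proof -
  have "istopology (\<lambda>U. U \<subseteq> q ` A \<and> open {a \<in> A. q a \<in> U})"
    unfolding istopology_def
  proof (intro conjI allI impI)
    fix S T
    assume "S \<subseteq> q ` A \<and> open {a \<in> A. q a \<in> S}" and "T \<subseteq> q ` A \<and> open {a \<in> A. q a \<in> T}"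
    moreover have "{a \<in> A. q a \<in> S \<inter> T} = {a \<in> A. q a \<in> S} \<inter> {a \<in> A. q a \<in> T}" by auto
    ultimately show "S \<inter> T \<subseteq> q ` A" "open {a \<in> A. q a \<in> S \<inter> T}" by auto
  next
    fix K
    assume "\<forall>U\<in>K. U \<subseteq> q ` A \<and> open {a \<in> A. q a \<in> U}"
    moreover have "{a \<in> A. q a \<in> \<Union>K} = (\<Union>U\<in>K. {a \<in> A. q a \<in> U})" by auto
    ultimately show "\<Union>K \<subseteq> q ` A" "open {a \<in> A. q a \<in> \<Union>K}" by auto
  qed
  then show ?thesis by (simp add: quotient_top_def topology_inverse')
qed


section \<open>The homogeneous coordinate ring\<close>

type_synonym cox = "(idx \<Rightarrow>\<^sub>0 nat) \<Rightarrow>\<^sub>0 complex"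

definition zvar :: "idx \<Rightarrow> cox" where
  "zvar v = Poly_Mapping.single (Poly_Mapping.single v 1) 1"

definition const :: "complex \<Rightarrow> cox" where
  "const c = Poly_Mapping.single 0 c"

definition eval_cox :: "cox \<Rightarrow> cpt \<Rightarrow> complex" where
  "eval_cox P z = (\<Sum>m\<in>Poly_Mapping.keys P.
     Poly_Mapping.lookup P m * (\<Prod>v\<in>UNIV. (z $ v) ^ Poly_Mapping.lookup m v))"

text \<open>Homogeneity is stated for degrees in \<open>\<int>\<^sup>2\<close>; the zero polynomial has every degree.\<close>

definition homogeneous :: "nat \<Rightarrow> int \<times> int \<Rightarrow> cox \<Rightarrow> bool" where
  "homogeneous r e P \<longleftrightarrow> (\<forall>m\<in>Poly_Mapping.keys P.
     (\<Sum>v\<in>UNIV. int (Poly_Mapping.lookup m v * fst (zdeg r v))) = fst e \<and>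
     (\<Sum>v\<in>UNIV. int (Poly_Mapping.lookup m v * snd (zdeg r v))) = snd e)"


section \<open>Foliations\<close>

text \<open>
  The form \<open>\<Sum> P\<^sub>i\<^sub>,\<^sub>j dz\<^sub>i\<^sub>,\<^sub>j\<close> and the vector field \<open>\<Sum> P\<^sub>i\<^sub>,\<^sub>j \<partial>/\<partial>z\<^sub>i\<^sub>,\<^sub>j\<close> are both given by their
  coefficients. A foliation is represented by any of its defining forms, two forms defining the same
  foliation iff they are \<open>same_foliation\<close>.
\<close>

definition contract :: "(idx \<Rightarrow> cox) \<Rightarrow> (idx \<Rightarrow> cox) \<Rightarrow> cox" where
  "contract R \<omega> = (\<Sum>v\<in>UNIV. R v * \<omega> v)"

definition R1 :: "nat \<Rightarrow> idx \<Rightarrow> cox" where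
  "R1 r v = (if v = (1,1) then zvar (1,1) else if v = (2,1) then zvar (2,1)
             else if v = (2,2) then of_nat r * zvar (2,2) else 0)"

definition R2 :: "idx \<Rightarrow> cox" where
  "R2 v = (if v = (1,2) then zvar (1,2) else if v = (2,2) then zvar (2,2) else 0)"

definition twisted_form :: "nat \<Rightarrow> int \<times> int \<Rightarrow> (idx \<Rightarrow> cox) \<Rightarrow> bool" where
  "twisted_form r d \<omega> \<longleftrightarrow>
     (\<forall>v. homogeneous r (fst d - int (fst (zdeg r v)), snd d - int (snd (zdeg r v))) (\<omega> v)) \<and>
     contract (R1 r) \<omega> = 0 \<and> contract R2 \<omega> = 0"

definition Sing :: "nat \<Rightarrow> (idx \<Rightarrow> cox) \<Rightarrow> cpt set set" where
  "Sing r \<omega> = hpoint r ` {z. z \<notin> irrelevant \<and> (\<forall>v. eval_cox (\<omega> v) z = 0)}"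

definition foliation :: "nat \<Rightarrow> int \<times> int \<Rightarrow> (idx \<Rightarrow> cox) \<Rightarrow> bool" where
  "foliation r d \<omega> \<longleftrightarrow> twisted_form r d \<omega> \<and>
     Sing r \<omega> \<inter> quotient_top (- irrelevant) (hpoint r) derived_set_of Sing r \<omega> = {}"

definition same_foliation :: "(idx \<Rightarrow> cox) \<Rightarrow> (idx \<Rightarrow> cox) \<Rightarrow> bool" where
  "same_foliation \<omega> \<eta> \<longleftrightarrow> (\<exists>c. c \<noteq> 0 \<and> (\<forall>v. \<omega> v = const c * \<eta> v))"

definition regular_foliation :: "nat \<Rightarrow> (idx \<Rightarrow> cox) \<Rightarrow> bool" where
  "regular_foliation r \<omega> \<longleftrightarrow> Sing r \<omega> = {}"

text \<open>The form \<open>z\<^sub>2\<^sub>,\<^sub>j dz\<^sub>1\<^sub>,\<^sub>j - z\<^sub>1\<^sub>,\<^sub>j dz\<^sub>2\<^sub>,\<^sub>j\<close>.\<close>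

definition pencil_form :: "2 \<Rightarrow> idx \<Rightarrow> cox" where
  "pencil_form j v = (if v = (1,j) then zvar (2,j) else if v = (2,j) then - zvar (1,j) else 0)"


section \<open>Multiplicity of a singularity\<close>

text \<open>
  The local ring of the surface at \<open>p\<close> consists of the germs of the regular functions near \<open>p\<close>, which
  are the quotients \<open>F / G\<close> of homogeneous polynomials of equal degree with \<open>G(p) \<noteq> 0\<close>. Below,
  germs are represented by functions on the surface with arbitrary values away from \<open>p\<close>; the
  difference of two representatives of one germ lies in \<open>zero_ideal\<close> (take \<open>F = 0\<close>).

  In the local frames of the twisted cotangent sheaf, the ideal of the zero scheme of
  \<open>\<Sum> P\<^sub>i\<^sub>,\<^sub>j dz\<^sub>i\<^sub>,\<^sub>j\<close> is generated by the four dehomogenised coefficients: where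
  \<open>z\<^sub>1\<^sub>,\<^sub>1 = z\<^sub>1\<^sub>,\<^sub>2 = 1\<close>, for instance, the section is \<open>P\<^sub>2\<^sub>,\<^sub>1 dz\<^sub>2\<^sub>,\<^sub>1 + P\<^sub>2\<^sub>,\<^sub>2 dz\<^sub>2\<^sub>,\<^sub>2\<close>,
  and contraction with the two radial fields puts \<open>P\<^sub>1\<^sub>,\<^sub>1\<close> and \<open>P\<^sub>1\<^sub>,\<^sub>2\<close> in the ideal of the other two.
\<close>

definition represents_at :: "nat \<Rightarrow> cpt set \<Rightarrow> cox \<Rightarrow> (cpt set \<Rightarrow> complex) \<Rightarrow> bool" where
  "represents_at r p F f \<longleftrightarrow> (\<exists>e G. homogeneous r e F \<and> homogeneous r e G \<and>
     (\<forall>z\<in>p. eval_cox G z \<noteq> 0) \<and>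
     (\<forall>w. w \<notin> irrelevant \<longrightarrow> eval_cox G w \<noteq> 0 \<longrightarrow> f (hpoint r w) = eval_cox F w / eval_cox G w))"

definition local_ring :: "nat \<Rightarrow> cpt set \<Rightarrow> (cpt set \<Rightarrow> complex) set" where
  "local_ring r p = {f. \<exists>F. represents_at r p F f}"

definition zero_ideal :: "nat \<Rightarrow> (idx \<Rightarrow> cox) \<Rightarrow> cpt set \<Rightarrow> (cpt set \<Rightarrow> complex) set" where
  "zero_ideal r \<omega> p = {f. \<exists>A. represents_at r p (\<Sum>v\<in>UNIV. A v * \<omega> v) f}"

text \<open>The dimension of \<open>V / W\<close> for spaces \<open>W \<subseteq> V\<close> of complex functions: the supremum of the sizes
  of the finite subsets of \<open>V\<close> that are linearly independent modulo \<open>W\<close>.\<close>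

definition quotient_dim :: "('a \<Rightarrow> complex) set \<Rightarrow> ('a \<Rightarrow> complex) set \<Rightarrow> enat" where
  "quotient_dim V W = (SUP B \<in> {B. finite B \<and> B \<subseteq> V \<and>
     (\<forall>c. (\<lambda>x. \<Sum>b\<in>B. c b * b x) \<in> W \<longrightarrow> (\<forall>b\<in>B. c b = 0))}. enat (card B))"

definition sing_mult :: "nat \<Rightarrow> (idx \<Rightarrow> cox) \<Rightarrow> cpt set \<Rightarrow> enat" where
  "sing_mult r \<omega> p = quotient_dim (local_ring r p) (zero_ideal r \<omega> p)"


section \<open>Holomorphic maps and fibrations\<close>

definition has_cderivative ::
    "(complex ^ 'n \<Rightarrow> complex ^ 'm) \<Rightarrow> (complex ^ 'n \<Rightarrow> complex ^ 'm) \<Rightarrow> complex ^ 'n \<Rightarrow> bool" where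
  "has_cderivative g D x \<longleftrightarrow> (g has_derivative D) (at x) \<and> Vector_Spaces.linear (*s) (*s) D"

text \<open>
  A holomorphic local lift of a map \<open>f\<close> from the quotient \<open>q ` A\<close> of \<open>A\<close> to the quotient \<open>q' ` B\<close>
  of \<open>B\<close>. For open \<open>A\<close>, \<open>B\<close> and quotients by free and proper holomorphic torus actions (so that \<open>q\<close>
  and \<open>q'\<close> are holomorphic principal bundles), \<open>f\<close> is holomorphic iff it has such lifts around
  every point of \<open>A\<close>.
\<close>

definition lift_on ::
    "(complex ^ 'n) set \<Rightarrow> (complex ^ 'n \<Rightarrow> 'p) \<Rightarrow> (complex ^ 'm) set \<Rightarrow> (complex ^ 'm \<Rightarrow> 'q) \<Rightarrow>
     ('p \<Rightarrow> 'q) \<Rightarrow> (complex ^ 'n) set \<Rightarrow> (complex ^ 'n \<Rightarrow> complex ^ 'm) \<Rightarrow> bool" where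
  "lift_on A q B q' f N g \<longleftrightarrow> open N \<and> N \<subseteq> A \<and> g ` N \<subseteq> B \<and>
     (\<forall>x\<in>N. \<exists>D. has_cderivative g D x) \<and> (\<forall>x\<in>N. f (q x) = q' (g x))"

definition holo_map ::
    "(complex ^ 'n) set \<Rightarrow> (complex ^ 'n \<Rightarrow> 'p) \<Rightarrow> (complex ^ 'm) set \<Rightarrow> (complex ^ 'm \<Rightarrow> 'q) \<Rightarrow>
     ('p \<Rightarrow> 'q) \<Rightarrow> bool" where
  "holo_map A q B q' f \<longleftrightarrow> (\<forall>a\<in>A. \<exists>N g. a \<in> N \<and> lift_on A q B q' f N g)"

definition column :: "2 \<Rightarrow> cpt \<Rightarrow> complex ^ 2" where
  "column j z = (\<chi> i. z $ (i, j))"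

text \<open>The map \<open>[z] \<mapsto> [z\<^sub>1\<^sub>,\<^sub>j : z\<^sub>2\<^sub>,\<^sub>j]\<close>; it is meaningful for \<open>j = 1\<close>, and for \<open>j = 2\<close> if \<open>r = 0\<close>.\<close>

definition proj :: "2 \<Rightarrow> cpt set \<Rightarrow> (complex ^ 2) set" where
  "proj j p = column j ` p"

lemma two_cases: "(j::2) = 1 \<or> j = 2"
  using exhaust_2 by blast

lemma proj_1: "proj 1 (hpoint r z) = ppoint (column 1 z)"
proof -
  have "column 1 (act r l m z) = l *s column 1 z" for l m
    by (simp add: column_def act_def zdeg_def vec_eq_iff)
  then show ?thesis
    unfolding proj_def hpoint_def ppoint_def
    by (auto simp: image_def) (metis zero_neq_one)
qed

lemma proj_2: "proj 2 (hpoint 0 z) = ppoint (column 2 z)"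
proof -
  have "column 2 (act 0 l m z) = m *s column 2 z" for l m
    using two_cases by (auto simp: column_def act_def zdeg_def vec_eq_iff)
  then show ?thesis
    unfolding proj_def hpoint_def ppoint_def
    by (auto simp: image_def) (metis zero_neq_one)
qed

text \<open>The product of two projective lines, as the quotient of \<open>prod_domain\<close> by \<open>prod_point\<close>.\<close>

definition prod_domain :: "cpt set" where
  "prod_domain = {w. column 1 w \<noteq> 0 \<and> column 2 w \<noteq> 0}"

definition prod_point :: "cpt \<Rightarrow> (complex ^ 2) set \<times> (complex ^ 2) set" where
  "prod_point w = (ppoint (column 1 w), ppoint (column 2 w))"

text \<open>Holomorphic fibre bundles over the projective line with fibre the projective line.\<close>

definition p1_fibration :: "nat \<Rightarrow> (cpt set \<Rightarrow> (complex ^ 2) set) \<Rightarrow> bool" where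
  "p1_fibration r f \<longleftrightarrow>
     holo_map (- irrelevant) (hpoint r) (- {0}) ppoint f \<and>
     (\<forall>b\<in>proj_line. \<exists>U \<Phi>.
        openin (quotient_top (- {0}) ppoint) U \<and> b \<in> U \<and>
        bij_betw \<Phi> {p \<in> hirzebruch r. f p \<in> U} (U \<times> proj_line) \<and>
        (\<forall>p\<in>hirzebruch r. f p \<in> U \<longrightarrow> fst (\<Phi> p) = f p) \<and>
        holo_map {z. z \<notin> irrelevant \<and> f (hpoint r z) \<in> U} (hpoint r) prod_domain prod_point \<Phi> \<and>
        holo_map {w \<in> prod_domain. fst (prod_point w) \<in> U} prod_point (- irrelevant) (hpoint r)
          (inv_into {p \<in> hirzebruch r. f p \<in> U} \<Phi>))"

text \<open>
  The foliation is given by the fibres of \<open>f\<close>: at every point, the kernel of the form is the kernel of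
  the differential of \<open>f\<close>. Upstairs, with \<open>g\<close> a local lift of \<open>f\<close> to \<open>\<complex>\<^sup>2 - {0}\<close>, the latter
  consists of the vectors that \<open>dg\<close> maps into the radial direction \<open>\<complex> g(z)\<close>.
\<close>

definition given_by :: "nat \<Rightarrow> (idx \<Rightarrow> cox) \<Rightarrow> (cpt set \<Rightarrow> (complex ^ 2) set) \<Rightarrow> bool" where
  "given_by r \<omega> f \<longleftrightarrow>
     holo_map (- irrelevant) (hpoint r) (- {0}) ppoint f \<and>
     (\<forall>z N g D. z \<in> N \<longrightarrow> lift_on (- irrelevant) (hpoint r) (- {0}) ppoint f N g \<longrightarrow>
        has_cderivative g D z \<longrightarrow>
        (\<forall>x. (\<Sum>v\<in>UNIV. eval_cox (\<omega> v) z * x $ v) = 0 \<longleftrightarrow> (\<exists>c. D x = c *s g z)))"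

end

(*
  Contracting with R2 shows that s P_s + t P_t = 0 for the fibre coordinates s = z12, t = z22, so
  P_s = t g and P_t = - s g. In a chart with base coordinate u, the singularities are the common zeros of
  g and of the coefficient P_u, binary forms in (s, t) of degrees d2 - 2 and d2 with coefficients
  in C[u]. Their resultant in (s, t) is a polynomial in u, and the resultants of the two charts glue to
  a section of O(c) on the projective line, with c = 2 + (d2 - 1) (2 (d1 - 1) - r d2), which is even.
  Without singularities the section has no zeros, so c = 0; the solutions other than the two pencils
  have r > 0 and are excluded because g then vanishes identically on some fibre, whereas P_u has
  zeros on every fibre. A unique singularity of multiplicity one makes the Jacobian of (g, P_u)
  invertible there, hence gives a section with a single simple zero, and c = 1 is odd.
*)
theory Submission
  imports Defs "Jordan_Normal_Form.Determinant" "HOL-Computational_Algebra.Fundamental_Theorem_Algebra"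
begin

text \<open>The resultant stands in for the second Chern class of the twisted cotangent sheaf:
  counting zeros becomes finding the degree of a line bundle on the base, for which polynomials in
  one variable suffice. Two obstacles shape the argument. First, the coefficient q of the base
  differential is not intrinsic: by the contraction with \<open>R1\<close>, a change of chart adds
  to it a multiple of s t g. A resultant of (g, q) does not see multiples of g added to q, so the
  correction becomes a column operation on the Sylvester matrix. Secondly, a simple zero of the
  section has to be read off from a local multiplicity. The order of the resultant at u collects all
  common zeros on the fibre over u, so uniqueness is used together with the invertible Jacobian.
  Invertibility itself is obtained dually: along a direction in the kernel of the Jacobian, value
  and first derivative are two independent functionals on the local ring that kill the ideal. For d2
  at most 1 the form g is zero and no Sylvester matrix is available; these degrees are treated
  directly.\<close>

no_notation Matrix.vec_index (infixl "$" 100)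
hide_const (open) Module.smult

section \<open>Binary forms and their resultant\<close>

text \<open>A binary form of degree \<open>N - 1\<close> in \<open>(s, t)\<close> is encoded by its dehomogenisation at \<open>s = 1\<close>, a polynomial with at
  most \<open>N\<close> coefficients; for \<open>N = 0\<close> this leaves the zero form only.\<close>

definition short :: "nat \<Rightarrow> 'a::zero poly \<Rightarrow> bool" where
  "short N f \<longleftrightarrow> (\<forall>k\<ge>N. coeff f k = 0)"

definition form_eval :: "nat \<Rightarrow> 'a::comm_ring_1 poly \<Rightarrow> 'a \<Rightarrow> 'a \<Rightarrow> 'a" where
  "form_eval N f s t = (\<Sum>k<N. coeff f k * s ^ (N - 1 - k) * t ^ k)"

lemma short_0 [simp]: "short N 0"
  by (simp add: short_def)

lemma short_0_iff: "short 0 f \<longleftrightarrow> f = 0"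
  by (auto simp: short_def poly_eq_iff)

lemma short_iff_degree: "short (Suc N) f \<longleftrightarrow> degree f \<le> N"
proof
  assume "short (Suc N) f"
  then show "degree f \<le> N" by (intro degree_le) (auto simp: short_def)
next
  assume "degree f \<le> N"
  then show "short (Suc N) f" by (auto simp: short_def intro: coeff_eq_0)
qed

lemma form_eval_0 [simp]: "form_eval N 0 s t = 0"
  by (simp add: form_eval_def)

lemma form_eval_add: "form_eval N (f + g) s t = form_eval N f s t + form_eval N g s t"
  by (simp add: form_eval_def sum.distrib algebra_simps)

lemma form_eval_linear: "form_eval 2 [:t0, - s0:] s t = t0 * s - s0 * t"
  by (simp add: form_eval_def eval_nat_numeral lessThan_Suc)

lemma form_eval_finite:
  fixes f :: "'a::field poly"
  assumes "short (Suc k) f" "s \<noteq> 0"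
  shows "form_eval (Suc k) f s t = s ^ k * poly f (t / s)"
proof -
  have "poly f (t / s) = (\<Sum>i\<le>k. coeff f i * (t / s) ^ i)"
    unfolding poly_altdef
  proof (rule sum.mono_neutral_left)
    show "{..degree f} \<subseteq> {..k}" using assms(1) by (auto simp: short_iff_degree)
  qed (auto simp: coeff_eq_0)
  then have "s ^ k * poly f (t / s) = (\<Sum>i\<le>k. coeff f i * (s ^ k * (t / s) ^ i))"
    by (simp add: sum_distrib_left mult_ac)
  also have "\<dots> = (\<Sum>i\<le>k. coeff f i * s ^ (k - i) * t ^ i)"
    using assms(2) by (intro sum.cong refl) (simp add: power_divide power_diff mult_ac)
  finally show ?thesis
    by (simp add: form_eval_def lessThan_Suc_atMost)
qed

lemma form_eval_infinity:
  assumes "short (Suc k) f"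
  shows "form_eval (Suc k) f 0 t = coeff f k * t ^ k"
proof -
  have "form_eval (Suc k) f 0 t = (\<Sum>i\<in>{k}. coeff f i * 0 ^ (k - i) * t ^ i)"
    unfolding form_eval_def by (intro sum.mono_neutral_cong_right) (auto simp: less_Suc_eq power_0_left split: if_splits)
  then show ?thesis by simp
qed

lemma short_mult:
  fixes f g :: "'a::comm_semiring_0 poly"
  assumes "short (Suc k) f" "short j g"
  shows "short (k + j) (f * g)"
  unfolding short_def coeff_mult
proof (intro allI impI sum.neutral ballI)
  fix l i assume "k + j \<le> l" "i \<in> {..l}"
  then have "Suc k \<le> i \<or> j \<le> l - i" by auto
  then show "coeff f i * coeff g (l - i) = 0"
    using assms unfolding short_def by auto
qed

text \<open>The bounds are \<open>Suc k\<close> and \<open>j\<close> so that the second factor may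
  have no coefficients at all, as happens to a cofactor of a syzygy when \<open>n = 0\<close>.
  Dehomogenising at s = 1 is multiplicative; only the point at infinity requires a comparison of top
  coefficients.\<close>

lemma form_eval_mult:
  fixes f g :: "'a::field poly"
  assumes f: "short (Suc k) f" and g: "short j g"
  shows "form_eval (k + j) (f * g) s t = form_eval (Suc k) f s t * form_eval j g s t"
proof (cases j)
  case 0
  then show ?thesis using g by (simp add: short_0_iff)
next
  case (Suc i)
  have fg: "short (Suc (k + i)) (f * g)" using short_mult[OF f g] Suc by simp
  show ?thesis
  proof (cases "s = 0")
    case False
    have "short (Suc i) g" using g Suc by simp
    then show ?thesis
      by (simp add: Suc form_eval_finite[OF fg False] form_eval_finite[OF f False]
          form_eval_finite[OF _ False] power_add mult_ac)
  next
    case True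
    have "coeff (f * g) (k + i) = (\<Sum>l\<in>{k}. coeff f l * coeff g (k + i - l))"
      unfolding coeff_mult
    proof (intro sum.mono_neutral_right ballI)
      fix l assume "l \<in> {..k + i} - {k}"
      then have "Suc k \<le> l \<or> j \<le> k + i - l" using Suc by auto
      then show "coeff f l * coeff g (k + i - l) = 0"
        using f g unfolding short_def by auto
    qed auto
    moreover have "short (Suc i) g" using g Suc by simp
    ultimately show ?thesis
      by (simp add: True Suc form_eval_infinity[OF fg] form_eval_infinity[OF f] form_eval_infinity
          power_add mult_ac)
  qed
qed

text \<open>The linear form t0 S - s0 T that vanishes at (s0, t0) dehomogenises to
  \<open>[:t0, - s0:]\<close>. At infinity it is a constant, and dividing by it lowers the
  coefficient bound rather than the degree of the polynomial.\<close>

lemma form_root_factor: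
  fixes f :: "'a::field poly"
  assumes f: "short (Suc k) f" and p: "s \<noteq> 0 \<or> t \<noteq> 0" and z: "form_eval (Suc k) f s t = 0"
  obtains f1 where "short k f1" "f = [:t, - s:] * f1"
proof (cases "s = 0")
  case True
  with p have t: "t \<noteq> 0" by simp
  have "coeff f k = 0" using form_eval_infinity[OF f, of t] z True t by simp
  then have "short k f" using f unfolding short_def by (metis Suc_leI le_neq_implies_less)
  then have "short k (smult (1 / t) f)" by (simp add: short_def)
  moreover have "f = [:t, - s:] * Polynomial.smult (1 / t) f" using True t by simp
  ultimately show ?thesis using that by blast
next
  case False
  then have "poly f (t / s) = 0" using form_eval_finite[OF f False, of t] z by simp
  then obtain h where h: "f = [:- (t / s), 1:] * h"
    using poly_eq_0_iff_dvd by (metis dvdE)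
  let ?f1 = "Polynomial.smult (- 1 / s) h"
  have "[:- (t / s), 1:] = Polynomial.smult (- 1 / s) [:t, - s:]" using False by simp
  then have eq: "f = [:t, - s:] * ?f1" unfolding h by (metis mult_smult_left mult_smult_right)
  have "short k ?f1"
  proof (cases "h = 0")
    case False
    have "degree f = Suc (degree h)" unfolding h
      by (subst degree_mult_eq) (use False in auto)
    then have "degree h < k" using f by (simp add: short_iff_degree)
    then show ?thesis by (auto simp: short_def coeff_eq_0)
  qed simp
  with eq that show ?thesis by blast
qed

text \<open>A vanishing top coefficient is a zero at [0 : 1]; otherwise the dehomogenised polynomial
  has full, hence positive, degree and a root.\<close>

lemma form_has_zero:
  fixes f :: "complex poly"
  assumes "short (Suc (Suc k)) f"
  obtains s t where "s \<noteq> 0 \<or> t \<noteq> 0" "form_eval (Suc (Suc k)) f s t = 0"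
proof (cases "coeff f (Suc k) = 0")
  case True
  then show ?thesis using that[of 0 1] form_eval_infinity[OF assms, of 1] by simp
next
  case False
  then have "degree f = Suc k" using assms le_degree short_iff_degree by (metis le_antisym)
  then obtain z where "poly f z = 0"
    using fundamental_theorem_of_algebra[of f] constant_degree[of f] by auto
  then show ?thesis using that[of 1 z] form_eval_finite[OF assms, of 1 z] by simp
qed

section \<open>Syzygies and common zeros of two binary forms\<close>

lemma short_linear: "short (Suc (Suc 0)) [:a, b:]"
  by (auto simp: short_iff_degree)

lemma form_eval_linear_mult:
  fixes f :: "'a::field poly"
  assumes "short k f"
  shows "form_eval (Suc k) ([:t0, - s0:] * f) s t = (t0 * s - s0 * t) * form_eval k f s t"
  using form_eval_mult[OF short_linear assms, of t0 "- s0" s t] form_eval_linear[of t0 s0 s t]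
  by (simp add: numeral_2_eq_2)

text \<open>At a zero of g the relation forces q or b to vanish. If q vanishes, the zero is common;
  if b does, the linear factor cancels from g and b, and \<open>n\<close> drops by one. The bounds
  on a and b lie one below the degrees of q and g, so at \<open>n = 0\<close> only b = 0 is left;
  then g = 0, and any zero of q serves.\<close>

lemma syzygy_imp_common_zero:
  fixes a b g q :: "complex poly"
  assumes "short m a" "short n b" "a \<noteq> 0 \<or> b \<noteq> 0" "short (Suc n) g" "short (Suc m) q"
    and "a * g + b * q = 0"
  obtains s t where "s \<noteq> 0 \<or> t \<noteq> 0" "form_eval (Suc n) g s t = 0" "form_eval (Suc m) q s t = 0"
  using assms
proof (induction n arbitrary: b g thesis)
  case 0
  then have "b = 0" by (simp add: short_0_iff)
  with 0 have "g = 0" by auto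
  have "m \<noteq> 0" using "0.prems"(2,4) \<open>b = 0\<close> by (cases m) (auto simp: short_0_iff)
  then obtain k where k: "m = Suc k" using not0_implies_Suc by blast
  then obtain s t where "s \<noteq> 0 \<or> t \<noteq> 0" "form_eval (Suc m) q s t = 0"
    using form_has_zero "0.prems"(6) by blast
  then show ?case using "0.prems"(1) \<open>g = 0\<close> by simp
next
  case (Suc n)
  show ?case
  proof (cases "b = 0 \<and> m \<noteq> 0")
    case True
    with Suc.prems have "g = 0" by auto
    from True obtain k where k: "m = Suc k" using not0_implies_Suc by blast
    then obtain s t where "s \<noteq> 0 \<or> t \<noteq> 0" "form_eval (Suc m) q s t = 0"
      using form_has_zero Suc.prems(6) by blast
    then show ?thesis using Suc.prems(1) \<open>g = 0\<close> by simp
  next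
    case False
    then have "b \<noteq> 0" using Suc.prems by (auto simp: short_0_iff)
    obtain s t where st: "s \<noteq> 0 \<or> t \<noteq> 0" "form_eval (Suc (Suc n)) g s t = 0"
      using form_has_zero Suc.prems(5) by blast
    then obtain g1 where g1: "short (Suc n) g1" "g = [:t, - s:] * g1"
      using form_root_factor Suc.prems(5) by blast
    define l where "l = [:t, - s:]"
    have l0: "l \<noteq> 0" using st(1) by (auto simp: l_def)
    have gl: "g = l * g1" using g1(2) by (simp only: l_def)
    show ?thesis
    proof (cases "form_eval (Suc m) q s t = 0")
      case True
      then show ?thesis using Suc.prems st by blast
    next
      case False
      have "q * b = l * (- a * g1)"
        using Suc.prems(7) unfolding gl by (simp add: algebra_simps eq_neg_iff_add_eq_0)
      moreover have "short (m + n) (- a * g1)"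
        using short_mult[OF g1(1) Suc.prems(2)] by (simp add: short_def ac_simps)
      ultimately have "form_eval (m + Suc n) (q * b) s t = 0"
        unfolding l_def using form_eval_linear_mult[of "m + n" "- a * g1" t s s t] by simp
      then have "form_eval (Suc n) b s t = 0"
        using form_eval_mult[OF Suc.prems(6,3)] False by simp
      then obtain b1 where b1: "short n b1" "b = l * b1"
        unfolding l_def using form_root_factor st(1) Suc.prems(3) by blast
      have "l * (a * g1 + b1 * q) = 0"
        using Suc.prems(7) unfolding gl b1(2) by (simp add: algebra_simps)
      then have syz: "a * g1 + b1 * q = 0" using l0 by simp
      have "a \<noteq> 0 \<or> b1 \<noteq> 0" using Suc.prems(4) b1(2) by auto
      from Suc.IH[OF _ Suc.prems(2) b1(1) this g1(1) Suc.prems(6) syz]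
      obtain s' t' where "s' \<noteq> 0 \<or> t' \<noteq> 0" "form_eval (Suc n) g1 s' t' = 0"
        "form_eval (Suc m) q s' t' = 0" by blast
      moreover have "form_eval (Suc (Suc n)) g s' t' = 0"
        unfolding g1(2) form_eval_linear_mult[OF g1(1)] using calculation(2) by simp
      ultimately show ?thesis using Suc.prems(1) by blast
    qed
  qed
qed

text \<open>The cofactors of the common linear factor, one with a sign, form the syzygy. They are
  both zero only for g = q = 0, where (1, 0) serves because of \<open>0 < m\<close>.\<close>

lemma common_zero_imp_syzygy:
  fixes g q :: "complex poly"
  assumes "s \<noteq> 0 \<or> t \<noteq> 0" "short (Suc n) g" "short (Suc m) q" "0 < m"
    and "form_eval (Suc n) g s t = 0" "form_eval (Suc m) q s t = 0"
  obtains a b where "short m a" "short n b" "a \<noteq> 0 \<or> b \<noteq> 0" "a * g + b * q = 0"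
proof -
  obtain g1 where g1: "short n g1" "g = [:t, - s:] * g1"
    using form_root_factor assms by blast
  obtain q1 where q1: "short m q1" "q = [:t, - s:] * q1"
    using form_root_factor assms by blast
  show ?thesis
  proof (cases "q1 = 0 \<and> g1 = 0")
    case True
    moreover have "short m (1 :: complex poly)" using assms(4) by (simp add: short_def)
    ultimately show ?thesis using that[of 1 0] g1 q1 by simp
  next
    case False
    have "short n (- g1)" using g1(1) by (simp add: short_def)
    then show ?thesis using that[of q1 "- g1"] False g1 q1 by (simp add: algebra_simps)
  qed
qed


text \<open>The matrix of \<open>(a, b) \<mapsto> a g + b q\<close> on coefficient vectors, for \<open>a\<close>, \<open>b\<close> with \<open>m\<close> and \<open>n\<close>
  coefficients.\<close>

definition sylv :: "nat \<Rightarrow> nat \<Rightarrow> (nat \<Rightarrow> 'a::comm_ring_1) \<Rightarrow> (nat \<Rightarrow> 'a) \<Rightarrow> 'a mat" where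
  "sylv m n g q = mat (m + n) (m + n) (\<lambda>(i, j).
     if j < m then (if j \<le> i then g (i - j) else 0)
     else (if j - m \<le> i then q (i - (j - m)) else 0))"

lemma sylv_carrier [simp]: "sylv m n g q \<in> carrier_mat (m + n) (m + n)"
  by (simp add: sylv_def)

text \<open>A vector in the domain of the Sylvester matrix is a pair of polynomials written one
  after the other; \<open>vpoly 0 m v\<close> and \<open>vpoly m n v\<close> recover the
  pair.\<close>

definition vpoly :: "nat \<Rightarrow> nat \<Rightarrow> 'a::comm_ring_1 Matrix.vec \<Rightarrow> 'a poly" where
  "vpoly l k v = (\<Sum>j<k. monom (vec_index v (l + j)) j)"

lemma coeff_vpoly: "coeff (vpoly l k v) j = (if j < k then vec_index v (l + j) else 0)"
  by (simp add: vpoly_def coeff_sum)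

lemma short_vpoly: "short k (vpoly l k v)"
  by (simp add: short_def coeff_vpoly)

lemma coeff_mult_vpoly:
  "coeff (vpoly l k v * f) i = (\<Sum>j<k. (if j \<le> i then coeff f (i - j) else 0) * vec_index v (l + j))"
proof -
  have "coeff (vpoly l k v * f) i = (\<Sum>j\<le>i. (if j < k then vec_index v (l + j) else 0) * coeff f (i - j))"
    by (simp add: coeff_mult coeff_vpoly)
  also have "\<dots> = (\<Sum>j\<in>{..i} \<inter> {..<k}. coeff f (i - j) * vec_index v (l + j))"
    by (rule sum.mono_neutral_cong_right) auto
  also have "\<dots> = (\<Sum>j<k. (if j \<le> i then coeff f (i - j) else 0) * vec_index v (l + j))"
    by (rule sum.mono_neutral_cong_left) auto
  finally show ?thesis .
qed

lemma sum_lessThan_add: "(\<Sum>j<m + n. f j) = (\<Sum>j<m. f j) + (\<Sum>j<n. f (m + j))"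
  for f :: "nat \<Rightarrow> 'a::comm_monoid_add"
  by (induction n) (auto simp: ac_simps)

lemma sylv_mult_vec:
  assumes v: "v \<in> carrier_vec (m + n)" and i: "i < m + n"
  shows "vec_index (sylv m n (coeff g) (coeff q) *\<^sub>v v) i
    = coeff (vpoly 0 m v * g + vpoly m n v * q) i"
proof -
  let ?M = "sylv m n (coeff g) (coeff q)"
  have "vec_index (?M *\<^sub>v v) i = (\<Sum>j<m + n. ?M $$ (i, j) * vec_index v j)"
    using v i by (auto simp: sylv_def scalar_prod_def atLeast0LessThan)
  also have "\<dots> = (\<Sum>j<m. ?M $$ (i, j) * vec_index v j) + (\<Sum>j<n. ?M $$ (i, m + j) * vec_index v (m + j))"
    by (rule sum_lessThan_add)
  also have "\<dots> = coeff (vpoly 0 m v * g + vpoly m n v * q) i"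
    unfolding coeff_add coeff_mult_vpoly using i
    by (intro arg_cong2[of _ _ _ _ "(+)"] sum.cong) (auto simp: sylv_def)
  finally show ?thesis .
qed

lemma sylv_kernel:
  fixes g q :: "'a::comm_ring_1 poly"
  assumes v: "v \<in> carrier_vec (m + n)" "v \<noteq> 0\<^sub>v (m + n)"
      "sylv m n (coeff g) (coeff q) *\<^sub>v v = 0\<^sub>v (m + n)"
    and g: "short (Suc n) g" and q: "short (Suc m) q"
  shows "vpoly 0 m v * g + vpoly m n v * q = 0" "vpoly 0 m v \<noteq> 0 \<or> vpoly m n v \<noteq> 0"
proof -
  let ?a = "vpoly 0 m v" and ?b = "vpoly m n v"
  have "coeff (?a * g + ?b * q) i = 0" for i
  proof (cases "i < m + n")
    case True
    then show ?thesis using sylv_mult_vec[OF v(1) True, of g q] v(3) by simp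
  next
    case False
    then show ?thesis
      using short_mult[OF g short_vpoly, of m 0 v] short_mult[OF q short_vpoly, of n m v]
      by (simp add: short_def mult.commute add.commute)
  qed
  then show "?a * g + ?b * q = 0" by (simp add: poly_eq_iff)
  show "?a \<noteq> 0 \<or> ?b \<noteq> 0"
  proof (rule ccontr)
    assume "\<not> ?thesis"
    then have *: "coeff ?a j = 0" "coeff ?b j = 0" for j by auto
    have "vec_index v j = 0" if "j < m + n" for j
      using *(1)[of j] *(2)[of "j - m"] that by (cases "j < m") (auto simp: coeff_vpoly split: if_splits)
    with v(1,2) show False by auto
  qed
qed

text \<open>Kernel vectors of the Sylvester matrix are syzygies of degree too small for the trivial
  one (q, - g), so they exist only if the two forms share a zero.\<close>

lemma det_sylv_eq_0_iff:
  fixes g q :: "complex poly"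
  assumes g: "short (Suc n) g" and q: "short (Suc m) q" and m: "0 < m"
  shows "Determinant.det (sylv m n (coeff g) (coeff q)) = 0 \<longleftrightarrow>
    (\<exists>s t. (s \<noteq> 0 \<or> t \<noteq> 0) \<and> form_eval (Suc n) g s t = 0 \<and> form_eval (Suc m) q s t = 0)"
    (is "?l \<longleftrightarrow> ?r")
proof -
  let ?M = "sylv m n (coeff g) (coeff q)"
  have "?l \<longleftrightarrow> (\<exists>v. v \<in> carrier_vec (m + n) \<and> v \<noteq> 0\<^sub>v (m + n) \<and> ?M *\<^sub>v v = 0\<^sub>v (m + n))"
    by (rule det_0_iff_vec_prod_zero[OF sylv_carrier])
  also have "\<dots> \<longleftrightarrow> (\<exists>a b. short m a \<and> short n b \<and> (a \<noteq> 0 \<or> b \<noteq> 0) \<and> a * g + b * q = 0)"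
  proof safe
    fix v assume v: "v \<in> carrier_vec (m + n)" "v \<noteq> 0\<^sub>v (m + n)" "?M *\<^sub>v v = 0\<^sub>v (m + n)"
    show "\<exists>a b. short m a \<and> short n b \<and> (a \<noteq> 0 \<or> b \<noteq> 0) \<and> a * g + b * q = 0"
      using sylv_kernel[OF v g q] short_vpoly by blast
  next
    fix a b assume ab: "short m a" "short n b" "a * g + b * q = 0"
    define v where "v = Matrix.vec (m + n) (\<lambda>j. if j < m then coeff a j else coeff b (j - m))"
    have v: "v \<in> carrier_vec (m + n)" by (simp add: v_def)
    have a: "vpoly 0 m v = a" and b: "vpoly m n v = b"
      using ab(1,2) by (auto simp: poly_eq_iff coeff_vpoly v_def short_def)
    have "?M *\<^sub>v v = 0\<^sub>v (m + n)"
    proof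
      fix i assume "i < dim_vec (0\<^sub>v (m + n))"
      then have i: "i < m + n" by simp
      then show "vec_index (?M *\<^sub>v v) i = vec_index (0\<^sub>v (m + n)) i"
        unfolding sylv_mult_vec[OF v i] a b ab(3) by simp
    qed (simp add: sylv_def)
    moreover have "v \<noteq> 0\<^sub>v (m + n)" if "a \<noteq> 0 \<or> b \<noteq> 0"
    proof
      assume "v = 0\<^sub>v (m + n)"
      then have "vpoly 0 m v = 0" "vpoly m n v = 0" by (auto simp: poly_eq_iff coeff_vpoly)
      with a b that show False by simp
    qed
    ultimately show "\<exists>v. v \<in> carrier_vec (m + n) \<and> v \<noteq> 0\<^sub>v (m + n) \<and> ?M *\<^sub>v v = 0\<^sub>v (m + n)"
      if "a \<noteq> 0" using that v by blast
    show "\<exists>v. v \<in> carrier_vec (m + n) \<and> v \<noteq> 0\<^sub>v (m + n) \<and> ?M *\<^sub>v v = 0\<^sub>v (m + n)"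
      if "b \<noteq> 0" using that v \<open>?M *\<^sub>v v = 0\<^sub>v (m + n)\<close> \<open>a \<noteq> 0 \<or> b \<noteq> 0 \<Longrightarrow> v \<noteq> 0\<^sub>v (m + n)\<close> by blast
  qed
  also have "\<dots> \<longleftrightarrow> ?r"
    using syzygy_imp_common_zero[OF _ _ _ g q] common_zero_imp_syzygy[OF _ g q m] by metis
  finally show ?thesis .
qed


section \<open>Simple roots of the determinant of a polynomial matrix\<close>

lemma poly_pderiv_linear_mult: "poly (pderiv ([:- u, 1:] * q)) u = poly q u"
  for u :: "'a::idom"
  by (simp add: pderiv_mult pderiv_pCons pderiv_diff pderiv_smult)

lemma pderiv_sum: "pderiv (\<Sum>i\<in>I. f i) = (\<Sum>i\<in>I. pderiv (f i))"
  by (induction I rule: infinite_finite_induct) (simp_all add: pderiv_add)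

text \<open>The covector \<open>w\<close> kills the image of M(u), and by \<open>nd\<close> the
  derivative M'(u) pairs it nontrivially with every nonzero kernel vector. Replacing a column by M
  v, for a kernel vector v of M(u), exposes the factor X - u of the determinant; what remains is the
  invertibility at u of a matrix with one column divided by X - u.\<close>

lemma det_simple_root:
  fixes M :: "complex poly mat" and u :: complex
  defines "M0 \<equiv> map_mat (\<lambda>p. poly p u) M" and "M1 \<equiv> map_mat (\<lambda>p. poly (pderiv p) u) M"
  assumes M: "M \<in> carrier_mat N N" and w: "w \<in> carrier_vec N"
    and im: "\<And>v. v \<in> carrier_vec N \<Longrightarrow> w \<bullet> (M0 *\<^sub>v v) = 0"
    and nd: "\<And>v. v \<in> carrier_vec N \<Longrightarrow> v \<noteq> 0\<^sub>v N \<Longrightarrow> M0 *\<^sub>v v = 0\<^sub>v N \<Longrightarrow> w \<bullet> (M1 *\<^sub>v v) \<noteq> 0"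
    and det: "poly (Determinant.det M) u = 0"
  shows "poly (pderiv (Determinant.det M)) u \<noteq> 0"
proof -
  interpret ev: comm_ring_hom "\<lambda>p::complex poly. poly p u" by unfold_locales auto
  have M0: "M0 \<in> carrier_mat N N" and M1: "M1 \<in> carrier_mat N N"
    using M by (auto simp: M0_def M1_def)
  have "Determinant.det M0 = 0" using det by (simp add: M0_def)
  then obtain v where v: "v \<in> carrier_vec N" "v \<noteq> 0\<^sub>v N" "M0 *\<^sub>v v = 0\<^sub>v N"
    using det_0_iff_vec_prod_zero[OF M0] by blast
  then obtain k where k: "k < N" "vec_index v k \<noteq> 0" by (metis carrier_vecD eq_vecI index_zero_vec)
  \<comment> \<open>The constant vector v regarded over the polynomial ring: M V vanishes at u, so
    each entry is divisible by X - u.\<close>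
  define V where "V = map_vec (\<lambda>c. [:c:]) v"
  have V: "V \<in> carrier_vec N" using v by (simp add: V_def)
  define b where "b = M *\<^sub>v V"
  have b: "b \<in> carrier_vec N" using M V by (simp add: b_def)
  have bi: "vec_index b i = (\<Sum>j<N. Polynomial.smult (vec_index v j) (M $$ (i, j)))" if "i < N" for i
    using M V v that by (simp add: b_def V_def scalar_prod_def atLeast0LessThan mult.commute)
  have M0v: "vec_index (M0 *\<^sub>v x) i = (\<Sum>j<N. vec_index x j * poly (M $$ (i, j)) u)"
    if "i < N" "x \<in> carrier_vec N" for i x
    using M that by (simp add: M0_def scalar_prod_def atLeast0LessThan mult.commute)
  have M1v: "vec_index (M1 *\<^sub>v x) i = (\<Sum>j<N. vec_index x j * poly (pderiv (M $$ (i, j))) u)"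
    if "i < N" "x \<in> carrier_vec N" for i x
    using M that by (simp add: M1_def scalar_prod_def atLeast0LessThan mult.commute)
  have "\<exists>q. vec_index b i = [:- u, 1:] * q" if "i < N" for i
  proof -
    have "poly (vec_index b i) u = vec_index (M0 *\<^sub>v v) i"
      using that v(1) by (simp add: bi M0v poly_sum)
    then have "poly (vec_index b i) u = 0" using v(3) that by simp
    then show ?thesis using poly_eq_0_iff_dvd by (metis dvdE)
  qed
  then obtain q where q: "\<And>i. i < N \<Longrightarrow> vec_index b i = [:- u, 1:] * q i" by metis
  have qu: "poly (q i) u = vec_index (M1 *\<^sub>v v) i" if "i < N" for i
  proof -
    have "poly (pderiv (vec_index b i)) u = poly (q i) u"
      unfolding q[OF that] by (rule poly_pderiv_linear_mult)
    moreover have "poly (pderiv (vec_index b i)) u = vec_index (M1 *\<^sub>v v) i"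
      using that v(1) by (simp add: bi M1v pderiv_sum pderiv_smult poly_sum)
    ultimately show ?thesis by simp
  qed
  \<comment> \<open>By Cramer's rule, M V in column k multiplies the determinant by v_k. Column k of
    \<open>Y\<close> is M V divided by X - u, and its value at u is M'(u) v.\<close>
  define Y where "Y = replace_col M (Matrix.vec N q) k"
  have Y: "Y \<in> carrier_mat N N" using M by (simp add: Y_def replace_col_def)
  have R: "replace_col M b k \<in> carrier_mat N N" using M by (simp add: replace_col_def)
  have "Determinant.det (replace_col M b k) = (\<Sum>i<N. (replace_col M b k) $$ (i, k) * cofactor (replace_col M b k) i k)"
    by (rule laplace_expansion_column[OF R k(1)])
  also have "\<dots> = (\<Sum>i<N. [:- u, 1:] * (Y $$ (i, k) * cofactor Y i k))"
  proof (intro sum.cong refl)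
    fix i assume "i \<in> {..<N}"
    then have i: "i < N" by simp
    have "mat_delete (replace_col M b k) i k = mat_delete Y i k"
      using M by (auto simp: mat_delete_def replace_col_def Y_def)
    then have "cofactor (replace_col M b k) i k = cofactor Y i k" by (simp add: cofactor_def)
    moreover have "(replace_col M b k) $$ (i, k) = [:- u, 1:] * Y $$ (i, k)"
      using M i k q by (simp add: replace_col_def Y_def)
    ultimately show "(replace_col M b k) $$ (i, k) * cofactor (replace_col M b k) i k
        = [:- u, 1:] * (Y $$ (i, k) * cofactor Y i k)" by (simp only: mult.assoc)
  qed
  also have "\<dots> = [:- u, 1:] * Determinant.det Y"
    unfolding laplace_expansion_column[OF Y k(1)] by (simp only: sum_distrib_left)
  finally have "[:- u, 1:] * Determinant.det Y = vec_index V k * Determinant.det M"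
    using cramer_lemma_mat[OF M V k(1)] by (simp add: b_def)
  then have eq: "[:- u, 1:] * Determinant.det Y = Polynomial.smult (vec_index v k) (Determinant.det M)"
    using k v(1) by (simp add: V_def)
  have "poly (Determinant.det Y) u = poly (pderiv ([:- u, 1:] * Determinant.det Y)) u"
    by (rule poly_pderiv_linear_mult[symmetric])
  also have "\<dots> = vec_index v k * poly (pderiv (Determinant.det M)) u"
    unfolding eq by (simp add: pderiv_smult)
  finally have *: "poly (Determinant.det Y) u = vec_index v k * poly (pderiv (Determinant.det M)) u" .
  define Y0 where "Y0 = map_mat (\<lambda>p. poly p u) Y"
  have Y0: "Y0 \<in> carrier_mat N N" using Y by (simp add: Y0_def)
  have "Determinant.det Y0 \<noteq> 0"
  proof
    assume "Determinant.det Y0 = 0"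
    then obtain y where y: "y \<in> carrier_vec N" "y \<noteq> 0\<^sub>v N" "Y0 *\<^sub>v y = 0\<^sub>v N"
      using det_0_iff_vec_prod_zero[OF Y0] by blast
    \<comment> \<open>The relation Y0 y = 0 reads y_k M'(u) v + M(u) x = 0. Pairing with
      \<open>w\<close> removes the second term and forces y_k = 0.\<close>
    define x where "x = Matrix.vec N (\<lambda>j. if j = k then 0 else vec_index y j)"
    have x: "x \<in> carrier_vec N" by (simp add: x_def)
    have split: "vec_index y k * vec_index (M1 *\<^sub>v v) i + vec_index (M0 *\<^sub>v x) i = 0" if i: "i < N" for i
    proof -
      have "0 = vec_index (Y0 *\<^sub>v y) i" using y(3) i by simp
      also have "\<dots> = (\<Sum>j<N. Y0 $$ (i, j) * vec_index y j)"
        using Y0 y(1) i by (simp add: scalar_prod_def atLeast0LessThan)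
      also have "\<dots> = (\<Sum>j<N. (if j = k then vec_index y k * vec_index (M1 *\<^sub>v v) i else 0)
          + vec_index x j * poly (M $$ (i, j)) u)"
        using M i by (intro sum.cong refl) (auto simp: Y0_def Y_def replace_col_def x_def qu)
      also have "\<dots> = vec_index y k * vec_index (M1 *\<^sub>v v) i + vec_index (M0 *\<^sub>v x) i"
        using k(1) by (simp add: sum.distrib M0v[OF i x])
      finally show ?thesis by simp
    qed
    have "(\<Sum>i<N. vec_index w i * (vec_index y k * vec_index (M1 *\<^sub>v v) i + vec_index (M0 *\<^sub>v x) i)) = 0"
      using split by simp
    then have "vec_index y k * (\<Sum>i<N. vec_index w i * vec_index (M1 *\<^sub>v v) i)
        + (\<Sum>i<N. vec_index w i * vec_index (M0 *\<^sub>v x) i) = 0"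
      by (simp add: sum.distrib distrib_left sum_distrib_left mult_ac)
    then have "vec_index y k * (w \<bullet> (M1 *\<^sub>v v)) + w \<bullet> (M0 *\<^sub>v x) = 0"
      using M0 M1 by (simp add: scalar_prod_def atLeast0LessThan)
    then have yk: "vec_index y k = 0" using im[OF x] nd[OF v] by simp
    have xy: "x = y" using y(1) yk by (auto simp: x_def)
    have M0x: "M0 *\<^sub>v x = 0\<^sub>v N" using split yk M0 by (auto simp: xy)
    \<comment> \<open>the kernel of \<open>M0\<close> is at most one-dimensional, as \<open>nd\<close> makes a functional injective on it\<close>
    define z where "z = (w \<bullet> (M1 *\<^sub>v v)) \<cdot>\<^sub>v x - (w \<bullet> (M1 *\<^sub>v x)) \<cdot>\<^sub>v v"
    have z: "z \<in> carrier_vec N" using x v by (simp add: z_def)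
    have "M0 *\<^sub>v z = 0\<^sub>v N"
      using M0 x v M0x by (auto intro!: eq_vecI simp: z_def mult_minus_distrib_mat_vec[of _ N N] mult_mat_vec[of _ N N])
    moreover have "w \<bullet> (M1 *\<^sub>v z) = 0"
      using M1 x v w by (simp add: z_def mult_minus_distrib_mat_vec[of _ N N] mult_mat_vec[of _ N N]
          scalar_prod_minus_distrib[of _ N])
    ultimately have "z = 0\<^sub>v N" using nd z by blast
    then have "vec_index z k = 0" using k by simp
    then have "w \<bullet> (M1 *\<^sub>v x) = 0" using k x v yk xy by (auto simp: z_def)
    then have "x = 0\<^sub>v N" using nd[OF x _ M0x] by blast
    with xy y(2) show False by simp
  qed
  then have "poly (Determinant.det Y) u \<noteq> 0" by (simp add: Y0_def)
  with * show ?thesis by auto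
qed


text \<open>The factors u^(- r k) reflect the weight r of the fibre coordinate t and come from row
  and column scalings. The summand with \<open>\<rho>\<close> adds to column h of the Q-block a
  multiple of column h + 1 of the G-block. As \<open>n < m\<close>, the latter exists, and the
  change of columns is triangular, so the exponent of u is the sum over all scalings.\<close>

lemma sylv_transition:
  fixes u \<rho> :: complex and e d :: int and r :: nat
  assumes u: "u \<noteq> 0" and "n < m"
    and G: "\<And>k. G2 k = u powi (e - int (r * k)) * G1 k"
    and Q: "\<And>k. Q2 k = u powi (d - int (r * k)) * (\<rho> * (if k = 0 then 0 else G1 (k - 1)) - Q1 k)"
  shows "Determinant.det (sylv m n G2 Q2) =
    (- 1) ^ n * u powi (e * int m + (d - int (r * m)) * int n) * Determinant.det (sylv m n G1 Q1)"
proof -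
  define N where "N = m + n"
  define D where "D = mat N N (\<lambda>(i, j). if i = j then u powi (- int (r * i)) else 0)"
  define dg where "dg j = (if j < m then u powi (e + int (r * j)) else - (u powi (d + int (r * (j - m)))))" for j
  define C where "C = mat N N (\<lambda>(i, j). if i = j then dg j
    else if m \<le> j \<and> i = j - m + 1 then \<rho> * u powi (d + int (r * (j - m))) else 0)"
  have carr: "D \<in> carrier_mat N N" "C \<in> carrier_mat N N" "sylv m n G1 Q1 \<in> carrier_mat N N"
    by (simp_all add: D_def C_def N_def)
  have DM: "(D * sylv m n G1 Q1) $$ (i, j) = u powi (- int (r * i)) * sylv m n G1 Q1 $$ (i, j)"
    if ij: "i < N" "j < N" for i j
  proof -
    have "(D * sylv m n G1 Q1) $$ (i, j) = (\<Sum>l<N. D $$ (i, l) * sylv m n G1 Q1 $$ (l, j))"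
      using ij carr by (simp add: scalar_prod_def atLeast0LessThan)
    also have "\<dots> = (\<Sum>l\<in>{i}. D $$ (i, l) * sylv m n G1 Q1 $$ (l, j))"
      using ij by (intro sum.mono_neutral_right) (auto simp: D_def)
    finally show ?thesis using ij by (simp add: D_def)
  qed
  define B where "B = D * sylv m n G1 Q1"
  have B: "B \<in> carrier_mat N N" using carr by (simp add: B_def)
  have "sylv m n G2 Q2 = B * C"
  proof
    fix i j assume "i < dim_row (B * C)" "j < dim_col (B * C)"
    then have i: "i < N" and j: "j < N" using carr B by auto
    let ?M = "sylv m n G1 Q1"
    have "(B * C) $$ (i, j) = (\<Sum>l<N. B $$ (i, l) * C $$ (l, j))"
      using i j carr B by (simp add: scalar_prod_def atLeast0LessThan)
    also have "\<dots> = (\<Sum>l<N. u powi (- int (r * i)) * ?M $$ (i, l) * C $$ (l, j))"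
      using i by (simp add: B_def DM)
    also have "\<dots> = sylv m n G2 Q2 $$ (i, j)"
    proof (cases "j < m")
      case True
      have "(\<Sum>l<N. u powi (- int (r * i)) * ?M $$ (i, l) * C $$ (l, j))
          = (\<Sum>l\<in>{j}. u powi (- int (r * i)) * ?M $$ (i, l) * C $$ (l, j))"
        using i j True by (intro sum.mono_neutral_right) (auto simp: C_def)
      also have "\<dots> = u powi (- int (r * i)) * ?M $$ (i, j) * u powi (e + int (r * j))"
        using i j True by (simp add: C_def dg_def)
      also have "\<dots> = sylv m n G2 Q2 $$ (i, j)"
      proof (cases "j \<le> i")
        case le: True
        have "u powi (- int (r * i)) * u powi (e + int (r * j)) = u powi (e - int (r * (i - j)))"
          using u le by (simp flip: power_int_add add: of_nat_diff algebra_simps)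
        then show ?thesis using i j True le unfolding N_def by (simp add: sylv_def G mult_ac)
      qed (use i j True in \<open>simp add: sylv_def N_def\<close>)
      finally show ?thesis .
    next
      case False
      define h where "h = j - m"
      have h: "j = m + h" "h < n" using False j by (auto simp: h_def N_def)
      have "(\<Sum>l<N. u powi (- int (r * i)) * ?M $$ (i, l) * C $$ (l, j))
          = (\<Sum>l\<in>{j, h + 1}. u powi (- int (r * i)) * ?M $$ (i, l) * C $$ (l, j))"
        using i j h assms(2) by (intro sum.mono_neutral_right) (auto simp: C_def N_def)
      also have "\<dots> = u powi (- int (r * i)) * u powi (d + int (r * h)) *
          (\<rho> * ?M $$ (i, h + 1) - ?M $$ (i, j))"
        using i j h assms(2) by (simp add: C_def dg_def N_def algebra_simps)
      also have "\<dots> = sylv m n G2 Q2 $$ (i, j)"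
      proof (cases "h \<le> i")
        case le: True
        have "u powi (- int (r * i)) * u powi (d + int (r * h)) = u powi (d - int (r * (i - h)))"
          using u le by (simp flip: power_int_add add: of_nat_diff algebra_simps)
        moreover have "?M $$ (i, h + 1) = (if i - h = 0 then 0 else G1 (i - h - 1))"
          using i h le assms(2) by (auto simp: sylv_def N_def)
        moreover have "?M $$ (i, j) = Q1 (i - h)" "sylv m n G2 Q2 $$ (i, j) = Q2 (i - h)"
          using i h le by (auto simp: sylv_def N_def)
        ultimately show ?thesis by (simp only: Q)
      qed (use i h assms(2) in \<open>simp add: sylv_def N_def\<close>)
      finally show ?thesis .
    qed
    finally show "sylv m n G2 Q2 $$ (i, j) = (B * C) $$ (i, j)" by simp
  qed (use B in \<open>simp_all add: sylv_def C_def N_def\<close>)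
  then have "Determinant.det (sylv m n G2 Q2) = Determinant.det D * Determinant.det (sylv m n G1 Q1) * Determinant.det C"
    using carr B by (simp add: B_def det_mult[of _ N])
  moreover have "Determinant.det D = (\<Prod>j<N. u powi (- int (r * j)))"
  proof -
    have "Determinant.det D = prod_list (diag_mat D)"
      by (rule det_upper_triangular[of _ N]) (auto simp: D_def)
    then show ?thesis by (simp add: prod_list_diag_prod D_def atLeast0LessThan)
  qed
  moreover have "Determinant.det C = (\<Prod>j<N. dg j)"
  proof -
    have "Determinant.det C = prod_list (diag_mat C)"
      by (rule det_upper_triangular[of _ N]) (use assms(2) in \<open>auto simp: C_def N_def upper_triangular_def\<close>)
    then show ?thesis by (simp add: prod_list_diag_prod C_def atLeast0LessThan)
  qed
  \<comment> \<open>Row and column exponents combine to e in each of the m columns of the first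
    block and to d - r m in each of the n columns of the second.\<close>
  moreover have "(\<Prod>j<N. u powi (- int (r * j))) * (\<Prod>j<N. dg j)
      = (- 1) ^ n * u powi (e * int m + (d - int (r * m)) * int n)"
  proof -
    have split: "(\<Prod>j<m + k. f j) = (\<Prod>j<m. f j) * (\<Prod>j<k. f (m + j))" for f :: "nat \<Rightarrow> complex" and k
      by (induction k) (auto simp: mult_ac)
    have "(\<Prod>j<N. u powi (- int (r * j))) * (\<Prod>j<N. dg j) = (\<Prod>j<N. u powi (- int (r * j)) * dg j)"
      by (simp add: prod.distrib)
    also have "\<dots> = (\<Prod>j<m. u powi (- int (r * j)) * dg j) * (\<Prod>j<n. u powi (- int (r * (m + j))) * dg (m + j))"
      unfolding N_def by (rule split)
    also have "(\<Prod>j<m. u powi (- int (r * j)) * dg j) = (\<Prod>j<m. u powi e)"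
      using u by (intro prod.cong refl) (simp add: dg_def flip: power_int_add)
    also have "(\<Prod>j<n. u powi (- int (r * (m + j))) * dg (m + j)) = (\<Prod>j<n. - (u powi (d - int (r * m))))"
      using u by (intro prod.cong refl) (simp add: dg_def algebra_simps flip: power_int_add)
    also have "(\<Prod>j<m. u powi e) * \<dots> = (- 1) ^ n * (u powi e) ^ m * (u powi (d - int (r * m))) ^ n"
      by (simp add: power_minus[of "u powi _"])
    also have "\<dots> = (- 1) ^ n * u powi (e * int m + (d - int (r * m)) * int n)"
      using u by (simp add: power_int_add power_int_mult mult.assoc)
    finally show ?thesis .
  qed
  ultimately show ?thesis by (simp add: mult_ac)
qed

section \<open>Resultants of families of binary forms over the affine line\<close>

definition spec :: "nat \<Rightarrow> (nat \<Rightarrow> 'a::comm_ring_1 poly) \<Rightarrow> 'a \<Rightarrow> 'a poly" where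
  "spec N G u = (\<Sum>k<N. monom (poly (G k) u) k)"

lemma coeff_spec: "coeff (spec N G u) k = (if k < N then poly (G k) u else 0)"
  by (simp add: spec_def coeff_sum)

lemma short_spec: "short N (spec N G u)"
  by (simp add: short_def coeff_spec)

lemma form_eval_spec: "form_eval N (spec N G u) s t = (\<Sum>k<N. poly (G k) u * s ^ (N - 1 - k) * t ^ k)"
  unfolding form_eval_def by (intro sum.cong) (auto simp: coeff_spec)

definition family_resultant ::
    "nat \<Rightarrow> nat \<Rightarrow> (nat \<Rightarrow> 'a::comm_ring_1 poly) \<Rightarrow> (nat \<Rightarrow> 'a poly) \<Rightarrow> 'a poly" where
  "family_resultant m n G Q = Determinant.det (sylv m n G Q)"

lemma map_sylv:
  assumes "f 0 = 0"
  shows "map_mat f (sylv m n G Q) = sylv m n (\<lambda>k. f (G k)) (\<lambda>k. f (Q k))"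
  using assms by (auto simp: sylv_def)

lemma poly_family_resultant:
  fixes G Q :: "nat \<Rightarrow> 'a::comm_ring_1 poly"
  shows "poly (family_resultant m n G Q) u = Determinant.det (sylv m n (\<lambda>k. poly (G k) u) (\<lambda>k. poly (Q k) u))"
proof -
  interpret ev: comm_ring_hom "\<lambda>p::'a poly. poly p u" by unfold_locales auto
  show ?thesis unfolding family_resultant_def
    by (simp flip: ev.hom_det add: map_sylv)
qed

lemma family_resultant_root_iff:
  fixes G Q :: "nat \<Rightarrow> complex poly"
  assumes G: "\<And>k. n < k \<Longrightarrow> G k = 0" and Q: "\<And>k. m < k \<Longrightarrow> Q k = 0" and "0 < m"
  shows "poly (family_resultant m n G Q) u = 0 \<longleftrightarrow>
    (\<exists>s t. (s \<noteq> 0 \<or> t \<noteq> 0) \<and> form_eval (Suc n) (spec (Suc n) G u) s t = 0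
       \<and> form_eval (Suc m) (spec (Suc m) Q u) s t = 0)"
proof -
  have "(\<lambda>k. poly (G k) u) = coeff (spec (Suc n) G u)" "(\<lambda>k. poly (Q k) u) = coeff (spec (Suc m) Q u)"
    using G Q by (auto simp: coeff_spec fun_eq_iff)
  then show ?thesis
    unfolding poly_family_resultant
    using det_sylv_eq_0_iff[OF short_spec short_spec assms(3)] by metis
qed

lemma form_eval_scale: "form_eval N f (c * s) (c * t) = c ^ (N - 1) * form_eval N f s t"
  for c :: "'a::comm_ring_1"
  unfolding form_eval_def sum_distrib_left
proof (intro sum.cong refl)
  fix k assume "k \<in> {..<N}"
  then have "c ^ (N - 1) = c ^ (N - 1 - k) * c ^ k" by (simp flip: power_add)
  then show "coeff f k * (c * s) ^ (N - 1 - k) * (c * t) ^ k = c ^ (N - 1) * (coeff f k * s ^ (N - 1 - k) * t ^ k)"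
    by (simp add: power_mult_distrib mult_ac)
qed

lemma form_eval_parallel:
  fixes s t s0 t0 :: complex
  assumes "s \<noteq> 0 \<or> t \<noteq> 0" "s0 \<noteq> 0 \<or> t0 \<noteq> 0" "t0 * s = s0 * t" "form_eval N f s t = 0"
  shows "form_eval N f s0 t0 = 0"
proof -
  define c where "c = (if s = 0 then t0 / t else s0 / s)"
  have "s0 = c * s" "t0 = c * t" using assms by (auto simp: c_def field_simps)
  then show ?thesis using form_eval_scale[of N f c s t] assms(4) by simp
qed

text \<open>Left and right kernel of a 2 by 2 matrix are nonzero together, both expressing that the
  determinant vanishes.\<close>

lemma rank_one_kernel:
  fixes x y a b c d :: complex
  assumes "x \<noteq> 0 \<or> y \<noteq> 0" "x * a + y * b = 0" "x * c + y * d = 0"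
  obtains \<alpha> \<beta> where "\<alpha> \<noteq> 0 \<or> \<beta> \<noteq> 0" "\<alpha> * a + \<beta> * c = 0" "\<alpha> * b + \<beta> * d = 0"
proof (cases "c = 0 \<and> d = 0")
  case True
  then show ?thesis using that[of 0 1] by simp
next
  case False
  have "x * (c * b - a * d) = b * (x * c + y * d) - d * (x * a + y * b)"
    "y * (c * b - a * d) = c * (x * a + y * b) - a * (x * c + y * d)"
    by (simp_all add: algebra_simps)
  then have "x * (c * b - a * d) = 0" "y * (c * b - a * d) = 0"
    using assms(2,3) by simp_all
  then have ad: "a * d = c * b" using assms(1) by auto
  show ?thesis
  proof (cases "c = 0")
    case True
    then show ?thesis using that[of d "- b"] False ad by (auto simp: algebra_simps)
  next
    case c: False
    then show ?thesis using that[of c "- a"] ad by (auto simp: algebra_simps)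
  qed
qed

text \<open>With p = (s0, t0) the only common zero on the fibre, the root is simple if the two zero
  loci meet transversally at p. This is \<open>nd\<close>: \<open>\<alpha>\<close> is the direction
  of the base and \<open>\<beta>\<close> that of the fibre, the derivative along the fibre being the
  value at p of the form divided by its linear factor.\<close>

lemma family_resultant_simple_root:
  fixes G Q :: "nat \<Rightarrow> complex poly"
  assumes G: "\<And>k. n < k \<Longrightarrow> G k = 0" and Q: "\<And>k. m < k \<Longrightarrow> Q k = 0" and m: "0 < m"
    and p: "s0 \<noteq> 0 \<or> t0 \<noteq> 0"
    and Gp: "form_eval (Suc n) (spec (Suc n) G u) s0 t0 = 0"
    and Qp: "form_eval (Suc m) (spec (Suc m) Q u) s0 t0 = 0"
    and uniq: "\<And>s t. \<lbrakk>s \<noteq> 0 \<or> t \<noteq> 0; form_eval (Suc n) (spec (Suc n) G u) s t = 0;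
        form_eval (Suc m) (spec (Suc m) Q u) s t = 0\<rbrakk> \<Longrightarrow> t0 * s = s0 * t"
    and nd: "\<And>g q \<alpha> \<beta>. \<lbrakk>short n g; short m q; spec (Suc n) G u = [:t0, - s0:] * g;
        spec (Suc m) Q u = [:t0, - s0:] * q;
        \<alpha> * form_eval (Suc n) (spec (Suc n) (\<lambda>k. pderiv (G k)) u) s0 t0 + \<beta> * form_eval n g s0 t0 = 0;
        \<alpha> * form_eval (Suc m) (spec (Suc m) (\<lambda>k. pderiv (Q k)) u) s0 t0 + \<beta> * form_eval m q s0 t0 = 0\<rbrakk>
        \<Longrightarrow> \<alpha> = 0 \<and> \<beta> = 0"
  shows "poly (pderiv (family_resultant m n G Q)) u \<noteq> 0"
proof -
  define N where "N = m + n"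
  let ?g = "spec (Suc n) G u" and ?q = "spec (Suc m) Q u"
  let ?g' = "spec (Suc n) (\<lambda>k. pderiv (G k)) u" and ?q' = "spec (Suc m) (\<lambda>k. pderiv (Q k)) u"
  \<comment> \<open>Pairing with \<open>w\<close> evaluates at p the form with the given
    coefficients; it kills the image because both specialised forms vanish at p.\<close>
  define w where "w = Matrix.vec N (\<lambda>i. s0 ^ (N - 1 - i) * t0 ^ i)"
  have w: "w \<in> carrier_vec N" by (simp add: w_def)
  have m1: "m = Suc (m - 1)" using m by simp
  have M0: "map_mat (\<lambda>p. poly p u) (sylv m n G Q) = sylv m n (coeff ?g) (coeff ?q)"
    by (subst map_sylv) (use G Q in \<open>auto simp: coeff_spec fun_eq_iff intro!: arg_cong2[of _ _ _ _ "sylv m n"]\<close>)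
  have M1: "map_mat (\<lambda>p. poly (pderiv p) u) (sylv m n G Q) = sylv m n (coeff ?g') (coeff ?q')"
    by (subst map_sylv) (use G Q in \<open>auto simp: coeff_spec fun_eq_iff intro!: arg_cong2[of _ _ _ _ "sylv m n"]\<close>)
  have short': "short (Suc n) ?g'" "short (Suc m) ?q'" "short (Suc n) ?g" "short (Suc m) ?q"
    by (rule short_spec)+
  have pairing: "w \<bullet> (sylv m n (coeff g) (coeff q) *\<^sub>v v) =
      form_eval m (vpoly 0 m v) s0 t0 * form_eval (Suc n) g s0 t0 +
      form_eval n (vpoly m n v) s0 t0 * form_eval (Suc m) q s0 t0"
    if v: "v \<in> carrier_vec N" and g: "short (Suc n) g" and q: "short (Suc m) q" for g q v
  proof -
    have "dim_vec (sylv m n (coeff g) (coeff q) *\<^sub>v v) = N" by (simp add: sylv_def N_def)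
    then have "w \<bullet> (sylv m n (coeff g) (coeff q) *\<^sub>v v) =
        (\<Sum>i<N. vec_index w i * vec_index (sylv m n (coeff g) (coeff q) *\<^sub>v v) i)"
      unfolding scalar_prod_def by (simp add: atLeast0LessThan)
    also have "\<dots> = form_eval N (vpoly 0 m v * g + vpoly m n v * q) s0 t0"
      unfolding form_eval_def
      by (intro sum.cong refl) (use v in \<open>simp add: sylv_mult_vec N_def w_def\<close>)
    also have "\<dots> = form_eval (n + m) (g * vpoly 0 m v) s0 t0 + form_eval (m + n) (q * vpoly m n v) s0 t0"
      by (simp add: form_eval_add N_def ac_simps)
    finally show ?thesis
      by (simp add: form_eval_mult[OF g short_vpoly] form_eval_mult[OF q short_vpoly] mult_ac)
  qed
  have root: "poly (Determinant.det (sylv m n G Q)) u = 0"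
    using family_resultant_root_iff[of n G m Q u] G Q m p Gp Qp
    unfolding family_resultant_def by blast
  have "poly (pderiv (Determinant.det (sylv m n G Q))) u \<noteq> 0"
  proof (rule det_simple_root[where N = N, OF _ w _ _ root], unfold M0 M1)
    show "sylv m n G Q \<in> carrier_mat N N" by (simp add: N_def)
    show "w \<bullet> (sylv m n (coeff ?g) (coeff ?q) *\<^sub>v v) = 0" if "v \<in> carrier_vec N" for v
      using pairing[OF that short'(3,4)] Gp Qp by simp
  next
    fix v assume v: "v \<in> carrier_vec N" "v \<noteq> 0\<^sub>v N" "sylv m n (coeff ?g) (coeff ?q) *\<^sub>v v = 0\<^sub>v N"
    define a where "a = vpoly 0 m v"
    define b where "b = vpoly m n v"
    have sh: "short m a" "short n b" unfolding a_def b_def by (rule short_vpoly)+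
    note ker = sylv_kernel[OF v[unfolded N_def] short'(3,4)]
    have ab: "a \<noteq> 0 \<or> b \<noteq> 0" and syz: "a * ?g + b * ?q = 0"
      using ker by (auto simp: a_def b_def)
    obtain g where g: "short n g" "?g = [:t0, - s0:] * g" using form_root_factor[OF short'(3) p Gp] .
    obtain q where q: "short m q" "?q = [:t0, - s0:] * q" using form_root_factor[OF short'(4) p Qp] .
    have l0: "[:t0, - s0:] \<noteq> 0" using p by auto
    have "[:t0, - s0:] * (a * g + b * q) = 0" using syz unfolding g(2) q(2) by (simp only: algebra_simps)
    then have syz1: "a * g + b * q = 0" using l0 by (metis mult_eq_0_iff)
    let ?e = "\<lambda>k f. form_eval k f s0 t0"
    show "w \<bullet> (sylv m n (coeff ?g') (coeff ?q') *\<^sub>v v) \<noteq> 0"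
    proof
      assume "w \<bullet> (sylv m n (coeff ?g') (coeff ?q') *\<^sub>v v) = 0"
      then have e1: "?e m a * ?e (Suc n) ?g' + ?e n b * ?e (Suc m) ?q' = 0"
        using pairing[OF v(1) short'(1,2)] by (simp add: a_def b_def)
      show False
      proof (cases "?e m a = 0 \<and> ?e n b = 0")
        \<comment> \<open>The values of a and b at p form a left kernel vector of the Jacobian:
          \<open>e1\<close> is the equation for the base direction, and the syzygy divided by the
          linear form gives the one for the fibre.\<close>
        case False
        have "?e (m - 1 + n) (a * g + q * b) = 0" using syz1 by (simp add: mult.commute)
        then have e2: "?e m a * ?e n g + ?e n b * ?e m q = 0"
          using form_eval_mult[of "m - 1" a n g s0 t0] form_eval_mult[of "m - 1" q n b s0 t0] sh g(1) q(1) m1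
          by (simp add: form_eval_add mult_ac)
        from False obtain \<alpha> \<beta> where "\<alpha> \<noteq> 0 \<or> \<beta> \<noteq> 0" "\<alpha> * ?e (Suc n) ?g' + \<beta> * ?e n g = 0"
          "\<alpha> * ?e (Suc m) ?q' + \<beta> * ?e m q = 0" using rank_one_kernel[OF _ e1 e2] by blast
        then show False using nd[OF g(1) q(1) g(2) q(2)] by blast
      next
        \<comment> \<open>Now a second linear factor splits off the syzygy. The reduced forms still
          have a common zero, which is p by uniqueness, so both derivatives along the fibre
          vanish.\<close>
        case True
        have "?e n g = 0 \<and> ?e m q = 0"
        proof -
          have "short (Suc (m - 1)) a" using sh(1) m by simp
          then obtain a1 where a1: "short (m - 1) a1" "a = [:t0, - s0:] * a1"
            using form_root_factor[OF _ p, of "m - 1" a] True m by auto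
          obtain s t where st: "s \<noteq> 0 \<or> t \<noteq> 0" "form_eval n g s t = 0" "form_eval m q s t = 0"
          proof (cases n)
            \<comment> \<open>Here g is zero, and a nonzero \<open>a1\<close> with m - 1
              coefficients forces m to be at least 2, so the reduced q has positive degree.\<close>
            case 0
            then have "b = 0" "g = 0" using sh g by (auto simp: short_0_iff)
            then have "a1 \<noteq> 0" using ab a1 by auto
            then have "m - 1 \<noteq> 0" using a1(1) by (auto simp: short_0_iff)
            then obtain k where "m = Suc (Suc k)" by (cases m; cases "m - 1") auto
            with q(1) obtain s t where "s \<noteq> 0 \<or> t \<noteq> 0" "form_eval m q s t = 0" using form_has_zero by metis
            with that \<open>g = 0\<close> show ?thesis by simp
          next
            case (Suc k)
            then obtain b1 where b1: "short k b1" "b = [:t0, - s0:] * b1"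
              using form_root_factor[OF _ p, of k b] True sh by auto
            have "[:t0, - s0:] * (a1 * g + b1 * q) = 0" using syz1 unfolding a1(2) b1(2) by (simp only: algebra_simps)
            then have syz2: "a1 * g + b1 * q = 0" using l0 by (metis mult_eq_0_iff)
            have "a1 \<noteq> 0 \<or> b1 \<noteq> 0" using ab a1 b1 by auto
            from syzygy_imp_common_zero[OF a1(1) b1(1) this _ _ syz2] that g(1) q(1) Suc m show ?thesis
              by auto
          qed
          have "form_eval (Suc n) ?g s t = 0" "form_eval (Suc m) ?q s t = 0"
            unfolding g(2) q(2) form_eval_linear_mult[OF g(1)] form_eval_linear_mult[OF q(1)] using st by simp_all
          then have "t0 * s = s0 * t" using uniq st(1) by blast
          then show ?thesis using form_eval_parallel[OF st(1) p] st by blast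
        qed
        then show False using nd[OF g(1) q(1) g(2) q(2), of 0 1] by simp
      qed
    qed
  qed
  then show ?thesis by (simp add: family_resultant_def)
qed


section \<open>Evaluation in the homogeneous coordinate ring\<close>

lemma one_neq_two [simp]: "(1::2) \<noteq> 2" "(2::2) \<noteq> 1"
  by simp_all

lemma UNIV_idx: "(UNIV :: idx set) = {(1,1), (2,1), (1,2), (2,2)}"
  using exhaust_2 by (auto simp: UNIV_eq_I)

lemma sum_idx: "(\<Sum>v\<in>(UNIV :: idx set). f v) = f (1,1) + f (2,1) + f (1,2) + f (2,2)"
  for f :: "idx \<Rightarrow> 'a::comm_monoid_add"
  by (simp add: UNIV_idx add.assoc)

lemma prod_idx: "(\<Prod>v\<in>(UNIV :: idx set). f v) = f (1,1) * f (2,1) * f (1,2) * f (2,2)"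
  for f :: "idx \<Rightarrow> 'a::comm_monoid_mult"
  by (simp add: UNIV_idx mult.assoc)

lemma all_idx: "(\<forall>v::idx. R v) \<longleftrightarrow> R (1,1) \<and> R (2,1) \<and> R (1,2) \<and> R (2,2)"
  by (metis (full_types) exhaust_2 prod.exhaust)

definition mono_eval :: "(idx \<Rightarrow>\<^sub>0 nat) \<Rightarrow> cpt \<Rightarrow> complex" where
  "mono_eval m z = (\<Prod>v\<in>UNIV. (z $ v) ^ Poly_Mapping.lookup m v)"

lemma mono_eval_add: "mono_eval (m + m') z = mono_eval m z * mono_eval m' z"
  by (simp add: mono_eval_def lookup_add power_add prod.distrib)

lemma eval_cox_superset:
  assumes "finite K" "Poly_Mapping.keys P \<subseteq> K"
  shows "eval_cox P z = (\<Sum>m\<in>K. Poly_Mapping.lookup P m * mono_eval m z)"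
  unfolding eval_cox_def mono_eval_def[symmetric]
  using assms by (intro sum.mono_neutral_left) (auto simp: in_keys_iff)

lemma eval_cox_0 [simp]: "eval_cox 0 z = 0"
  by (simp add: eval_cox_def)

lemma eval_cox_single: "eval_cox (Poly_Mapping.single m c) z = c * mono_eval m z"
  by (subst eval_cox_superset[of "{m}"]) auto

lemma eval_cox_add: "eval_cox (P + Q) z = eval_cox P z + eval_cox Q z"
proof -
  let ?K = "Poly_Mapping.keys P \<union> Poly_Mapping.keys Q"
  have "Poly_Mapping.keys (P + Q) \<subseteq> ?K" by (rule keys_add)
  then show ?thesis
    by (simp add: eval_cox_superset[of ?K] lookup_add distrib_right sum.distrib)
qed

lemma eval_cox_sum: "eval_cox (\<Sum>i\<in>I. f i) z = (\<Sum>i\<in>I. eval_cox (f i) z)"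
  by (induction I rule: infinite_finite_induct) (simp_all add: eval_cox_add)

lemma cox_sum_monomials: "(P::cox) = (\<Sum>m\<in>Poly_Mapping.keys P. Poly_Mapping.single m (Poly_Mapping.lookup P m))"
proof (rule poly_mapping_eqI)
  fix k
  have "Poly_Mapping.lookup (\<Sum>m\<in>Poly_Mapping.keys P. Poly_Mapping.single m (Poly_Mapping.lookup P m)) k
      = (\<Sum>m\<in>Poly_Mapping.keys P. if m = k then Poly_Mapping.lookup P m else 0)"
    by (simp add: lookup_sum lookup_single when_def)
  also have "\<dots> = Poly_Mapping.lookup P k"
    by (simp add: in_keys_iff)
  finally show "Poly_Mapping.lookup P k = Poly_Mapping.lookup (\<Sum>m\<in>Poly_Mapping.keys P. Poly_Mapping.single m (Poly_Mapping.lookup P m)) k"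
    by simp
qed

lemma eval_cox_mult: "eval_cox (P * Q) z = eval_cox P z * eval_cox Q z"
proof -
  let ?f = "\<lambda>R m. Poly_Mapping.single m (Poly_Mapping.lookup (R::cox) m)"
  have "P * Q = (\<Sum>m\<in>Poly_Mapping.keys P. ?f P m) * (\<Sum>m\<in>Poly_Mapping.keys Q. ?f Q m)"
    using cox_sum_monomials by metis
  then have "eval_cox (P * Q) z = (\<Sum>m\<in>Poly_Mapping.keys P. \<Sum>m'\<in>Poly_Mapping.keys Q.
      eval_cox (?f P m) z * eval_cox (?f Q m') z)"
    by (simp add: sum_product eval_cox_sum mult_single eval_cox_single mono_eval_add mult_ac)
  also have "\<dots> = (\<Sum>m\<in>Poly_Mapping.keys P. eval_cox (?f P m) z) * (\<Sum>m\<in>Poly_Mapping.keys Q. eval_cox (?f Q m) z)"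
    by (simp add: sum_product)
  finally show ?thesis
    using cox_sum_monomials[of P] cox_sum_monomials[of Q] by (metis eval_cox_sum)
qed

lemma eval_cox_1 [simp]: "eval_cox 1 z = 1"
  using eval_cox_single[of 0 1 z] by (simp add: mono_eval_def)

lemma eval_cox_const [simp]: "eval_cox (const c) z = c"
  by (simp add: const_def eval_cox_single mono_eval_def)

lemma eval_cox_of_nat [simp]: "eval_cox (of_nat k) z = of_nat k"
  by (induction k) (simp_all add: eval_cox_add)

lemma eval_cox_uminus: "eval_cox (- P) z = - eval_cox P z"
  using eval_cox_add[of P "- P" z] by (simp add: eq_neg_iff_add_eq_0 add.commute)

lemma eval_cox_zvar [simp]: "eval_cox (zvar v) z = z $ v"
proof -
  have "mono_eval (Poly_Mapping.single v 1) z = (\<Prod>w\<in>UNIV. if w = v then z $ w else 1)"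
    unfolding mono_eval_def by (intro prod.cong refl) (simp add: lookup_single when_def)
  then show ?thesis by (simp add: zvar_def eval_cox_single)
qed

lemma eval_cox_zvar_power [simp]: "eval_cox (zvar v ^ k) z = (z $ v) ^ k"
  by (induction k) (simp_all add: eval_cox_mult)

lemma continuous_on_eval_cox: "continuous_on A (eval_cox P)"
  unfolding eval_cox_def by (intro continuous_intros)

lemma eval_cox_line: "\<exists>p. \<forall>\<epsilon>. eval_cox P (z + \<epsilon> *s x) = poly p \<epsilon>"
proof -
  let ?p = "\<Sum>m\<in>Poly_Mapping.keys P. Polynomial.smult (Poly_Mapping.lookup P m)
    (\<Prod>v\<in>UNIV. [:z $ v, x $ v:] ^ Poly_Mapping.lookup m v)"
  have "eval_cox P (z + \<epsilon> *s x) = poly ?p \<epsilon>" for \<epsilon>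
    by (simp add: eval_cox_def poly_sum poly_prod)
  then show ?thesis by blast
qed

section \<open>Homogeneity and the torus action\<close>

lemma homogeneous_monomial:
  assumes "homogeneous r e P" "m \<in> Poly_Mapping.keys P"
  shows "int (Poly_Mapping.lookup m (1,1)) + int (Poly_Mapping.lookup m (2,1)) + int (Poly_Mapping.lookup m (2,2)) * int r = fst e"
    and "int (Poly_Mapping.lookup m (1,2)) + int (Poly_Mapping.lookup m (2,2)) = snd e"
  using assms by (auto simp: homogeneous_def sum_idx zdeg_def)

lemma homogeneous_negative:
  assumes "homogeneous r e P" "fst e < 0 \<or> snd e < 0"
  shows "P = 0"
proof (rule ccontr)
  assume "P \<noteq> 0"
  then obtain m where m: "m \<in> Poly_Mapping.keys P" by (metis keys_eq_empty ex_in_conv)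
  have "0 \<le> fst e" "0 \<le> snd e"
    by (simp_all flip: homogeneous_monomial[OF assms(1) m])
  then show False using assms(2) by simp
qed

text \<open>The exponents are integers since the zero polynomial is homogeneous of negative degrees
  as well.\<close>

lemma eval_cox_act:
  assumes P: "homogeneous r e P" and "l \<noteq> 0" "m \<noteq> 0"
  shows "eval_cox P (act r l m z) = l powi fst e * m powi snd e * eval_cox P z"
proof -
  have "mono_eval k (act r l m z) = l powi fst e * m powi snd e * mono_eval k z"
    if k: "k \<in> Poly_Mapping.keys P" for k
  proof -
    have "mono_eval k (act r l m z) = (\<Prod>v\<in>UNIV. l ^ (Poly_Mapping.lookup k v * fst (zdeg r v))
        * m ^ (Poly_Mapping.lookup k v * snd (zdeg r v)) * (z $ v) ^ Poly_Mapping.lookup k v)"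
      unfolding mono_eval_def by (intro prod.cong refl) (simp add: act_def power_mult_distrib mult.commute flip: power_mult)
    also have "\<dots> = l ^ (\<Sum>v\<in>UNIV. Poly_Mapping.lookup k v * fst (zdeg r v))
        * m ^ (\<Sum>v\<in>UNIV. Poly_Mapping.lookup k v * snd (zdeg r v)) * mono_eval k z"
      by (simp add: prod.distrib mono_eval_def power_sum)
    also have "l ^ (\<Sum>v\<in>UNIV. Poly_Mapping.lookup k v * fst (zdeg r v)) = l powi fst e"
      using P k by (simp add: homogeneous_def flip: power_int_of_nat)
    also have "m ^ (\<Sum>v\<in>UNIV. Poly_Mapping.lookup k v * snd (zdeg r v)) = m powi snd e"
      using P k by (simp add: homogeneous_def flip: power_int_of_nat)
    finally show ?thesis .
  qed
  then show ?thesis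
    unfolding eval_cox_superset[OF finite_keys order_refl] sum_distrib_left
    by (intro sum.cong refl) (simp add: mult_ac)
qed


section \<open>Orbits\<close>

lemma act_act: "act r l m (act r l' m' z) = act r (l * l') (m * m') z"
  by (simp add: act_def vec_eq_iff power_mult_distrib mult_ac)

lemma act_component: "act r l m z $ v = l ^ fst (zdeg r v) * m ^ snd (zdeg r v) * z $ v"
  by (simp add: act_def)

lemma in_hpoint_self: "z \<in> hpoint r z"
  unfolding hpoint_def by (force intro: exI[of _ 1] simp: act_def Finite_Cartesian_Product.vec_eq_iff)

lemma hpoint_act [simp]:
  assumes "l \<noteq> 0" "m \<noteq> 0"
  shows "hpoint r (act r l m z) = hpoint r z"
proof
  show "hpoint r (act r l m z) \<subseteq> hpoint r z"
  proof
    fix w assume "w \<in> hpoint r (act r l m z)"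
    then obtain l' m' where "w = act r l' m' (act r l m z)" "l' \<noteq> 0" "m' \<noteq> 0" unfolding hpoint_def by auto
    then have "w = act r (l' * l) (m' * m) z" "l' * l \<noteq> 0" "m' * m \<noteq> 0" using assms by (simp_all add: act_act)
    then show "w \<in> hpoint r z" unfolding hpoint_def by blast
  qed
  show "hpoint r z \<subseteq> hpoint r (act r l m z)"
  proof
    fix w assume "w \<in> hpoint r z"
    then obtain l' m' where "w = act r l' m' z" "l' \<noteq> 0" "m' \<noteq> 0" unfolding hpoint_def by auto
    then have "w = act r (l' / l) (m' / m) (act r l m z)" "l' / l \<noteq> 0" "m' / m \<noteq> 0"
      using assms by (simp_all add: act_act)
    then show "w \<in> hpoint r (act r l m z)" unfolding hpoint_def by blast
  qed
qed

lemma hpoint_eqD: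
  assumes "hpoint r w = hpoint r z"
  obtains l m where "l \<noteq> 0" "m \<noteq> 0" "w = act r l m z"
  using in_hpoint_self[of w r] assms unfolding hpoint_def by auto

lemma act_irrelevant [simp]:
  "l \<noteq> 0 \<Longrightarrow> m \<noteq> 0 \<Longrightarrow> act r l m z \<in> irrelevant \<longleftrightarrow> z \<in> irrelevant"
  by (simp add: irrelevant_def act_component zdeg_def)

definition form_zeros :: "(idx \<Rightarrow> cox) \<Rightarrow> cpt set" where
  "form_zeros \<omega> = {z. z \<notin> irrelevant \<and> (\<forall>v. eval_cox (\<omega> v) z = 0)}"

lemma Sing_eq: "Sing r \<omega> = hpoint r ` form_zeros \<omega>"
  by (simp add: Sing_def form_zeros_def)

lemma form_zeros_act:
  assumes "twisted_form r d \<omega>" "l \<noteq> 0" "m \<noteq> 0"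
  shows "act r l m z \<in> form_zeros \<omega> \<longleftrightarrow> z \<in> form_zeros \<omega>"
proof -
  have "eval_cox (\<omega> v) (act r l m z) = 0 \<longleftrightarrow> eval_cox (\<omega> v) z = 0" for v
  proof -
    have "homogeneous r (fst d - int (fst (zdeg r v)), snd d - int (snd (zdeg r v))) (\<omega> v)"
      using assms(1) unfolding twisted_form_def by blast
    from eval_cox_act[OF this assms(2,3)] show ?thesis using assms(2,3) by (simp add: power_int_eq_0_iff)
  qed
  then show ?thesis using assms by (simp add: form_zeros_def)
qed

lemma hpoint_in_Sing_iff:
  assumes "twisted_form r d \<omega>"
  shows "hpoint r z \<in> Sing r \<omega> \<longleftrightarrow> z \<in> form_zeros \<omega>"
proof
  assume "hpoint r z \<in> Sing r \<omega>"
  then obtain w where w: "w \<in> form_zeros \<omega>" "hpoint r z = hpoint r w" unfolding Sing_eq by auto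
  then obtain l m where "l \<noteq> 0" "m \<noteq> 0" "z = act r l m w" using hpoint_eqD by metis
  then show "z \<in> form_zeros \<omega>" using w form_zeros_act[OF assms] by simp
qed (simp add: Sing_eq)

lemma closed_irrelevant: "closed irrelevant"
  unfolding irrelevant_def
  by (intro closed_Un closed_Collect_conj closed_Collect_eq continuous_intros)

lemma openin_hirzebruch:
  "openin (quotient_top (- irrelevant) (hpoint r)) (hpoint r ` (- irrelevant))"
proof -
  have "{a \<in> - irrelevant. hpoint r a \<in> hpoint r ` (- irrelevant)} = - irrelevant" by auto
  then show ?thesis using closed_irrelevant by (simp add: openin_quotient_top open_Compl)
qed

section \<open>Compactness of the surface and finiteness of the singular set\<close>

definition sphere_reps :: "cpt set" where
  "sphere_reps = {z. (cmod (z $ (1,1)))\<^sup>2 + (cmod (z $ (2,1)))\<^sup>2 = 1 \<and>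
     (cmod (z $ (1,2)))\<^sup>2 + (cmod (z $ (2,2)))\<^sup>2 = 1}"

lemma compact_sphere_reps: "compact sphere_reps"
proof -
  have "closed sphere_reps"
    unfolding sphere_reps_def by (intro closed_Collect_conj closed_Collect_eq continuous_intros)
  moreover have "bounded sphere_reps"
  proof (rule boundedI)
    fix z assume z: "z \<in> sphere_reps"
    have *: "a \<le> 1" if "a\<^sup>2 + b\<^sup>2 = 1" for a b :: real
    proof -
      have "a\<^sup>2 \<le> 1" using that zero_le_power2[of b] by linarith
      then show ?thesis by (simp add: abs_square_le_1)
    qed
    have "cmod (z $ v) \<le> 1" for v
    proof -
      have "\<forall>v. cmod (z $ v) \<le> 1"
        unfolding all_idx using z * unfolding sphere_reps_def by (auto simp: add.commute)
      then show ?thesis by blast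
    qed
    then have "(\<Sum>v\<in>UNIV. cmod (z $ v)) \<le> (\<Sum>v\<in>(UNIV::idx set). 1)" by (intro sum_mono) auto
    then show "norm z \<le> real (card (UNIV::idx set))"
      using L2_set_le_sum[of UNIV "\<lambda>v. cmod (z $ v)"] by (simp add: norm_vec_def)
  qed
  ultimately show ?thesis using compact_eq_bounded_closed by blast
qed

lemma sphere_reps_relevant: "sphere_reps \<inter> irrelevant = {}"
  by (auto simp: sphere_reps_def irrelevant_def)

text \<open>The factor \<open>l\<close> normalises the base coordinates but also multiplies z22 by
  \<open>l ^ r\<close>; hence \<open>m\<close> is computed from the fibre coordinates as already
  changed.\<close>

lemma sphere_reps_meets_orbit:
  assumes "z \<notin> irrelevant"
  obtains l m where "l \<noteq> 0" "m \<noteq> 0" "act r l m z \<in> sphere_reps"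
proof -
  define a where "a = sqrt ((cmod (z $ (1,1)))\<^sup>2 + (cmod (z $ (2,1)))\<^sup>2)"
  define l where "l = complex_of_real (1 / a)"
  define b where "b = sqrt ((cmod (z $ (1,2)))\<^sup>2 + (cmod (l ^ r * z $ (2,2)))\<^sup>2)"
  define m where "m = complex_of_real (1 / b)"
  have a: "a > 0" using assms by (auto simp: a_def irrelevant_def sum_power2_gt_zero_iff)
  then have l: "l \<noteq> 0" by (simp add: l_def)
  have b: "b > 0" using assms l by (auto simp: b_def irrelevant_def sum_power2_gt_zero_iff)
  have normalize: "(cmod (complex_of_real (1 / c) * x))\<^sup>2 + (cmod (complex_of_real (1 / c) * y))\<^sup>2 = 1"
    if "c > 0" "c = sqrt ((cmod x)\<^sup>2 + (cmod y)\<^sup>2)" for c x y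
  proof -
    have "c\<^sup>2 = (cmod x)\<^sup>2 + (cmod y)\<^sup>2" using that(2) by simp
    moreover have "c\<^sup>2 \<noteq> 0" using that(1) by simp
    ultimately show ?thesis
      by (simp add: norm_mult norm_divide power_mult_distrib power_divide flip: add_divide_distrib)
  qed
  have "act r l m z \<in> sphere_reps"
    using normalize[OF a a_def, folded l_def] normalize[OF b b_def, folded m_def]
    by (simp add: sphere_reps_def act_component zdeg_def mult_ac)
  moreover have "m \<noteq> 0" using b by (simp add: m_def)
  ultimately show ?thesis using that l by blast
qed

text \<open>Infinitely many singularities would accumulate at a singularity by compactness. The
  accumulation is found among representatives on the spheres and then passes to the quotient
  topology, whose open sets are tested upstairs.\<close>

lemma foliation_finite_Sing:
  assumes F: "foliation r d \<omega>"
  shows "finite (Sing r \<omega>)"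
proof (rule ccontr)
  assume inf: "infinite (Sing r \<omega>)"
  let ?X = "quotient_top (- irrelevant) (hpoint r)"
  let ?C = "sphere_reps \<inter> (\<Inter>v. {z. eval_cox (\<omega> v) z = 0})"
  have tw: "twisted_form r d \<omega>" using F by (simp add: foliation_def)
  have C: "?C \<subseteq> form_zeros \<omega>" using sphere_reps_relevant by (auto simp: form_zeros_def)
  have "closed {z. eval_cox (\<omega> v) z = 0}" for v
    by (intro closed_Collect_eq continuous_on_eval_cox continuous_on_const)
  then have comp: "compact ?C" using compact_sphere_reps by (intro compact_Int_closed closed_INT) auto
  have "\<exists>z\<in>?C. hpoint r z = p" if "p \<in> Sing r \<omega>" for p
  proof -
    obtain w where w: "w \<in> form_zeros \<omega>" "p = hpoint r w" using \<open>p \<in> Sing r \<omega>\<close> unfolding Sing_eq by blast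
    then have "w \<notin> irrelevant" by (simp add: form_zeros_def)
    then obtain l m where lm: "l \<noteq> 0" "m \<noteq> 0" "act r l m w \<in> sphere_reps"
      using sphere_reps_meets_orbit by blast
    then have "act r l m w \<in> form_zeros \<omega>" using form_zeros_act[OF tw] w by blast
    then have "act r l m w \<in> ?C" using lm by (simp add: form_zeros_def)
    then show ?thesis using lm w by (intro bexI[of _ "act r l m w"]) simp_all
  qed
  then obtain \<rho> where \<rho>: "\<And>p. p \<in> Sing r \<omega> \<Longrightarrow> \<rho> p \<in> ?C" "\<And>p. p \<in> Sing r \<omega> \<Longrightarrow> hpoint r (\<rho> p) = p"
    by metis
  have "inj_on \<rho> (Sing r \<omega>)" using \<rho>(2) by (metis inj_onI)
  then have inf': "infinite (\<rho> ` Sing r \<omega>)" using inf finite_imageD by blast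
  have "\<rho> ` Sing r \<omega> \<subseteq> ?C" using \<rho>(1) by (rule image_subsetI)
  from Heine_Borel_imp_Bolzano_Weierstrass[OF comp inf' this]
  obtain x where x: "x \<in> ?C" "x islimpt \<rho> ` Sing r \<omega>" ..
  define p where "p = hpoint r x"
  have rel: "x \<notin> irrelevant" using x(1) C by (auto simp: form_zeros_def)
  \<comment> \<open>Isolation concerns singularities other than \<open>p\<close>; dropping the
    single representative of \<open>p\<close> does not affect the limit point.\<close>
  have "\<rho> ` Sing r \<omega> \<subseteq> insert (\<rho> p) (\<rho> ` (Sing r \<omega> - {p}))" by blast
  with x(2) have "x islimpt insert (\<rho> p) (\<rho> ` (Sing r \<omega> - {p}))" by (rule islimpt_subset)
  then have lim: "x islimpt \<rho> ` (Sing r \<omega> - {p})" by (simp only: islimpt_insert)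
  have pS: "p \<in> Sing r \<omega>" using x(1) C by (auto simp: p_def Sing_eq)
  have "p \<in> ?X derived_set_of Sing r \<omega>"
    unfolding in_derived_set_of
  proof (intro conjI allI impI)
    show "p \<in> topspace ?X"
      using openin_hirzebruch[of r] openin_subset rel unfolding p_def by blast
    fix T assume T: "p \<in> T \<and> openin ?X T"
    then have op: "open {a \<in> - irrelevant. hpoint r a \<in> T}" by (simp add: openin_quotient_top)
    have "x \<in> {a \<in> - irrelevant. hpoint r a \<in> T}" using T rel by (simp add: p_def)
    from islimptE[OF lim this op] obtain y where "y \<in> \<rho> ` (Sing r \<omega> - {p})"
      "y \<in> {a \<in> - irrelevant. hpoint r a \<in> T}" .
    then show "\<exists>y. y \<noteq> p \<and> y \<in> Sing r \<omega> \<and> y \<in> T" using \<rho>(2) by auto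
  qed
  then show False using F pS by (auto simp: foliation_def)
qed


section \<open>Charts\<close>

text \<open>Chart \<open>i\<close> has the base coordinate \<open>u = z\<^sub>i\<^sub>,\<^sub>1\<close>, the other base coordinate being normalised to 1, and
  the homogeneous fibre coordinates \<open>[s : t]\<close>.\<close>

definition cpoint :: "2 \<Rightarrow> complex \<Rightarrow> complex \<Rightarrow> complex \<Rightarrow> cpt" where
  "cpoint i u s t = (\<chi> v. if snd v = 1 then (if fst v = i then u else 1) else if fst v = 1 then s else t)"

lemma cpoint_simps [simp]:
  "cpoint i u s t $ (i, 1) = u"
  "i' \<noteq> i \<Longrightarrow> cpoint i u s t $ (i', 1) = 1"
  "cpoint i u s t $ (1, 2) = s"
  "cpoint i u s t $ (2, 2) = t"
  by (simp_all add: cpoint_def)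

lemma all_idx_charts:
  assumes "i \<noteq> i'"
  shows "(\<forall>v::idx. R v) \<longleftrightarrow> R (i, 1) \<and> R (i', 1) \<and> R (1, 2) \<and> R (2, 2)"
  unfolding all_idx using assms two_cases[of i] two_cases[of i'] by auto

lemma cpoint_irrelevant_iff [simp]: "cpoint i u s t \<in> irrelevant \<longleftrightarrow> s = 0 \<and> t = 0"
  using two_cases[of i] by (auto simp: irrelevant_def)

lemma zdeg_simps [simp]:
  "zdeg r (i, 1) = (1, 0)" "zdeg r (1, 2) = (0, 1)" "zdeg r (2, 2) = (r, 1)"
  by (simp_all add: zdeg_def)

lemma chart_exists:
  assumes "z \<notin> irrelevant"
  obtains i u s t where "s \<noteq> 0 \<or> t \<noteq> 0" "hpoint r z = hpoint r (cpoint i u s t)"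
proof -
  have "z $ (1,1) \<noteq> 0 \<or> z $ (2,1) \<noteq> 0" using assms by (auto simp: irrelevant_def)
  then obtain i i' :: 2 where i: "i \<noteq> i'" "z $ (i', 1) \<noteq> 0"
    using one_neq_two by metis
  define c where "c = 1 / z $ (i', 1)"
  have c: "c \<noteq> 0" using i by (simp add: c_def)
  have "\<forall>v. act r c 1 z $ v = cpoint i (c * z $ (i, 1)) (z $ (1, 2)) (c ^ r * z $ (2, 2)) $ v"
    unfolding all_idx_charts[OF i(1)] using i by (simp add: act_component c_def)
  then have eq: "act r c 1 z = cpoint i (c * z $ (i, 1)) (z $ (1, 2)) (c ^ r * z $ (2, 2))"
    by (rule Finite_Cartesian_Product.vec_eq_iff[THEN iffD2])
  have "z $ (1, 2) \<noteq> 0 \<or> c ^ r * z $ (2, 2) \<noteq> 0" using assms c by (auto simp: irrelevant_def)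
  moreover have "hpoint r z = hpoint r (act r c 1 z)" using c by simp
  ultimately show ?thesis using that unfolding eq by blast
qed

text \<open>The normalised base coordinate forces \<open>l = 1\<close>, so within a chart only the
  common scaling of s and t is left.\<close>

lemma hpoint_cpoint_eqD:
  assumes "hpoint r (cpoint i u s t) = hpoint r (cpoint i u' s' t')"
  shows "u = u'" "t' * s = s' * t"
proof -
  obtain l m where lm: "l \<noteq> 0" "m \<noteq> 0" and eq: "cpoint i u s t = act r l m (cpoint i u' s' t')"
    using hpoint_eqD[OF assms] .
  have c: "cpoint i u s t $ v = l ^ fst (zdeg r v) * m ^ snd (zdeg r v) * cpoint i u' s' t' $ v" for v
    by (simp add: eq act_component)
  obtain i' where i': "i' \<noteq> i" using one_neq_two by metis
  have "l = 1" using c[of "(i', 1)"] i' by simp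
  then show "u = u'" "t' * s = s' * t" using c[of "(i, 1)"] c[of "(1, 2)"] c[of "(2, 2)"] by simp_all
qed

lemma hpoint_cpoint_transition:
  assumes "i \<noteq> i'" "hpoint r (cpoint i u s t) = hpoint r (cpoint i' u' s' t')"
  shows "u * u' = 1"
proof -
  obtain l m where lm: "l \<noteq> 0" "m \<noteq> 0" and eq: "cpoint i u s t = act r l m (cpoint i' u' s' t')"
    using hpoint_eqD[OF assms(2)] .
  have c: "cpoint i u s t $ v = l ^ fst (zdeg r v) * m ^ snd (zdeg r v) * cpoint i' u' s' t' $ v" for v
    by (simp add: eq act_component)
  show ?thesis using c[of "(i, 1)"] c[of "(i', 1)"] assms(1) by (simp add: mult.commute)
qed

text \<open>The coefficient of t^k in the chart, as a polynomial in the base coordinate. The other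
  base coordinate is 1 there and the exponent of s is determined by the degree, so two exponents
  suffice.\<close>

definition coefp :: "2 \<Rightarrow> cox \<Rightarrow> nat \<Rightarrow> complex poly" where
  "coefp i P k = (\<Sum>m\<in>Poly_Mapping.keys P. if Poly_Mapping.lookup m (2, 2) = k
     then monom (Poly_Mapping.lookup P m) (Poly_Mapping.lookup m (i, 1)) else 0)"

lemma poly_coefp: "poly (coefp i P k) u = (\<Sum>m\<in>Poly_Mapping.keys P. if Poly_Mapping.lookup m (2, 2) = k
     then Poly_Mapping.lookup P m * u ^ Poly_Mapping.lookup m (i, 1) else 0)"
  by (simp add: coefp_def poly_sum poly_monom if_distrib[of "\<lambda>p. poly p u"] cong: if_cong)

lemma coefp_eq_0:
  assumes "homogeneous r e P" "snd e < int N" "N \<le> k"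
  shows "coefp i P k = 0"
  unfolding coefp_def
proof (intro sum.neutral ballI)
  fix m assume "m \<in> Poly_Mapping.keys P"
  from homogeneous_monomial(2)[OF assms(1) this] assms(2,3)
  show "(if Poly_Mapping.lookup m (2, 2) = k
     then monom (Poly_Mapping.lookup P m) (Poly_Mapping.lookup m (i, 1)) else 0) = 0" by auto
qed

lemma mono_eval_cpoint:
  "mono_eval m (cpoint i u s t) = u ^ Poly_Mapping.lookup m (i, 1) *
     s ^ Poly_Mapping.lookup m (1, 2) * t ^ Poly_Mapping.lookup m (2, 2)"
  using two_cases[of i] by (auto simp: mono_eval_def prod_idx)

lemma eval_cox_cpoint:
  assumes P: "homogeneous r e P" and N: "snd e = int N - 1"
  shows "eval_cox P (cpoint i u s t) = (\<Sum>k<N. poly (coefp i P k) u * s ^ (N - 1 - k) * t ^ k)"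
proof -
  have "eval_cox P (cpoint i u s t) = (\<Sum>m\<in>Poly_Mapping.keys P. \<Sum>k<N. if Poly_Mapping.lookup m (2, 2) = k
      then Poly_Mapping.lookup P m * u ^ Poly_Mapping.lookup m (i, 1) * s ^ (N - 1 - k) * t ^ k else 0)"
    unfolding eval_cox_superset[OF finite_keys order_refl]
  proof (intro sum.cong refl)
    fix m assume "m \<in> Poly_Mapping.keys P"
    then have "Poly_Mapping.lookup m (2, 2) < N"
      "Poly_Mapping.lookup m (1, 2) = N - 1 - Poly_Mapping.lookup m (2, 2)"
      using homogeneous_monomial(2)[OF P] N by fastforce+
    then show "Poly_Mapping.lookup P m * mono_eval m (cpoint i u s t) =
      (\<Sum>k<N. if Poly_Mapping.lookup m (2, 2) = k
      then Poly_Mapping.lookup P m * u ^ Poly_Mapping.lookup m (i, 1) * s ^ (N - 1 - k) * t ^ k else 0)"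
      by (simp add: mono_eval_cpoint mult.assoc)
  qed
  also have "\<dots> = (\<Sum>k<N. poly (coefp i P k) u * s ^ (N - 1 - k) * t ^ k)"
    unfolding poly_coefp sum_distrib_right by (subst sum.swap) (intro sum.cong refl, simp)
  finally show ?thesis .
qed

text \<open>In a term with t^k the exponents of the two base coordinates add up to
  \<open>fst e - r k\<close>, so a change of chart reverses the coefficient polynomial with respect
  to that degree.\<close>

lemma coefp_transition:
  assumes P: "homogeneous r e P" and i: "i \<noteq> i'" and u: "u \<noteq> 0"
  shows "poly (coefp i P k) u = u powi (fst e - int (r * k)) * poly (coefp i' P k) (1 / u)"
  unfolding poly_coefp sum_distrib_left
proof (intro sum.cong refl)
  fix m assume m: "m \<in> Poly_Mapping.keys P"
  have "u ^ Poly_Mapping.lookup m (i, 1) = u powi (fst e - int (r * k)) * (1 / u) ^ Poly_Mapping.lookup m (i', 1)"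
    if k: "Poly_Mapping.lookup m (2, 2) = k"
  proof -
    have "int (Poly_Mapping.lookup m (i, 1)) = fst e - int (r * k) - int (Poly_Mapping.lookup m (i', 1))"
      using homogeneous_monomial(1)[OF P m] i two_cases[of i] two_cases[of i'] k
      by (auto simp: mult.commute)
    then have "u powi int (Poly_Mapping.lookup m (i, 1)) = u powi (fst e - int (r * k)) / u powi int (Poly_Mapping.lookup m (i', 1))"
      using u by (simp add: power_int_diff)
    then show ?thesis by (simp add: power_one_over)
  qed
  then show "(if Poly_Mapping.lookup m (2, 2) = k then Poly_Mapping.lookup P m * u ^ Poly_Mapping.lookup m (i, 1) else 0) =
    u powi (fst e - int (r * k)) * (if Poly_Mapping.lookup m (2, 2) = k
      then Poly_Mapping.lookup P m * (1 / u) ^ Poly_Mapping.lookup m (i', 1) else 0)"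
    by simp
qed


text \<open>The contraction with \<open>R2\<close> gives \<open>P\<^sub>1\<^sub>,\<^sub>2 = t g\<close> and \<open>P\<^sub>2\<^sub>,\<^sub>2 = - s g\<close>; \<open>Gco i \<omega>\<close> lists the coefficients of \<open>g\<close>
  as a form in \<open>(s, t)\<close>. With \<open>Qco i \<omega>\<close>, those of \<open>P\<^sub>i\<^sub>,\<^sub>1\<close>, it cuts out the singularities in the chart.\<close>

definition Gco :: "2 \<Rightarrow> (idx \<Rightarrow> cox) \<Rightarrow> nat \<Rightarrow> complex poly" where
  "Gco i \<omega> k = coefp i (\<omega> (1, 2)) (Suc k)"

definition Qco :: "2 \<Rightarrow> (idx \<Rightarrow> cox) \<Rightarrow> nat \<Rightarrow> complex poly" where
  "Qco i \<omega> k = coefp i (\<omega> (i, 1)) k"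

section \<open>A twisted form in the two charts\<close>

context
  fixes r :: nat and d1 :: int and D :: nat and \<omega> :: "idx \<Rightarrow> cox"
  assumes tw: "twisted_form r (d1, int D) \<omega>"
begin

lemma hom_base: "homogeneous r (d1 - 1, int D) (\<omega> (i, 1))"
  using tw unfolding twisted_form_def by (metis fst_conv snd_conv of_nat_0 of_nat_1 diff_zero zdeg_simps(1))

lemma hom_fibre: "homogeneous r (d1, int D - 1) (\<omega> (1, 2))" "homogeneous r (d1 - int r, int D - 1) (\<omega> (2, 2))"
  using tw unfolding twisted_form_def by (metis fst_conv snd_conv of_nat_0 of_nat_1 diff_zero zdeg_simps(2,3))+

lemma contract_R2: "z $ (1, 2) * eval_cox (\<omega> (1, 2)) z + z $ (2, 2) * eval_cox (\<omega> (2, 2)) z = 0"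
proof -
  have "eval_cox (contract R2 \<omega>) z = 0" using tw by (simp add: twisted_form_def)
  then show ?thesis by (simp add: contract_def R2_def sum_idx eval_cox_add eval_cox_mult)
qed

lemma contract_R1: "z $ (1, 1) * eval_cox (\<omega> (1, 1)) z + z $ (2, 1) * eval_cox (\<omega> (2, 1)) z
    + of_nat r * z $ (2, 2) * eval_cox (\<omega> (2, 2)) z = 0"
proof -
  have "eval_cox (contract (R1 r) \<omega>) z = 0" using tw by (simp add: twisted_form_def)
  then show ?thesis by (simp add: contract_def R1_def sum_idx eval_cox_add eval_cox_mult)
qed

lemma Gco_eq_0: "D \<le> Suc k \<Longrightarrow> Gco i \<omega> k = 0"
  unfolding Gco_def by (rule coefp_eq_0[OF hom_fibre(1)]) auto

lemma Qco_eq_0: "D < k \<Longrightarrow> Qco i \<omega> k = 0"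
  unfolding Qco_def by (rule coefp_eq_0[OF hom_base, of "Suc D"]) auto

lemma poly_coefp_spec:
  assumes "homogeneous r e P" "snd e = int N - 1"
  shows "eval_cox P (cpoint i u 1 t) = poly (spec N (coefp i P) u) t"
  by (simp add: eval_cox_cpoint[OF assms] spec_def poly_sum poly_monom)

text \<open>At s = 1 the contraction with \<open>R2\<close> says that P_s + t P_t = 0 on every
  fibre; comparing powers of t gives the shift by one between the two lists.\<close>

lemma coefp_fibre:
  shows "coefp i (\<omega> (1, 2)) 0 = 0" and "coefp i (\<omega> (2, 2)) k = - Gco i \<omega> k"
proof -
  let ?A = "\<lambda>u. spec D (coefp i (\<omega> (1, 2))) u" and ?B = "\<lambda>u. spec D (coefp i (\<omega> (2, 2))) u"
  have "?A u + pCons 0 (?B u) = 0" for u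
  proof -
    have "poly (?A u + pCons 0 (?B u)) t = 0" for t
      using contract_R2[of "cpoint i u 1 t"]
        poly_coefp_spec[OF hom_fibre(1), of D i u t] poly_coefp_spec[OF hom_fibre(2), of D i u t]
      by (simp add: mult.commute)
    then show ?thesis using poly_all_0_iff_0 by blast
  qed
  then have *: "coeff (?A u) j + coeff (pCons 0 (?B u)) j = 0" for u j
    by (metis coeff_0 coeff_add)
  have vanish: "coefp i (\<omega> (1, 2)) j = 0" "coefp i (\<omega> (2, 2)) j = 0" if "D \<le> j" for j
    using that coefp_eq_0[OF hom_fibre(1), of D j] coefp_eq_0[OF hom_fibre(2), of D j] by auto
  have A: "coeff (?A u) j = poly (coefp i (\<omega> (1, 2)) j) u" for u j
    using vanish by (auto simp: coeff_spec)
  have B: "coeff (?B u) j = poly (coefp i (\<omega> (2, 2)) j) u" for u j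
    using vanish by (auto simp: coeff_spec)
  have "poly (coefp i (\<omega> (1, 2)) 0) u = 0" for u using *[of u 0] A by simp
  then show "coefp i (\<omega> (1, 2)) 0 = 0" using poly_all_0_iff_0 by blast
  have "poly (coefp i (\<omega> (2, 2)) k + Gco i \<omega> k) u = 0" for u
    using *[of u "Suc k"] A B by (simp add: Gco_def add.commute)
  then have "coefp i (\<omega> (2, 2)) k + Gco i \<omega> k = 0" using poly_all_0_iff_0 by blast
  then show "coefp i (\<omega> (2, 2)) k = - Gco i \<omega> k" by (simp add: eq_neg_iff_add_eq_0)
qed

text \<open>The form g has degree D - 2 and hence \<open>D - 1\<close> coefficients. The subtraction
  truncates: for \<open>D \<le> 1\<close> there are none, and both fibre components are
  zero.\<close>

lemma eval_fibre:
  fixes i :: 2 and u s t :: complex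
  defines "g \<equiv> form_eval (D - 1) (spec (D - 1) (Gco i \<omega>) u) s t"
  shows "eval_cox (\<omega> (1, 2)) (cpoint i u s t) = t * g"
    and "eval_cox (\<omega> (2, 2)) (cpoint i u s t) = - s * g"
proof -
  have "eval_cox (\<omega> (1, 2)) (cpoint i u s t) = (\<Sum>k<D. poly (coefp i (\<omega> (1, 2)) k) u * s ^ (D - 1 - k) * t ^ k)"
    by (rule eval_cox_cpoint[OF hom_fibre(1)]) simp
  also have "\<dots> = (\<Sum>k<D - 1. poly (Gco i \<omega> k) u * s ^ (D - 1 - Suc k) * t ^ Suc k)"
  proof (cases D)
    case (Suc n)
    then show ?thesis
      by (simp only: sum.lessThan_Suc_shift coefp_fibre(1)) (simp add: Gco_def)
  qed simp
  also have "\<dots> = t * g"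
    unfolding g_def form_eval_spec by (simp add: sum_distrib_left mult_ac)
  finally show "eval_cox (\<omega> (1, 2)) (cpoint i u s t) = t * g" .
  have "eval_cox (\<omega> (2, 2)) (cpoint i u s t) = (\<Sum>k<D. - poly (Gco i \<omega> k) u * s ^ (D - 1 - k) * t ^ k)"
    by (subst eval_cox_cpoint[OF hom_fibre(2), of D]) (simp_all add: coefp_fibre)
  also have "\<dots> = (\<Sum>k<D - 1. - poly (Gco i \<omega> k) u * s ^ (D - 1 - k) * t ^ k)"
    by (rule sum.mono_neutral_right) (auto simp: Gco_eq_0)
  also have "\<dots> = - s * g"
    unfolding g_def form_eval_spec sum_distrib_left
  proof (intro sum.cong refl)
    fix k assume "k \<in> {..<D - 1}"
    then have "D - 1 - k = Suc (D - 1 - 1 - k)" by auto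
    then show "- poly (Gco i \<omega> k) u * s ^ (D - 1 - k) * t ^ k = - s * (poly (Gco i \<omega> k) u * s ^ (D - 1 - 1 - k) * t ^ k)"
      by (simp add: mult_ac)
  qed
  finally show "eval_cox (\<omega> (2, 2)) (cpoint i u s t) = - s * g" .
qed

lemma eval_base:
  "eval_cox (\<omega> (i, 1)) (cpoint i u s t) = form_eval (Suc D) (spec (Suc D) (Qco i \<omega>) u) s t"
  unfolding form_eval_spec Qco_def
  by (subst eval_cox_cpoint[OF hom_base, of "Suc D"]) simp_all

text \<open>Solving the contraction with \<open>R1\<close> for the component at the normalised
  coordinate shows that it lies in the ideal of g and q, and so imposes no further condition on a
  zero.\<close>

lemma eval_base_other:
  assumes "i \<noteq> i'"
  shows "eval_cox (\<omega> (i', 1)) (cpoint i u s t) =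
    of_nat r * s * t * form_eval (D - 1) (spec (D - 1) (Gco i \<omega>) u) s t
    - u * form_eval (Suc D) (spec (Suc D) (Qco i \<omega>) u) s t"
proof -
  have "u * eval_cox (\<omega> (i, 1)) (cpoint i u s t) + eval_cox (\<omega> (i', 1)) (cpoint i u s t)
      + of_nat r * t * eval_cox (\<omega> (2, 2)) (cpoint i u s t) = 0"
    using contract_R1[of "cpoint i u s t"] assms two_cases[of i] two_cases[of i'] by (auto simp: add_ac)
  then show ?thesis
    unfolding eval_fibre eval_base by (simp add: algebra_simps)
qed

lemma cpoint_zero_iff:
  assumes "s \<noteq> 0 \<or> t \<noteq> 0"
  shows "cpoint i u s t \<in> form_zeros \<omega> \<longleftrightarrow>
    form_eval (D - 1) (spec (D - 1) (Gco i \<omega>) u) s t = 0 \<and>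
    form_eval (Suc D) (spec (Suc D) (Qco i \<omega>) u) s t = 0"
proof -
  obtain i' where i': "i \<noteq> i'" using one_neq_two by metis
  show ?thesis
    unfolding form_zeros_def mem_Collect_eq all_idx_charts[OF i'] eval_fibre eval_base eval_base_other[OF i']
    using assms by auto
qed

text \<open>Index \<open>k\<close> of g is index \<open>Suc k\<close> of P_s, whence the additional
  - r in the exponent.\<close>

lemma Gco_transition:
  assumes "i \<noteq> i'" "u \<noteq> 0"
  shows "poly (Gco i \<omega> k) u = u powi (d1 - int r - int (r * k)) * poly (Gco i' \<omega> k) (1 / u)"
proof -
  have "d1 - int (r * Suc k) = d1 - int r - int (r * k)" by simp
  then show ?thesis
    unfolding Gco_def using coefp_transition[OF hom_fibre(1) assms, of "Suc k"] by (simp only: fst_conv)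
qed

text \<open>The contraction with \<open>R1\<close> in chart i expresses u q by g and by the
  component at the normalised coordinate, which is q of the other chart up to a power of u. Dividing
  by u turns the exponent d1 - 1 into d1 - 2, in accordance with the degree - 2 of the cotangent
  bundle of the line.\<close>

lemma Qco_transition:
  assumes i: "i \<noteq> i'" and u: "u \<noteq> 0"
  shows "poly (Qco i \<omega> k) u = u powi (d1 - 2 - int (r * k)) *
    (of_nat r * u * (if k = 0 then 0 else poly (Gco i' \<omega> (k - 1)) (1 / u)) - poly (Qco i' \<omega> k) (1 / u))"
proof -
  let ?P = "spec (Suc D) (coefp i (\<omega> (i, 1))) u" and ?P' = "spec (Suc D) (coefp i (\<omega> (i', 1))) u"
  let ?B = "spec D (coefp i (\<omega> (2, 2))) u"
  have "Polynomial.smult u ?P + ?P' + Polynomial.smult (of_nat r) (pCons 0 ?B) = 0" (is "?S = 0")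
  proof -
    have "poly ?S t = 0" for t
    proof -
      have "u * eval_cox (\<omega> (i, 1)) (cpoint i u 1 t) + eval_cox (\<omega> (i', 1)) (cpoint i u 1 t)
          + of_nat r * t * eval_cox (\<omega> (2, 2)) (cpoint i u 1 t) = 0"
        using contract_R1[of "cpoint i u 1 t"] i two_cases[of i] two_cases[of i'] by (auto simp: add_ac)
      then show ?thesis
        using poly_coefp_spec[OF hom_base, of "Suc D" i i u t] poly_coefp_spec[OF hom_base, of "Suc D" i' i u t]
          poly_coefp_spec[OF hom_fibre(2), of D i u t]
        by (simp add: mult_ac)
    qed
    then show ?thesis using poly_all_0_iff_0 by blast
  qed
  then have "u * coeff ?P k + coeff ?P' k + of_nat r * coeff (pCons 0 ?B) k = 0"
    by (metis coeff_0 coeff_add coeff_smult)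
  moreover have "coefp i (\<omega> (j, 1)) k = 0" if "Suc D \<le> k" for j
    using that coefp_eq_0[OF hom_base, of "Suc D" k] by auto
  then have "coeff ?P k = poly (Qco i \<omega> k) u" "coeff ?P' k = poly (coefp i (\<omega> (i', 1)) k) u"
    by (auto simp: coeff_spec Qco_def)
  moreover have "coefp i (\<omega> (2, 2)) j = 0" if "D \<le> j" for j
    using that coefp_eq_0[OF hom_fibre(2), of D j] by auto
  then have "coeff (pCons 0 ?B) k = (if k = 0 then 0 else - poly (Gco i \<omega> (k - 1)) u)"
    by (cases k) (auto simp: coeff_spec coefp_fibre)
  moreover have "poly (coefp i (\<omega> (i', 1)) k) u = u powi (d1 - 1 - int (r * k)) * poly (Qco i' \<omega> k) (1 / u)"
    unfolding Qco_def using coefp_transition[OF hom_base i u] by simp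
  moreover have "poly (Gco i \<omega> (k - 1)) u = u powi (d1 - int (r * k)) * poly (Gco i' \<omega> (k - 1)) (1 / u)" if "k \<noteq> 0"
    unfolding Gco_def using that coefp_transition[OF hom_fibre(1) i u, of k] by simp
  ultimately have eq: "u * poly (Qco i \<omega> k) u = of_nat r * (if k = 0 then 0 else u powi (d1 - int (r * k)) * poly (Gco i' \<omega> (k - 1)) (1 / u))
      - u powi (d1 - 1 - int (r * k)) * poly (Qco i' \<omega> k) (1 / u)"
    by (auto simp: algebra_simps eq_neg_iff_add_eq_0)
  define E where "E = u powi (d1 - 2 - int (r * k))"
  have E: "u powi (d1 - 1 - int (r * k)) = E * u" "u powi (d1 - int (r * k)) = E * u\<^sup>2"
    unfolding E_def using u power_int_add[of u "d1 - 2 - int (r * k)" 1] power_int_add[of u "d1 - 2 - int (r * k)" 2]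
    by (simp_all add: algebra_simps)
  have "u * poly (Qco i \<omega> k) u = u * (E * (of_nat r * u * (if k = 0 then 0 else poly (Gco i' \<omega> (k - 1)) (1 / u))
      - poly (Qco i' \<omega> k) (1 / u)))"
    unfolding eq E by (simp add: algebra_simps power2_eq_square)
  then show ?thesis using u by (simp add: E_def)
qed

end


section \<open>Singularities of multiplicity one\<close>

lemma homogeneous_1: "homogeneous r (0, 0) 1"
  by (simp add: homogeneous_def)

lemma homogeneous_zvar: "homogeneous r (int (fst (zdeg r v)), int (snd (zdeg r v))) (zvar v)"
proof -
  have "(\<Sum>w\<in>UNIV. int (Poly_Mapping.lookup (Poly_Mapping.single v 1) w * f w)) = int (f v)" for f :: "idx \<Rightarrow> nat"
  proof -
    have "(\<Sum>w\<in>UNIV. int (Poly_Mapping.lookup (Poly_Mapping.single v 1) w * f w))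
        = (\<Sum>w\<in>UNIV. if w = v then int (f v) else 0)"
      by (intro sum.cong refl) (simp add: lookup_single when_def)
    then show ?thesis by simp
  qed
  then show ?thesis by (simp add: homogeneous_def zvar_def)
qed

lemma homogeneous_mult:
  assumes "homogeneous r e P" "homogeneous r f Q"
  shows "homogeneous r (fst e + fst f, snd e + snd f) (P * Q)"
  unfolding homogeneous_def
proof
  fix m assume "m \<in> Poly_Mapping.keys (P * Q)"
  then obtain a b where "m = a + b" "a \<in> Poly_Mapping.keys P" "b \<in> Poly_Mapping.keys Q"
    using keys_mult[of P Q] by auto
  then show "(\<Sum>v\<in>UNIV. int (Poly_Mapping.lookup m v * fst (zdeg r v))) = fst (fst e + fst f, snd e + snd f) \<and>
     (\<Sum>v\<in>UNIV. int (Poly_Mapping.lookup m v * snd (zdeg r v))) = snd (fst e + fst f, snd e + snd f)"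
    using assms by (simp add: homogeneous_def lookup_add distrib_right sum.distrib)
qed

lemma homogeneous_power:
  assumes "homogeneous r e P"
  shows "homogeneous r (int k * fst e, int k * snd e) (P ^ k)"
proof (induction k)
  case (Suc k)
  then show ?case using homogeneous_mult[OF assms Suc] by (simp add: algebra_simps)
qed (simp add: homogeneous_1)

lemma homogeneous_eval_nonzero_on_orbit:
  assumes "homogeneous r e P" "eval_cox P z \<noteq> 0" "w \<in> hpoint r z"
  shows "eval_cox P w \<noteq> 0"
proof -
  obtain l m where "l \<noteq> 0" "m \<noteq> 0" "w = act r l m z" using assms(3) unfolding hpoint_def by auto
  then show ?thesis using eval_cox_act[OF assms(1)] assms(2) by (simp add: power_int_eq_0_iff)
qed

text \<open>Numerator and denominator scale alike along an orbit, so any representative may define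
  the value; where G vanishes, it does so on the whole orbit and the quotient is 0 by
  convention.\<close>

lemma quotient_function_exists:
  assumes F: "homogeneous r e F" and G: "homogeneous r e G"
  shows "\<exists>f. \<forall>w. f (hpoint r w) = eval_cox F w / eval_cox G w"
proof -
  define f where "f p = (let w = (SOME w. p = hpoint r w) in eval_cox F w / eval_cox G w)" for p
  have "f (hpoint r w) = eval_cox F w / eval_cox G w" for w
  proof -
    define w' where "w' = (SOME w'. hpoint r w = hpoint r w')"
    have "hpoint r w = hpoint r w'" unfolding w'_def by (rule someI[of _ w]) simp
    then obtain l m where lm: "l \<noteq> 0" "m \<noteq> 0" "w = act r l m w'" by (rule hpoint_eqD)
    have "eval_cox F w / eval_cox G w = eval_cox F w' / eval_cox G w'"
      using lm by (simp add: eval_cox_act[OF F] eval_cox_act[OF G])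
    then show ?thesis by (simp add: f_def w'_def Let_def)
  qed
  then show ?thesis by blast
qed

text \<open>If the coefficients of the form vanish to second order at \<open>z\<close> in the direction \<open>x\<close>, then the value and the
  derivative along \<open>x\<close> are two functionals on the local ring which kill the ideal.\<close>

lemma sing_mult_ge_2:
  assumes z: "z \<notin> irrelevant" "\<And>v. eval_cox (\<omega> v) z = 0"
    and D: "\<And>v. ((\<lambda>\<epsilon>. eval_cox (\<omega> v) (z + \<epsilon> *s x)) has_field_derivative 0) (at 0)"
    and F: "homogeneous r e F" and G: "homogeneous r e G" "eval_cox G z \<noteq> 0"
    and FG: "((\<lambda>\<epsilon>. eval_cox F (z + \<epsilon> *s x) / eval_cox G (z + \<epsilon> *s x)) has_field_derivative \<kappa>) (at 0)" "\<kappa> \<noteq> 0"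
  shows "2 \<le> sing_mult r \<omega> (hpoint r z)"
proof -
  define p where "p = hpoint r z"
  obtain f where f: "\<forall>w. f (hpoint r w) = eval_cox F w / eval_cox G w"
    using quotient_function_exists[OF F G(1)] by blast
  let ?one = "\<lambda>_::cpt set. 1::complex"
  have "represents_at r p F f"
    unfolding represents_at_def p_def
    using F G f homogeneous_eval_nonzero_on_orbit[OF G] by blast
  then have fV: "f \<in> local_ring r p" by (auto simp: local_ring_def)
  have "represents_at r p 1 ?one"
    unfolding represents_at_def using homogeneous_1 by (intro exI[of _ "(0, 0)"] exI[of _ 1]) simp
  then have oneV: "?one \<in> local_ring r p" by (auto simp: local_ring_def)
  define \<gamma> where "\<gamma> \<epsilon> = z + \<epsilon> *s x" for \<epsilon>
  have \<gamma>0: "\<gamma> 0 = z" by (simp add: \<gamma>_def Finite_Cartesian_Product.vec_eq_iff)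
  have dP: "\<exists>d. ((\<lambda>\<epsilon>. eval_cox P (\<gamma> \<epsilon>)) has_field_derivative d) (at 0)" for P
  proof -
    obtain q where "\<forall>\<epsilon>. eval_cox P (z + \<epsilon> *s x) = poly q \<epsilon>" using eval_cox_line by blast
    then show ?thesis unfolding \<gamma>_def by (auto intro!: exI poly_DERIV)
  qed
  \<comment> \<open>The filter \<open>nhds 0\<close> includes the point 0 itself, as is needed to
    transfer a derivative at 0 through an eventual equality.\<close>
  have ev_nz: "\<forall>\<^sub>F \<epsilon> in nhds 0. eval_cox P (\<gamma> \<epsilon>) \<noteq> 0" if "eval_cox P z \<noteq> 0" for P
  proof -
    obtain d where "((\<lambda>\<epsilon>. eval_cox P (\<gamma> \<epsilon>)) has_field_derivative d) (at 0)" using dP by blast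
    then have "isCont (\<lambda>\<epsilon>. eval_cox P (\<gamma> \<epsilon>)) 0" by (rule DERIV_isCont)
    then have "((\<lambda>\<epsilon>. eval_cox P (\<gamma> \<epsilon>)) \<longlongrightarrow> eval_cox P z) (nhds 0)"
      by (simp add: isCont_def \<gamma>0 tendsto_nhds_iff)
    then show ?thesis using that by (rule tendsto_imp_eventually_ne)
  qed
  have ev_rel: "\<forall>\<^sub>F \<epsilon> in nhds 0. \<gamma> \<epsilon> \<notin> irrelevant"
  proof -
    have cont: "continuous_on UNIV \<gamma>" unfolding \<gamma>_def vector_scalar_mult_def
      by (intro continuous_intros)
    have "open (\<gamma> -` (- irrelevant))"
      using closed_irrelevant by (intro open_vimage cont) auto
    moreover have "0 \<in> \<gamma> -` (- irrelevant)" using z(1) by (simp add: \<gamma>0)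
    ultimately show ?thesis using eventually_nhds_in_open by fastforce
  qed
  have key: "c1 = 0 \<and> c2 = 0" if zi: "(\<lambda>q. c1 + c2 * f q) \<in> zero_ideal r \<omega> p" for c1 c2
  proof -
    obtain A where "represents_at r p (\<Sum>v\<in>UNIV. A v * \<omega> v) (\<lambda>q. c1 + c2 * f q)"
      using zi by (auto simp: zero_ideal_def)
    then obtain H where H: "\<And>w. w \<in> p \<Longrightarrow> eval_cox H w \<noteq> 0" and
      eq: "\<And>w. \<lbrakk>w \<notin> irrelevant; eval_cox H w \<noteq> 0\<rbrakk> \<Longrightarrow>
        c1 + c2 * f (hpoint r w) = (\<Sum>v\<in>UNIV. eval_cox (A v) w * eval_cox (\<omega> v) w) / eval_cox H w"
      unfolding represents_at_def by (auto simp: eval_cox_sum eval_cox_mult)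
    have Hz: "eval_cox H z \<noteq> 0" using H in_hpoint_self unfolding p_def by blast
    define R where "R \<epsilon> = (\<Sum>v\<in>UNIV. eval_cox (A v) (\<gamma> \<epsilon>) * eval_cox (\<omega> v) (\<gamma> \<epsilon>)) / eval_cox H (\<gamma> \<epsilon>)" for \<epsilon>
    define L where "L \<epsilon> = c1 + c2 * (eval_cox F (\<gamma> \<epsilon>) / eval_cox G (\<gamma> \<epsilon>))" for \<epsilon>
    have LR: "\<forall>\<^sub>F \<epsilon> in nhds 0. L \<epsilon> = R \<epsilon>"
      using ev_rel ev_nz[OF Hz]
    proof eventually_elim
      case (elim \<epsilon>)
      have "c1 + c2 * f (hpoint r (\<gamma> \<epsilon>)) = R \<epsilon>" using eq[OF elim] by (simp only: R_def)
      then show "L \<epsilon> = R \<epsilon>" by (simp only: L_def f[rule_format])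
    qed
    have "\<exists>dA. \<forall>v. ((\<lambda>\<epsilon>. eval_cox (A v) (\<gamma> \<epsilon>)) has_field_derivative dA v) (at 0)"
      by (rule choice) (intro allI dP)
    then obtain dA where dA: "\<And>v. ((\<lambda>\<epsilon>. eval_cox (A v) (\<gamma> \<epsilon>)) has_field_derivative dA v) (at 0)"
      by blast
    obtain dH where dH: "((\<lambda>\<epsilon>. eval_cox H (\<gamma> \<epsilon>)) has_field_derivative dH) (at 0)"
      using dP[of H] by blast
    \<comment> \<open>Both terms of the product rule vanish, since the coefficient of the form is
      zero at z together with its derivative along \<open>x\<close>.\<close>
    have "((\<lambda>\<epsilon>. eval_cox (A v) (\<gamma> \<epsilon>) * eval_cox (\<omega> v) (\<gamma> \<epsilon>)) has_field_derivative 0) (at 0)" for v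
      using DERIV_mult[OF dA[of v] D[of v, folded \<gamma>_def]] by (simp add: \<gamma>0 z)
    from DERIV_sum[of UNIV, OF this]
    have "((\<lambda>\<epsilon>. \<Sum>v\<in>UNIV. eval_cox (A v) (\<gamma> \<epsilon>) * eval_cox (\<omega> v) (\<gamma> \<epsilon>)) has_field_derivative 0) (at 0)"
      by simp
    from DERIV_divide[OF this dH] have "(R has_field_derivative 0) (at 0)"
      unfolding R_def by (simp add: \<gamma>0 z Hz)
    moreover have "(L has_field_derivative c2 * \<kappa>) (at 0)"
      unfolding L_def using DERIV_add[OF DERIV_const DERIV_cmult[OF FG(1)[folded \<gamma>_def]]] by simp
    ultimately have "c2 * \<kappa> = 0"
      unfolding DERIV_cong_ev[OF refl LR refl] by (rule DERIV_unique[rotated])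
    then have c2: "c2 = 0" using FG(2) by simp
    \<comment> \<open>The value at z is the second functional: elements of the ideal vanish
      there.\<close>
    have "c1 + c2 * f (hpoint r z) = 0" using eq[OF z(1) Hz] by (simp add: z)
    with c2 show ?thesis by simp
  qed
  \<comment> \<open>The two functions must be distinct to form a set of size 2; if they were equal,
    their difference 0 would lie in the ideal and contradict \<open>key\<close>.\<close>
  have "?one \<noteq> f"
  proof
    assume "?one = f"
    then have "(\<lambda>q. 1 + (- 1) * f q) = (\<lambda>q. 0)" by (metis add.right_inverse mult_minus1)
    moreover have "(\<lambda>q. 0) \<in> zero_ideal r \<omega> p"
      unfolding zero_ideal_def represents_at_def mem_Collect_eq
      by (intro exI[of _ "\<lambda>_. 0"] exI[of _ "(0, 0)"] exI[of _ 1])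
        (simp add: homogeneous_1, simp add: homogeneous_def)
    ultimately show False using key[of 1 "- 1"] by simp
  qed
  have "enat (card {?one, f}) \<le> sing_mult r \<omega> p"
    unfolding sing_mult_def quotient_dim_def
  proof (rule SUP_upper, simp only: mem_Collect_eq, intro conjI allI impI)
    show "{?one, f} \<subseteq> local_ring r p" using fV oneV by simp
    fix c assume "(\<lambda>x. \<Sum>b\<in>{?one, f}. c b * b x) \<in> zero_ideal r \<omega> p"
    then have "(\<lambda>x. c ?one + c f * f x) \<in> zero_ideal r \<omega> p" using \<open>?one \<noteq> f\<close> by simp
    then show "\<forall>b\<in>{?one, f}. c b = 0" using key by auto
  qed simp
  then show ?thesis using \<open>?one \<noteq> f\<close> by (simp add: p_def numeral_eq_enat eval_nat_numeral)
qed

text \<open>The derivative is split into two parts. With u frozen, the linear factor makes the form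
  a multiple of \<epsilon>, so its derivative in (s, t) is read off without differentiating
  monomials; the other part differentiates only the coefficients \<open>G k\<close>.\<close>

lemma form_family_derivative:
  fixes G :: "nat \<Rightarrow> complex poly"
  assumes g: "short n g" "spec (Suc n) G u = [:t0, - s0:] * g"
  shows "((\<lambda>\<epsilon>. form_eval (Suc n) (spec (Suc n) G (u + \<epsilon> * \<alpha>)) (s0 + \<epsilon> * a) (t0 + \<epsilon> * b)) has_field_derivative
    \<alpha> * form_eval (Suc n) (spec (Suc n) (\<lambda>k. pderiv (G k)) u) s0 t0 + (t0 * a - s0 * b) * form_eval n g s0 t0) (at 0)"
proof -
  define c where "c k \<epsilon> = (s0 + \<epsilon> * a) ^ (n - k) * (t0 + \<epsilon> * b) ^ k" for k \<epsilon>
  have "\<exists>d. (c k has_field_derivative d) (at 0)" for k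
    unfolding c_def by (rule exI) (rule derivative_intros refl)+
  then obtain c' where c': "\<And>k. (c k has_field_derivative c' k) (at 0)" by metis
  have "((\<lambda>\<epsilon>. \<Sum>k<Suc n. poly (G k) u * c k \<epsilon>) has_field_derivative (\<Sum>k<Suc n. poly (G k) u * c' k)) (at 0)"
    by (intro DERIV_sum DERIV_cmult c')
  \<comment> \<open>At the moving point the linear form takes the value \<epsilon> (t0 a - s0
    b).\<close>
  moreover have "(\<Sum>k<Suc n. poly (G k) u * c k \<epsilon>) = \<epsilon> * ((t0 * a - s0 * b) * form_eval n g (s0 + \<epsilon> * a) (t0 + \<epsilon> * b))" for \<epsilon>
  proof -
    have "(\<Sum>k<Suc n. poly (G k) u * c k \<epsilon>) = form_eval (Suc n) (spec (Suc n) G u) (s0 + \<epsilon> * a) (t0 + \<epsilon> * b)"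
      by (simp add: form_eval_spec c_def mult.assoc)
    then show ?thesis unfolding g(2) form_eval_linear_mult[OF g(1)] by (simp add: algebra_simps)
  qed
  moreover have "((\<lambda>\<epsilon>. \<epsilon> * ((t0 * a - s0 * b) * form_eval n g (s0 + \<epsilon> * a) (t0 + \<epsilon> * b))) has_field_derivative
      (t0 * a - s0 * b) * form_eval n g s0 t0) (at 0)"
  proof -
    have "\<exists>d. ((\<lambda>\<epsilon>. (t0 * a - s0 * b) * form_eval n g (s0 + \<epsilon> * a) (t0 + \<epsilon> * b)) has_field_derivative d) (at 0)"
      unfolding form_eval_def by (rule exI) (rule derivative_intros refl)+
    then obtain d where d: "((\<lambda>\<epsilon>. (t0 * a - s0 * b) * form_eval n g (s0 + \<epsilon> * a) (t0 + \<epsilon> * b)) has_field_derivative d) (at 0)" ..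
    from DERIV_mult[OF DERIV_ident d] show ?thesis by simp
  qed
  ultimately have sum: "(\<Sum>k<Suc n. poly (G k) u * c' k) = (t0 * a - s0 * b) * form_eval n g s0 t0"
    using DERIV_unique by simp
  have "((\<lambda>\<epsilon>. poly (G k) (u + \<epsilon> * \<alpha>) * c k \<epsilon>) has_field_derivative
      \<alpha> * (poly (pderiv (G k)) u * c k 0) + poly (G k) u * c' k) (at 0)" for k
  proof -
    have "((\<lambda>\<epsilon>. u + \<epsilon> * \<alpha>) has_field_derivative \<alpha>) (at 0)" by (auto intro!: derivative_eq_intros)
    from DERIV_chain2[of "poly (G k)", OF _ this] have "((\<lambda>\<epsilon>. poly (G k) (u + \<epsilon> * \<alpha>)) has_field_derivative poly (pderiv (G k)) u * \<alpha>) (at 0)"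
      using poly_DERIV[of "G k" u] by simp
    from DERIV_mult[OF this c'] show ?thesis by (simp add: algebra_simps)
  qed
  then have "((\<lambda>\<epsilon>. \<Sum>k<Suc n. poly (G k) (u + \<epsilon> * \<alpha>) * c k \<epsilon>) has_field_derivative
      (\<Sum>k<Suc n. \<alpha> * (poly (pderiv (G k)) u * c k 0) + poly (G k) u * c' k)) (at 0)"
    by (intro DERIV_sum)
  then show ?thesis
    unfolding sum.distrib sum by (simp only: form_eval_spec) (simp add: c_def sum_distrib_left mult.assoc del: sum.lessThan_Suc)
qed

context
  fixes r :: nat and d1 :: int and n :: nat and \<omega> :: "idx \<Rightarrow> cox"
  assumes tw: "twisted_form r (d1, int (n + 2)) \<omega>"
begin

text \<open>A nonzero kernel vector of the Jacobian lifts to a direction in which all four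
  coefficients vanish to second order. The multiplicity is then at least 2 as soon as some rational
  function has a nonzero derivative in this direction.\<close>

lemma sing_mult_1_nondegenerate:
  fixes i :: 2 and u s0 t0 :: complex
  defines "Gu \<equiv> spec (Suc n) (Gco i \<omega>) u" and "Qu \<equiv> spec (Suc (n + 2)) (Qco i \<omega>) u"
  assumes p: "s0 \<noteq> 0 \<or> t0 \<noteq> 0" and zero: "cpoint i u s0 t0 \<in> form_zeros \<omega>"
    and mult: "sing_mult r \<omega> (hpoint r (cpoint i u s0 t0)) = 1"
    and g: "short n g" "Gu = [:t0, - s0:] * g" and q: "short (n + 2) q" "Qu = [:t0, - s0:] * q"
    and eqG: "\<alpha> * form_eval (Suc n) (spec (Suc n) (\<lambda>k. pderiv (Gco i \<omega> k)) u) s0 t0 + \<beta> * form_eval n g s0 t0 = 0"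
    and eqQ: "\<alpha> * form_eval (Suc (n + 2)) (spec (Suc (n + 2)) (\<lambda>k. pderiv (Qco i \<omega> k)) u) s0 t0
      + \<beta> * form_eval (n + 2) q s0 t0 = 0"
  shows "\<alpha> = 0 \<and> \<beta> = 0"
proof (rule ccontr)
  assume nz: "\<not> ?thesis"
  obtain i' where i': "i \<noteq> i'" using one_neq_two by metis
  \<comment> \<open>Any a, b with t0 a - s0 b = \<beta> represent the fibre component of the
    direction; this choice keeps one of them zero and divides by a nonzero coordinate.\<close>
  define a where "a = (if t0 = 0 then 0 else \<beta> / t0)"
  define b where "b = (if t0 = 0 then - \<beta> / s0 else 0)"
  have ab: "t0 * a - s0 * b = \<beta>" using p by (simp add: a_def b_def)
  let ?z = "cpoint i u s0 t0"
  define x :: cpt where "x = (\<chi> v. if v = (i, 1) then \<alpha> else if v = (1, 2) then a else if v = (2, 2) then b else 0)"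
  have line: "?z + \<epsilon> *s x = cpoint i (u + \<epsilon> * \<alpha>) (s0 + \<epsilon> * a) (t0 + \<epsilon> * b)" for \<epsilon>
  proof -
    have "\<forall>v. (?z + \<epsilon> *s x) $ v = cpoint i (u + \<epsilon> * \<alpha>) (s0 + \<epsilon> * a) (t0 + \<epsilon> * b) $ v"
      unfolding all_idx_charts[OF i'] using i' by (simp add: x_def)
    then show ?thesis by (rule Finite_Cartesian_Product.vec_eq_iff[THEN iffD2])
  qed
  define gh where "gh \<epsilon> = form_eval (Suc n) (spec (Suc n) (Gco i \<omega>) (u + \<epsilon> * \<alpha>)) (s0 + \<epsilon> * a) (t0 + \<epsilon> * b)" for \<epsilon>
  define qh where "qh \<epsilon> = form_eval (Suc (n + 2)) (spec (Suc (n + 2)) (Qco i \<omega>) (u + \<epsilon> * \<alpha>)) (s0 + \<epsilon> * a) (t0 + \<epsilon> * b)" for \<epsilon>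
  have dg: "(gh has_field_derivative 0) (at 0)"
    using form_family_derivative[OF g(1), of "Gco i \<omega>" u t0 s0 \<alpha> a b] g(2) eqG
    unfolding gh_def Gu_def ab by simp
  have dq: "(qh has_field_derivative 0) (at 0)"
    using form_family_derivative[OF q(1), of "Qco i \<omega>" u t0 s0 \<alpha> a b] q(2) eqQ
    unfolding qh_def Qu_def ab by simp
  have 0: "gh 0 = 0" "qh 0 = 0"
    using zero unfolding cpoint_zero_iff[OF tw p] by (simp_all add: gh_def qh_def)
  have z: "?z \<notin> irrelevant" "\<And>v. eval_cox (\<omega> v) ?z = 0" using zero unfolding form_zeros_def by blast+
  have D: "((\<lambda>\<epsilon>. eval_cox (\<omega> v) (?z + \<epsilon> *s x)) has_field_derivative 0) (at 0)" for v
  proof -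
    have "\<forall>v. ((\<lambda>\<epsilon>. eval_cox (\<omega> v) (?z + \<epsilon> *s x)) has_field_derivative 0) (at 0)"
      unfolding all_idx_charts[OF i'] line eval_fibre[OF tw] eval_base[OF tw] eval_base_other[OF tw i']
    proof (intro conjI)
      show "((\<lambda>\<epsilon>. form_eval (Suc (n + 2)) (spec (Suc (n + 2)) (Qco i \<omega>) (u + \<epsilon> * \<alpha>)) (s0 + \<epsilon> * a) (t0 + \<epsilon> * b))
          has_field_derivative 0) (at 0)"
        by (rule dq[unfolded qh_def])
      have "((\<lambda>\<epsilon>. of_nat r * (s0 + \<epsilon> * a) * (t0 + \<epsilon> * b) * gh \<epsilon> - (u + \<epsilon> * \<alpha>) * qh \<epsilon>) has_field_derivative 0) (at 0)"
        by (rule derivative_eq_intros dg dq refl | simp add: 0)+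
      then show "((\<lambda>\<epsilon>. of_nat r * (s0 + \<epsilon> * a) * (t0 + \<epsilon> * b)
          * form_eval (n + 2 - 1) (spec (n + 2 - 1) (Gco i \<omega>) (u + \<epsilon> * \<alpha>)) (s0 + \<epsilon> * a) (t0 + \<epsilon> * b)
          - (u + \<epsilon> * \<alpha>) * form_eval (Suc (n + 2)) (spec (Suc (n + 2)) (Qco i \<omega>) (u + \<epsilon> * \<alpha>)) (s0 + \<epsilon> * a) (t0 + \<epsilon> * b))
          has_field_derivative 0) (at 0)"
        by (simp add: gh_def qh_def)
      have "((\<lambda>\<epsilon>. (t0 + \<epsilon> * b) * gh \<epsilon>) has_field_derivative 0) (at 0)"
        by (rule derivative_eq_intros dg refl | simp add: 0)+
      then show "((\<lambda>\<epsilon>. (t0 + \<epsilon> * b) * form_eval (n + 2 - 1) (spec (n + 2 - 1) (Gco i \<omega>) (u + \<epsilon> * \<alpha>)) (s0 + \<epsilon> * a) (t0 + \<epsilon> * b))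
          has_field_derivative 0) (at 0)"
        by (simp add: gh_def)
      have "((\<lambda>\<epsilon>. - (s0 + \<epsilon> * a) * gh \<epsilon>) has_field_derivative 0) (at 0)"
        by (rule derivative_eq_intros dg refl | simp add: 0)+
      then show "((\<lambda>\<epsilon>. - (s0 + \<epsilon> * a) * form_eval (n + 2 - 1) (spec (n + 2 - 1) (Gco i \<omega>) (u + \<epsilon> * \<alpha>)) (s0 + \<epsilon> * a) (t0 + \<epsilon> * b))
          has_field_derivative 0) (at 0)"
        by (simp add: gh_def)
    qed
    then show ?thesis by blast
  qed
  note ge2 = sing_mult_ge_2[OF z D]
  \<comment> \<open>This factor equals 1 throughout the chart and balances the degrees (0, 1) and
    (r, 1) of the fibre coordinates.\<close>
  let ?y = "zvar (i', 1) ^ r"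
  have hom: "homogeneous r (1, 0) (zvar (j, 1))" "homogeneous r (int r, 1) (zvar (2, 2))"
    "homogeneous r (int r, 1) (zvar (1, 2) * ?y)" for j
    using homogeneous_zvar[of r "(j, 1)"] homogeneous_zvar[of r "(2, 2)"]
      homogeneous_mult[OF homogeneous_zvar[of r "(1, 2)"] homogeneous_power[OF homogeneous_zvar[of r "(i', 1)"], of r]]
    by simp_all
  \<comment> \<open>The test function is the affine base coordinate if \<alpha> is nonzero, and
    otherwise the affine fibre coordinate that is finite at the point.\<close>
  have "2 \<le> sing_mult r \<omega> (hpoint r ?z)"
  proof (cases "\<alpha> = 0")
    case False
    show ?thesis
    proof (rule ge2[OF hom(1)[of i] hom(1)[of i'] _ _ False])
      show "((\<lambda>\<epsilon>. eval_cox (zvar (i, 1)) (?z + \<epsilon> *s x) / eval_cox (zvar (i', 1)) (?z + \<epsilon> *s x))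
          has_field_derivative \<alpha>) (at 0)"
        unfolding line using i' by (auto intro!: derivative_eq_intros)
    qed (use i' in simp)
  next
    case True
    then have \<beta>: "\<beta> \<noteq> 0" using nz by simp
    show ?thesis
    proof (cases "t0 = 0")
      case False
      show ?thesis
      proof (rule ge2[OF hom(3,2)])
        show "((\<lambda>\<epsilon>. eval_cox (zvar (1, 2) * ?y) (?z + \<epsilon> *s x) / eval_cox (zvar (2, 2)) (?z + \<epsilon> *s x))
            has_field_derivative a / t0) (at 0)"
          unfolding line eval_cox_mult using i' False
          by (auto intro!: derivative_eq_intros simp: b_def field_simps)
        show "a / t0 \<noteq> 0" using False \<beta> by (simp add: a_def)
      qed (use False in simp)
    next
      case True
      then have s0: "s0 \<noteq> 0" using p by simp
      show ?thesis
      proof (rule ge2[OF hom(2,3)])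
        show "((\<lambda>\<epsilon>. eval_cox (zvar (2, 2)) (?z + \<epsilon> *s x) / eval_cox (zvar (1, 2) * ?y) (?z + \<epsilon> *s x))
            has_field_derivative b / s0) (at 0)"
          unfolding line eval_cox_mult using i' True s0
          by (auto intro!: derivative_eq_intros simp: a_def field_simps)
        show "b / s0 \<noteq> 0" using True s0 \<beta> by (simp add: b_def)
      qed (use s0 i' in \<open>simp add: eval_cox_mult\<close>)
    qed
  qed
  then show False using mult by simp
qed

end


section \<open>Fibrations\<close>

definition cdiff :: "(complex ^ 'n \<Rightarrow> complex) \<Rightarrow> complex ^ 'n \<Rightarrow> bool" where
  "cdiff h x \<longleftrightarrow> (\<exists>d. (h has_derivative d) (at x) \<and> (\<forall>c y. d (c *s y) = c * d y))"

lemma cdiff_component: "cdiff (\<lambda>x. x $ i) x"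
  unfolding cdiff_def
  by (intro exI[of _ "\<lambda>y. y $ i"]) (auto intro: bounded_linear_imp_has_derivative)

lemma cdiff_mult:
  assumes "cdiff f x" "cdiff g x"
  shows "cdiff (\<lambda>x. f x * g x) x"
proof -
  obtain d e where d: "(f has_derivative d) (at x)" "\<And>c y. d (c *s y) = c * d y"
    and e: "(g has_derivative e) (at x)" "\<And>c y. e (c *s y) = c * e y"
    using assms unfolding cdiff_def by blast
  have "((\<lambda>x. f x * g x) has_derivative (\<lambda>h. f x * e h + d h * g x)) (at x)"
    by (rule has_derivative_mult[OF d(1) e(1)])
  then show ?thesis
    unfolding cdiff_def
    by (intro exI[of _ "\<lambda>h. f x * e h + d h * g x"]) (simp add: d(2) e(2) algebra_simps)
qed

lemma cdiff_power:
  assumes "cdiff f x"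
  shows "cdiff (\<lambda>x. f x ^ k) x"
proof (induction k)
  case 0
  show ?case unfolding cdiff_def by (intro exI[of _ "\<lambda>_. 0"]) simp
qed (simp add: cdiff_mult assms)

lemma has_derivative_vec_components:
  fixes g :: "complex ^ 'n \<Rightarrow> complex ^ 'm"
  assumes "\<And>v. ((\<lambda>x. g x $ v) has_derivative (\<lambda>y. D y $ v)) (at x)"
  shows "(g has_derivative D) (at x)"
proof (subst has_derivative_componentwise_within, rule ballI)
  fix i :: "complex ^ 'm" assume "i \<in> Basis"
  then obtain v b where i: "i = axis v b" unfolding Basis_vec_def by auto
  show "((\<lambda>x. g x \<bullet> i) has_derivative (\<lambda>x. D x \<bullet> i)) (at x)"
    unfolding i inner_axis by (rule has_derivative_inner_left[OF assms])
qed

lemma cdiff_imp_has_cderivative: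
  assumes "\<And>v. cdiff (\<lambda>x. g x $ v) x"
  shows "\<exists>D. has_cderivative g D x"
proof -
  have "\<exists>d. \<forall>v. ((\<lambda>x. g x $ v) has_derivative d v) (at x) \<and> (\<forall>c y. d v (c *s y) = c * d v y)"
    by (rule choice) (use assms in \<open>simp add: cdiff_def\<close>)
  then obtain d where d: "\<And>v. ((\<lambda>x. g x $ v) has_derivative d v) (at x)" "\<And>v c y. d v (c *s y) = c * d v y"
    by blast
  define D where "D y = (\<chi> v. d v y)" for y
  have "(g has_derivative D) (at x)"
    by (rule has_derivative_vec_components) (simp add: D_def d(1))
  moreover have "Vector_Spaces.linear (*s) (*s) D"
    unfolding Vector_Spaces.linear_iff
  proof (intro conjI allI vec.vector_space_axioms)
    have "d v (x + y) = d v x + d v y" for v x y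
      using has_derivative_bounded_linear[OF d(1)] linear_simps(1) by blast
    then show "D (x + y) = D x + D y" for x y
      by (simp add: D_def Finite_Cartesian_Product.vec_eq_iff)
    show "D (c *s y) = c *s D y" for c y
      by (simp add: D_def Finite_Cartesian_Product.vec_eq_iff d(2))
  qed
  ultimately show ?thesis unfolding has_cderivative_def by blast
qed

section \<open>Points of the projective line and of the product of two lines\<close>

lemma ppoint_eq_iff: "ppoint w = ppoint w' \<longleftrightarrow> (\<exists>c. c \<noteq> 0 \<and> w = c *s w')"
proof
  assume eq: "ppoint w = ppoint w'"
  have "w \<in> ppoint w" unfolding ppoint_def by (force intro: exI[of _ 1])
  then show "\<exists>c. c \<noteq> 0 \<and> w = c *s w'" unfolding eq unfolding ppoint_def by blast
next
  assume "\<exists>c. c \<noteq> 0 \<and> w = c *s w'"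
  then obtain c where c: "c \<noteq> 0" "w = c *s w'" by blast
  show "ppoint w = ppoint w'"
  proof
    show "ppoint w \<subseteq> ppoint w'"
    proof
      fix y assume "y \<in> ppoint w"
      then obtain k where "k \<noteq> 0" "y = k *s w" unfolding ppoint_def by blast
      then have "k * c \<noteq> 0 \<and> y = (k * c) *s w'" using c by simp
      then show "y \<in> ppoint w'" unfolding ppoint_def by blast
    qed
    show "ppoint w' \<subseteq> ppoint w"
    proof
      fix y assume "y \<in> ppoint w'"
      then obtain k where "k \<noteq> 0" "y = k *s w'" unfolding ppoint_def by blast
      then have "k / c \<noteq> 0 \<and> y = (k / c) *s w" using c by simp
      then show "y \<in> ppoint w" unfolding ppoint_def by blast
    qed
  qed
qed

lemma column_component [simp]: "column j z $ i = z $ (i, j)"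
  by (simp add: column_def)

lemma column_eq_0_iff: "column j z = 0 \<longleftrightarrow> z $ (1, j) = 0 \<and> z $ (2, j) = 0"
  by (simp add: Finite_Cartesian_Product.vec_eq_iff forall_2)

lemma irrelevant_iff: "z \<in> irrelevant \<longleftrightarrow> column 1 z = 0 \<or> column 2 z = 0"
  by (simp add: irrelevant_def column_eq_0_iff)

lemma prod_domain_iff: "w \<in> prod_domain \<longleftrightarrow> column 1 w \<noteq> 0 \<and> column 2 w \<noteq> 0"
  by (simp add: prod_domain_def)

lemma prod_domain_eq: "prod_domain = - irrelevant"
  using irrelevant_iff prod_domain_iff by blast

lemma prod_point_eqD:
  assumes "prod_point w = prod_point w'"
  shows "\<exists>a b. a \<noteq> 0 \<and> b \<noteq> 0 \<and> (\<forall>i. w $ (i, 1) = a * w' $ (i, 1)) \<and> (\<forall>i. w $ (i, 2) = b * w' $ (i, 2))"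
proof -
  obtain a b where ab: "a \<noteq> 0" "b \<noteq> 0" "column 1 w = a *s column 1 w'" "column 2 w = b *s column 2 w'"
    using assms unfolding prod_point_def prod.inject ppoint_eq_iff by blast
  have "w $ (i, 1) = a * w' $ (i, 1)" "w $ (i, 2) = b * w' $ (i, 2)" for i
    using arg_cong[OF ab(3), of "\<lambda>c. c $ i"] arg_cong[OF ab(4), of "\<lambda>c. c $ i"] by simp_all
  with ab show ?thesis by blast
qed

lemma prod_point_eqI:
  assumes "a \<noteq> 0" "b \<noteq> 0" "\<And>i. w $ (i, 1) = a * w' $ (i, 1)" "\<And>i. w $ (i, 2) = b * w' $ (i, 2)"
  shows "prod_point w = prod_point w'"
proof -
  have "column 1 w = a *s column 1 w'" "column 2 w = b *s column 2 w'"
    using assms(3,4) by (simp_all add: Finite_Cartesian_Product.vec_eq_iff)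
  then show ?thesis unfolding prod_point_def prod.inject ppoint_eq_iff using assms(1,2) by blast
qed

lemma hpoint_eqI:
  assumes "a \<noteq> 0" "b \<noteq> 0" "w = act r a b z"
  shows "hpoint r w = hpoint r z"
  using assms by simp

text \<open>The trivialisation descends from differentiable maps \<open>\<tau>\<close> and
  \<open>\<sigma>\<close> upstairs that are inverse to each other only modulo the two torus actions.
  Both are defined on a full preimage, so one neighbourhood and one lift serve all points.\<close>

lemma trivialization:
  fixes r :: nat and f :: "cpt set \<Rightarrow> (complex ^ 2) set" and \<tau> \<sigma> :: "cpt \<Rightarrow> cpt"
  defines "A U \<equiv> {z. z \<notin> irrelevant \<and> f (hpoint r z) \<in> U}"
    and "W U \<equiv> {w \<in> prod_domain. fst (prod_point w) \<in> U}"
  assumes U: "openin (quotient_top (- {0}) ppoint) U"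
    and opn: "open (A U)" "open (W U)"
    and f: "\<And>z. z \<in> A U \<Longrightarrow> f (hpoint r z) = fst (prod_point (\<tau> z))"
    and \<tau>: "\<And>z. z \<in> A U \<Longrightarrow> \<tau> z \<in> W U" "\<And>z v. cdiff (\<lambda>z. \<tau> z $ v) z"
    and \<sigma>: "\<And>w. w \<in> W U \<Longrightarrow> \<sigma> w \<in> A U" "\<And>w v. cdiff (\<lambda>w. \<sigma> w $ v) w"
    and \<sigma>\<tau>: "\<And>z. z \<in> A U \<Longrightarrow> hpoint r (\<sigma> (\<tau> z)) = hpoint r z"
    and \<tau>\<sigma>: "\<And>w. w \<in> W U \<Longrightarrow> prod_point (\<tau> (\<sigma> w)) = prod_point w"
    and \<tau>_inv: "\<And>z z'. \<lbrakk>z \<in> A U; z' \<in> A U; hpoint r z = hpoint r z'\<rbrakk> \<Longrightarrow> prod_point (\<tau> z) = prod_point (\<tau> z')"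
    and \<sigma>_inv: "\<And>w w'. \<lbrakk>w \<in> W U; w' \<in> W U; prod_point w = prod_point w'\<rbrakk> \<Longrightarrow> hpoint r (\<sigma> w) = hpoint r (\<sigma> w')"
  shows "\<exists>\<Phi>. bij_betw \<Phi> {p \<in> hirzebruch r. f p \<in> U} (U \<times> proj_line) \<and>
        (\<forall>p\<in>hirzebruch r. f p \<in> U \<longrightarrow> fst (\<Phi> p) = f p) \<and>
        holo_map {z. z \<notin> irrelevant \<and> f (hpoint r z) \<in> U} (hpoint r) prod_domain prod_point \<Phi> \<and>
        holo_map {w \<in> prod_domain. fst (prod_point w) \<in> U} prod_point (- irrelevant) (hpoint r)
          (inv_into {p \<in> hirzebruch r. f p \<in> U} \<Phi>)"
proof -
  let ?P = "{p \<in> hirzebruch r. f p \<in> U}"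
  define \<Phi> where "\<Phi> p = prod_point (\<tau> (SOME z. z \<in> A U \<and> p = hpoint r z))" for p
  have P: "?P = hpoint r ` A U" by (auto simp: hirzebruch_def A_def)
  have \<Phi>: "\<Phi> (hpoint r z) = prod_point (\<tau> z)" if z: "z \<in> A U" for z
  proof -
    let ?z = "SOME z'. z' \<in> A U \<and> hpoint r z = hpoint r z'"
    have "?z \<in> A U \<and> hpoint r z = hpoint r ?z" by (rule someI[of _ z]) (use z in simp)
    then show ?thesis unfolding \<Phi>_def using \<tau>_inv[of ?z z] z by simp
  qed
  have inj: "inj_on \<Phi> ?P"
    unfolding P
  proof (rule inj_onI)
    fix p q assume "p \<in> hpoint r ` A U" "q \<in> hpoint r ` A U" and eq: "\<Phi> p = \<Phi> q"
    then obtain z z' where z: "z \<in> A U" "p = hpoint r z" "z' \<in> A U" "q = hpoint r z'" by blast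
    then have "hpoint r (\<sigma> (\<tau> z)) = hpoint r (\<sigma> (\<tau> z'))" using \<sigma>_inv \<tau>(1) eq \<Phi> by simp
    then show "p = q" using z \<sigma>\<tau> by simp
  qed
  have inv: "inv_into ?P \<Phi> (prod_point w) = hpoint r (\<sigma> w)" if w: "w \<in> W U" for w
  proof (rule inv_into_f_eq[OF inj])
    show "hpoint r (\<sigma> w) \<in> ?P" unfolding P using \<sigma>(1)[OF w] by blast
    show "\<Phi> (hpoint r (\<sigma> w)) = prod_point w" using \<Phi>[OF \<sigma>(1)[OF w]] \<tau>\<sigma>[OF w] by simp
  qed
  have img: "\<Phi> ` ?P = U \<times> proj_line"
  proof
    show "\<Phi> ` ?P \<subseteq> U \<times> proj_line"
    proof
      fix x assume "x \<in> \<Phi> ` ?P"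
      then obtain z where z: "z \<in> A U" "x = prod_point (\<tau> z)" unfolding P using \<Phi> by auto
      then have "\<tau> z \<in> W U" using \<tau>(1) by blast
      then show "x \<in> U \<times> proj_line" using z by (auto simp: W_def prod_domain_iff prod_point_def proj_line_def)
    qed
    show "U \<times> proj_line \<subseteq> \<Phi> ` ?P"
    proof
      fix x assume "x \<in> U \<times> proj_line"
      then obtain b c where x: "x = (b, c)" "b \<in> U" "c \<in> proj_line" by blast
      have "U \<subseteq> ppoint ` (- {0})" using U by (simp add: openin_quotient_top)
      then obtain w1 w2 where w12: "b = ppoint w1" "w1 \<noteq> 0" "c = ppoint w2" "w2 \<noteq> 0"
        using x unfolding proj_line_def by blast
      define w :: cpt where "w = (\<chi> v. if snd v = 1 then w1 $ fst v else w2 $ fst v)"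
      have col: "column 1 w = w1" "column 2 w = w2"
        by (simp_all add: w_def Finite_Cartesian_Product.vec_eq_iff)
      then have w: "w \<in> W U" "x = prod_point w"
        using w12 x by (simp_all add: W_def prod_domain_iff prod_point_def)
      then have "x = \<Phi> (hpoint r (\<sigma> w))" using \<Phi>[OF \<sigma>(1)] \<tau>\<sigma> by simp
      moreover have "hpoint r (\<sigma> w) \<in> ?P" unfolding P using \<sigma>(1) w by blast
      ultimately show "x \<in> \<Phi> ` ?P" by blast
    qed
  qed
  have "fst (\<Phi> p) = f p" if "p \<in> ?P" for p
    using that f \<Phi> unfolding P by auto
  moreover have "holo_map (A U) (hpoint r) prod_domain prod_point \<Phi>"
    unfolding holo_map_def lift_on_def
  proof (rule ballI, rule exI[of _ "A U"], rule exI[of _ \<tau>], intro conjI ballI)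
    show "\<tau> ` A U \<subseteq> prod_domain" using \<tau>(1) by (auto simp: W_def)
    show "\<exists>D. has_cderivative \<tau> D x" for x by (rule cdiff_imp_has_cderivative[OF \<tau>(2)])
  qed (use opn \<Phi> in auto)
  moreover have "holo_map (W U) prod_point (- irrelevant) (hpoint r) (inv_into ?P \<Phi>)"
    unfolding holo_map_def lift_on_def
  proof (rule ballI, rule exI[of _ "W U"], rule exI[of _ \<sigma>], intro conjI ballI)
    show "\<sigma> ` W U \<subseteq> - irrelevant" using \<sigma>(1) by (auto simp: A_def)
    show "\<exists>D. has_cderivative \<sigma> D x" for x by (rule cdiff_imp_has_cderivative[OF \<sigma>(2)])
  qed (use opn inv in auto)
  ultimately show ?thesis
    using inj img unfolding A_def W_def bij_betw_def by blast
qed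

section \<open>The projections and their local trivialisations\<close>

definition proj_valid :: "nat \<Rightarrow> 2 \<Rightarrow> bool" where
  "proj_valid r j \<longleftrightarrow> j = 1 \<or> r = 0 \<and> j = 2"

lemma proj_hpoint: "proj_valid r j \<Longrightarrow> proj j (hpoint r z) = ppoint (column j z)"
  by (auto simp: proj_valid_def proj_1 proj_2)

lemma column_nonzero: "z \<notin> irrelevant \<Longrightarrow> column j z \<noteq> 0"
  using exhaust_2[of j] by (auto simp: irrelevant_iff)

lemma holo_map_proj:
  assumes "proj_valid r j"
  shows "holo_map (- irrelevant) (hpoint r) (- {0}) ppoint (proj j)"
  unfolding holo_map_def
proof (intro ballI exI conjI)
  show "lift_on (- irrelevant) (hpoint r) (- {0}) ppoint (proj j) (- irrelevant) (column j)"
    unfolding lift_on_def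
  proof (intro conjI ballI)
    show "open (- irrelevant)" using closed_irrelevant by (rule open_Compl)
    show "column j ` (- irrelevant) \<subseteq> - {0}" using column_nonzero by auto
    show "\<exists>D. has_cderivative (column j) D x" for x
      by (rule cdiff_imp_has_cderivative) (simp add: cdiff_component)
    show "proj j (hpoint r x) = ppoint (column j x)" for x by (rule proj_hpoint[OF assms])
  qed simp
qed

lemma open_component_nonzero: "open {w :: complex ^ 'n. w $ l \<noteq> 0}"
  by (intro open_Collect_neq continuous_intros)

text \<open>Where z_k1 is nonzero, the factor z_k1^r raises the weight of z12 to that of z22, so the
  second column becomes a point of the projective line. The inverse would divide z12 by this factor;
  multiplying z22 by it instead gives the same orbit and stays polynomial.\<close>

lemma p1_fibration_proj_1: "p1_fibration r (proj 1)"
  unfolding p1_fibration_def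
proof (intro conjI ballI)
  show "holo_map (- irrelevant) (hpoint r) (- {0}) ppoint (proj 1)"
    by (rule holo_map_proj) (simp add: proj_valid_def)
  fix b assume "b \<in> proj_line"
  then obtain w0 where w0: "b = ppoint w0" "w0 \<noteq> 0" unfolding proj_line_def by blast
  then obtain k :: 2 where k: "w0 $ k \<noteq> 0" by (auto simp: Finite_Cartesian_Product.vec_eq_iff)
  define U where "U = ppoint ` {w. w $ k \<noteq> 0}"
  have in_U: "ppoint w \<in> U \<longleftrightarrow> w $ k \<noteq> 0" for w
  proof
    assume "ppoint w \<in> U"
    then obtain w' where "w' $ k \<noteq> 0" "ppoint w = ppoint w'" unfolding U_def by blast
    then show "w $ k \<noteq> 0" by (auto simp: ppoint_eq_iff)
  qed (simp add: U_def)
  note op = open_component_nonzero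
  have openU: "openin (quotient_top (- {0}) ppoint) U"
    unfolding openin_quotient_top
  proof
    show "U \<subseteq> ppoint ` (- {0})" unfolding U_def by (rule image_mono) auto
    have "{a \<in> - {0}. ppoint a \<in> U} = {w. w $ k \<noteq> 0}" unfolding in_U by auto
    then show "open {a \<in> - {0}. ppoint a \<in> U}" using op[of k] by simp
  qed
  have b: "b \<in> U" using w0 k in_U by simp
  define \<tau> :: "cpt \<Rightarrow> cpt" where "\<tau> z = (\<chi> v. if v = (1, 2) then z $ v * z $ (k, 1) ^ r else z $ v)" for z
  define \<sigma> :: "cpt \<Rightarrow> cpt" where "\<sigma> z = (\<chi> v. if v = (2, 2) then z $ v * z $ (k, 1) ^ r else z $ v)" for z
  have \<tau>c [simp]: "\<tau> z $ (i, 1) = z $ (i, 1)" "\<tau> z $ (1, 2) = z $ (1, 2) * z $ (k, 1) ^ r" "\<tau> z $ (2, 2) = z $ (2, 2)" for z i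
    by (simp_all add: \<tau>_def)
  have \<sigma>c [simp]: "\<sigma> z $ (i, 1) = z $ (i, 1)" "\<sigma> z $ (1, 2) = z $ (1, 2)" "\<sigma> z $ (2, 2) = z $ (2, 2) * z $ (k, 1) ^ r" for z i
    by (simp_all add: \<sigma>_def)
  have A: "{z. z \<notin> irrelevant \<and> proj 1 (hpoint r z) \<in> U} = - irrelevant \<inter> {z. z $ (k, 1) \<noteq> 0}"
    unfolding proj_1 in_U by auto
  have W: "{w \<in> prod_domain. fst (prod_point w) \<in> U} = - irrelevant \<inter> {z. z $ (k, 1) \<noteq> 0}"
    unfolding prod_point_def fst_conv in_U prod_domain_eq by auto
  have rel: "\<tau> z \<notin> irrelevant" "\<sigma> z \<notin> irrelevant" if "z \<notin> irrelevant" "z $ (k, 1) \<noteq> 0" for z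
    using that by (auto simp: irrelevant_def)
  show "\<exists>U \<Phi>. openin (quotient_top (- {0}) ppoint) U \<and> b \<in> U \<and>
        bij_betw \<Phi> {p \<in> hirzebruch r. proj 1 p \<in> U} (U \<times> proj_line) \<and>
        (\<forall>p\<in>hirzebruch r. proj 1 p \<in> U \<longrightarrow> fst (\<Phi> p) = proj 1 p) \<and>
        holo_map {z. z \<notin> irrelevant \<and> proj 1 (hpoint r z) \<in> U} (hpoint r) prod_domain prod_point \<Phi> \<and>
        holo_map {w \<in> prod_domain. fst (prod_point w) \<in> U} prod_point (- irrelevant) (hpoint r)
          (inv_into {p \<in> hirzebruch r. proj 1 p \<in> U} \<Phi>)"
  proof (rule exI[of _ U], rule exE[OF trivialization[OF openU, of "proj 1" r \<tau> \<sigma>]], unfold A W)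
    show "open (- irrelevant \<inter> {z. z $ (k, 1) \<noteq> 0})" "open (- irrelevant \<inter> {z. z $ (k, 1) \<noteq> 0})"
      by (rule open_Int open_Compl closed_irrelevant op)+
    show "cdiff (\<lambda>z. \<tau> z $ v) z" for z v
      by (cases "v = (1, 2)") (simp_all add: \<tau>_def cdiff_component cdiff_mult cdiff_power)
    show "cdiff (\<lambda>z. \<sigma> z $ v) z" for z v
      by (cases "v = (2, 2)") (simp_all add: \<sigma>_def cdiff_component cdiff_mult cdiff_power)
    show "proj 1 (hpoint r z) = fst (prod_point (\<tau> z))" for z
      by (simp add: proj_1 prod_point_def column_def)
    fix z z' assume z: "z \<in> - irrelevant \<inter> {z. z $ (k, 1) \<noteq> 0}"
    then show "\<tau> z \<in> - irrelevant \<inter> {z. z $ (k, 1) \<noteq> 0}" "\<sigma> z \<in> - irrelevant \<inter> {z. z $ (k, 1) \<noteq> 0}"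
      using rel by auto
    have xk: "z $ (k, 1) \<noteq> 0" using z by simp
    show "hpoint r (\<sigma> (\<tau> z)) = hpoint r z"
    proof (rule hpoint_eqI)
      have "\<forall>v. \<sigma> (\<tau> z) $ v = act r 1 (z $ (k, 1) ^ r) z $ v"
        unfolding all_idx by (simp add: act_component zdeg_def)
      then show "\<sigma> (\<tau> z) = act r 1 (z $ (k, 1) ^ r) z"
        by (rule Finite_Cartesian_Product.vec_eq_iff[THEN iffD2])
    qed (use xk in auto)
    show "prod_point (\<tau> (\<sigma> z)) = prod_point z"
    proof (rule prod_point_eqI[of 1 "z $ (k, 1) ^ r"])
      show "\<tau> (\<sigma> z) $ (i, 2) = z $ (k, 1) ^ r * z $ (i, 2)" for i
        using exhaust_2[of i] by auto
    qed (use xk in auto)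
    assume z': "z' \<in> - irrelevant \<inter> {z. z $ (k, 1) \<noteq> 0}"
    show "prod_point (\<tau> z) = prod_point (\<tau> z')" if eq: "hpoint r z = hpoint r z'"
    proof -
      obtain l m where lm: "l \<noteq> 0" "m \<noteq> 0" "z = act r l m z'" using hpoint_eqD[OF eq] .
      show ?thesis
      proof (rule prod_point_eqI[of l "m * l ^ r"])
        show "\<tau> z $ (i, 1) = l * \<tau> z' $ (i, 1)" for i
          by (simp add: lm act_component zdeg_def)
        show "\<tau> z $ (i, 2) = m * l ^ r * \<tau> z' $ (i, 2)" for i
          using exhaust_2[of i] by (auto simp: lm act_component zdeg_def power_mult_distrib)
      qed (use lm in auto)
    qed
    show "hpoint r (\<sigma> z) = hpoint r (\<sigma> z')" if eq: "prod_point z = prod_point z'"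
    proof -
      obtain a b where ab: "a \<noteq> 0" "b \<noteq> 0" "\<And>i. z $ (i, 1) = a * z' $ (i, 1)" "\<And>i. z $ (i, 2) = b * z' $ (i, 2)"
        using prod_point_eqD[OF eq] by blast
      have "\<forall>v. \<sigma> z $ v = act r a b (\<sigma> z') $ v"
        unfolding all_idx by (simp add: act_component zdeg_def ab power_mult_distrib)
      then have "\<sigma> z = act r a b (\<sigma> z')" by (rule Finite_Cartesian_Product.vec_eq_iff[THEN iffD2])
      then show ?thesis using ab by simp
    qed
  qed (use openU b in blast)
qed

text \<open>For r = 0 the two columns scale independently, and exchanging them is a trivialisation
  over the whole line.\<close>

lemma p1_fibration_proj_2: "p1_fibration 0 (proj 2)"
  unfolding p1_fibration_def
proof (intro conjI ballI)
  show "holo_map (- irrelevant) (hpoint 0) (- {0}) ppoint (proj 2)"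
    by (rule holo_map_proj) (simp add: proj_valid_def)
  fix b assume b: "b \<in> proj_line"
  let ?U = "proj_line"
  have openU: "openin (quotient_top (- {0}) ppoint) ?U"
  proof -
    have "{a \<in> - {0}. ppoint a \<in> ?U} = - {0}" unfolding proj_line_def by auto
    then show ?thesis unfolding openin_quotient_top by (simp add: proj_line_def open_Compl)
  qed
  define \<tau> :: "cpt \<Rightarrow> cpt" where "\<tau> z = (\<chi> v. z $ (fst v, if snd v = 1 then 2 else 1))" for z
  have \<tau>c [simp]: "\<tau> z $ (i, 1) = z $ (i, 2)" "\<tau> z $ (i, 2) = z $ (i, 1)" for z i
    by (simp_all add: \<tau>_def)
  have \<tau>\<tau>: "\<tau> (\<tau> z) = z" for z
  proof -
    have "\<forall>v. \<tau> (\<tau> z) $ v = z $ v" unfolding all_idx by simp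
    then show ?thesis by (rule Finite_Cartesian_Product.vec_eq_iff[THEN iffD2])
  qed
  have in_line: "ppoint w \<in> ?U" if "w \<noteq> 0" for w using that unfolding proj_line_def by blast
  have A: "{z. z \<notin> irrelevant \<and> proj 2 (hpoint 0 z) \<in> ?U} = - irrelevant"
    unfolding proj_2 using column_nonzero in_line by blast
  have W: "{w \<in> prod_domain. fst (prod_point w) \<in> ?U} = - irrelevant"
    unfolding prod_point_def fst_conv prod_domain_eq using column_nonzero in_line by blast
  show "\<exists>U \<Phi>. openin (quotient_top (- {0}) ppoint) U \<and> b \<in> U \<and>
        bij_betw \<Phi> {p \<in> hirzebruch 0. proj 2 p \<in> U} (U \<times> proj_line) \<and>
        (\<forall>p\<in>hirzebruch 0. proj 2 p \<in> U \<longrightarrow> fst (\<Phi> p) = proj 2 p) \<and>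
        holo_map {z. z \<notin> irrelevant \<and> proj 2 (hpoint 0 z) \<in> U} (hpoint 0) prod_domain prod_point \<Phi> \<and>
        holo_map {w \<in> prod_domain. fst (prod_point w) \<in> U} prod_point (- irrelevant) (hpoint 0)
          (inv_into {p \<in> hirzebruch 0. proj 2 p \<in> U} \<Phi>)"
  proof (rule exI[of _ ?U], rule exE[OF trivialization[OF openU, of "proj 2" 0 \<tau> \<tau>]], unfold A W)
    show "open (- irrelevant)" "open (- irrelevant)" by (rule open_Compl closed_irrelevant)+
    show "cdiff (\<lambda>z. \<tau> z $ v) z" "cdiff (\<lambda>z. \<tau> z $ v) z" for z v
      by (simp_all add: \<tau>_def cdiff_component)
    show "proj 2 (hpoint 0 z) = fst (prod_point (\<tau> z))" for z
      by (simp add: proj_2 prod_point_def column_def)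
    show "hpoint 0 (\<tau> (\<tau> z)) = hpoint 0 z" "prod_point (\<tau> (\<tau> z)) = prod_point z" for z
      by (simp_all add: \<tau>\<tau>)
    fix z z' assume "z \<in> - irrelevant"
    then show "\<tau> z \<in> - irrelevant" "\<tau> z \<in> - irrelevant" by (auto simp: irrelevant_def)
    show "prod_point (\<tau> z) = prod_point (\<tau> z')" if eq: "hpoint 0 z = hpoint 0 z'"
    proof -
      obtain l m where lm: "l \<noteq> 0" "m \<noteq> 0" "z = act 0 l m z'" using hpoint_eqD[OF eq] .
      show ?thesis
      proof (rule prod_point_eqI[of m l])
        show "\<tau> z $ (i, 1) = m * \<tau> z' $ (i, 1)" "\<tau> z $ (i, 2) = l * \<tau> z' $ (i, 2)" for i
          using exhaust_2[of i] by (auto simp: lm act_component zdeg_def)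
      qed (use lm in auto)
    qed
    show "hpoint 0 (\<tau> z) = hpoint 0 (\<tau> z')" if eq: "prod_point z = prod_point z'"
    proof -
      obtain a b where ab: "a \<noteq> 0" "b \<noteq> 0" "\<And>i. z $ (i, 1) = a * z' $ (i, 1)" "\<And>i. z $ (i, 2) = b * z' $ (i, 2)"
        using prod_point_eqD[OF eq] by blast
      have "\<forall>v. \<tau> z $ v = act 0 b a (\<tau> z') $ v"
        unfolding all_idx by (simp add: act_component zdeg_def ab)
      then have "\<tau> z = act 0 b a (\<tau> z')" by (rule Finite_Cartesian_Product.vec_eq_iff[THEN iffD2])
      then show ?thesis using ab by simp
    qed
  qed (use openU b in blast)
qed

section \<open>Leaves of the pencils\<close>

lemma eval_pencil_form:
  "(\<Sum>v\<in>UNIV. eval_cox (pencil_form j v) z * x $ v) = z $ (2, j) * x $ (1, j) - z $ (1, j) * x $ (2, j)"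
  using exhaust_2[of j] by (auto simp: sum_idx pencil_form_def eval_cox_uminus)

text \<open>A lift \<open>g\<close> is proportional to column j, but with a factor that varies over
  \<open>N\<close>. Differentiating the relation g_1 z_2j = g_2 z_1j instead relates the
  differential of \<open>g\<close> to the pencil form without mentioning this factor.\<close>

lemma given_by_proj:
  assumes j: "proj_valid r j" and \<omega>: "same_foliation \<omega> (pencil_form j)"
  shows "given_by r \<omega> (proj j)"
  unfolding given_by_def
proof (intro conjI allI impI)
  show "holo_map (- irrelevant) (hpoint r) (- {0}) ppoint (proj j)" by (rule holo_map_proj[OF j])
  fix z N g D x
  assume z: "z \<in> N" and lift: "lift_on (- irrelevant) (hpoint r) (- {0}) ppoint (proj j) N g"
    and D: "has_cderivative g D z"
  obtain c where c: "c \<noteq> 0" "\<And>v. \<omega> v = const c * pencil_form j v" using \<omega> by (auto simp: same_foliation_def)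
  have N: "open N" "N \<subseteq> - irrelevant" "g ` N \<subseteq> - {0}" "\<And>y. y \<in> N \<Longrightarrow> proj j (hpoint r y) = ppoint (g y)"
    using lift by (auto simp: lift_on_def)
  have par: "\<exists>k. k \<noteq> 0 \<and> g y = k *s column j y" if "y \<in> N" for y
  proof -
    have "ppoint (g y) = ppoint (column j y)" using N(4)[OF that] proj_hpoint[OF j, of y] by simp
    then show ?thesis by (simp only: ppoint_eq_iff)
  qed
  have rel: "g y $ 1 * y $ (2, j) = g y $ 2 * y $ (1, j)" if "y \<in> N" for y
    using par[OF that] by auto
  have dg: "((\<lambda>y. g y $ i) has_derivative (\<lambda>y. D y $ i)) (at z)" for i
    using D bounded_linear.has_derivative[OF bounded_linear_vec_nth] unfolding has_cderivative_def by blast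
  have dc: "((\<lambda>y. y $ v) has_derivative (\<lambda>y. y $ v)) (at z)" for v :: idx
    by (rule bounded_linear_imp_has_derivative) (rule bounded_linear_vec_nth)
  have d1: "((\<lambda>y. g y $ 1 * y $ (2, j)) has_derivative (\<lambda>h. g z $ 1 * h $ (2, j) + D h $ 1 * z $ (2, j))) (at z)"
    by (rule has_derivative_mult[OF dg dc])
  have d2: "((\<lambda>y. g y $ 2 * y $ (1, j)) has_derivative (\<lambda>h. g z $ 2 * h $ (1, j) + D h $ 2 * z $ (1, j))) (at z)"
    by (rule has_derivative_mult[OF dg dc])
  have "(\<lambda>h. g z $ 1 * h $ (2, j) + D h $ 1 * z $ (2, j)) = (\<lambda>h. g z $ 2 * h $ (1, j) + D h $ 2 * z $ (1, j))"
    using has_derivative_unique[OF has_derivative_transform_within_open[OF d1 N(1) z rel] d2] .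
  then have eq: "g z $ 1 * x $ (2, j) + D x $ 1 * z $ (2, j) = g z $ 2 * x $ (1, j) + D x $ 2 * z $ (1, j)"
    by (rule fun_cong)
  obtain k where k: "k \<noteq> 0" "g z = k *s column j z" using par[OF z] by blast
  have zc: "z $ (1, j) \<noteq> 0 \<or> z $ (2, j) \<noteq> 0"
    using column_nonzero[of z j] N(2) z column_eq_0_iff by blast
  have key: "k * (z $ (2, j) * x $ (1, j) - z $ (1, j) * x $ (2, j)) = D x $ 1 * z $ (2, j) - D x $ 2 * z $ (1, j)"
    using eq by (simp add: k(2) algebra_simps)
  have "(\<Sum>v\<in>UNIV. eval_cox (\<omega> v) z * x $ v) = c * (\<Sum>v\<in>UNIV. eval_cox (pencil_form j v) z * x $ v)"
    by (simp add: c eval_cox_mult sum_distrib_left mult.assoc)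
  then have "(\<Sum>v\<in>UNIV. eval_cox (\<omega> v) z * x $ v) = 0 \<longleftrightarrow>
      k * (z $ (2, j) * x $ (1, j) - z $ (1, j) * x $ (2, j)) = 0"
    unfolding eval_pencil_form using c(1) k(1) by simp
  also have "\<dots> \<longleftrightarrow> D x $ 1 * z $ (2, j) = D x $ 2 * z $ (1, j)" unfolding key by simp
  also have "\<dots> \<longleftrightarrow> (\<exists>c. D x = c *s g z)"
  proof
    assume e: "D x $ 1 * z $ (2, j) = D x $ 2 * z $ (1, j)"
    define c where "c = (if z $ (1, j) = 0 then D x $ 2 / (k * z $ (2, j)) else D x $ 1 / (k * z $ (1, j)))"
    have "D x = c *s g z"
      unfolding Finite_Cartesian_Product.vec_eq_iff forall_2
      using e k(1) zc by (auto simp: c_def k(2) field_simps)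
    then show "\<exists>c. D x = c *s g z" ..
  next
    assume "\<exists>c. D x = c *s g z"
    then show "D x $ 1 * z $ (2, j) = D x $ 2 * z $ (1, j)" by (auto simp: k(2))
  qed
  finally show "(\<Sum>v\<in>UNIV. eval_cox (\<omega> v) z * x $ v) = 0 \<longleftrightarrow> (\<exists>c. D x = c *s g z)" .
qed


section \<open>Counting zeros over the projective line\<close>

text \<open>A pair of polynomials related by \<open>S(u) = \<epsilon> u\<^sup>c S'(1/u)\<close> is a section of the line bundle of degree \<open>c\<close> over the
  projective line, written in the two charts.\<close>

lemma poly_no_root_const:
  fixes S :: "complex poly"
  assumes "\<And>u. poly S u \<noteq> 0"
  obtains a where "S = [:a:]" "a \<noteq> 0"
proof -
  have "degree S = 0"
    using assms fundamental_theorem_of_algebra[of S] constant_degree[of S] by blast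
  then obtain a where "S = [:a:]" by (rule degree_eq_zeroE)
  with assms[of 0] that show ?thesis by simp
qed

lemma poly_eq_off_zero:
  fixes p q :: "complex poly"
  assumes "\<And>u. u \<noteq> 0 \<Longrightarrow> poly p u = poly q u"
  shows "p = q"
proof (rule ccontr)
  assume "p \<noteq> q"
  then have "finite {u. poly (p - q) u = 0}" using poly_roots_finite[of "p - q"] by simp
  moreover have "UNIV - {0} \<subseteq> {u. poly (p - q) u = 0}" using assms by auto
  ultimately have "finite (UNIV - {0 :: complex})" by (rule finite_subset[rotated])
  then show False using infinite_UNIV_char_0[where 'a = complex] by simp
qed

text \<open>Both polynomials are constant by the fundamental theorem of algebra, so u^c takes the
  same value at 1 and 2.\<close>

lemma section_without_zeros:
  fixes S S' :: "complex poly" and c :: int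
  assumes "\<And>u. poly S u \<noteq> 0" "\<And>u. poly S' u \<noteq> 0"
    and trans: "\<And>u. u \<noteq> 0 \<Longrightarrow> poly S u = \<epsilon> * u powi c * poly S' (1 / u)"
  shows "c = 0"
proof -
  obtain a where a: "S = [:a:]" "a \<noteq> 0" using poly_no_root_const[OF assms(1)] .
  obtain b where b: "S' = [:b:]" "b \<noteq> 0" using poly_no_root_const[OF assms(2)] .
  have "a = \<epsilon> * b" "a = \<epsilon> * 2 powi c * b" using trans[of 1] trans[of 2] a b by simp_all
  then have "(2 :: complex) powi c = 1" using a b by auto
  then have "norm ((2 :: complex) powi c) = 1" by simp
  then have "(2 :: real) powi c = 1" by (simp add: norm_power_int)
  then have "(2 :: real) powr (real_of_int c) = 1" by (simp add: powr_real_of_int')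
  then show ?thesis by simp
qed

text \<open>The zero accounts for a factor 1 - u0 u in the second chart, which leaves u^(c - 1) up
  to a constant. A positive exponent would make \<open>S'\<close> vanish at 0, and a negative one is
  incompatible with \<open>S'\<close> being a polynomial.\<close>

lemma section_with_simple_zero:
  fixes S S' :: "complex poly" and c :: int
  assumes root: "\<And>u. poly S u = 0 \<longleftrightarrow> u = u0" and simple: "poly (pderiv S) u0 \<noteq> 0"
    and S'0: "poly S' 0 \<noteq> 0"
    and trans: "\<And>u. u \<noteq> 0 \<Longrightarrow> poly S' u = \<epsilon> * u powi c * poly S (1 / u)"
  shows "c = 1"
proof -
  obtain T where T: "S = [:- u0, 1:] * T" using root[of u0] poly_eq_0_iff_dvd by (metis dvdE)
  have "poly T u0 = poly (pderiv S) u0" unfolding T by (rule poly_pderiv_linear_mult[symmetric])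
  then have "poly T u \<noteq> 0" for u using simple root[of u] unfolding T by (cases "u = u0") auto
  then obtain b where b: "T = [:b:]" "b \<noteq> 0" using poly_no_root_const by blast
  define a where "a = \<epsilon> * b"
  have S': "poly S' u = a * u powi (c - 1) * (1 - u0 * u)" if u: "u \<noteq> 0" for u
  proof -
    have "poly S (1 / u) = b * (1 - u0 * u) / u" using u by (simp add: T b field_simps)
    then show ?thesis unfolding trans[OF u] using u by (simp add: a_def power_int_diff)
  qed
  have a: "a \<noteq> 0"
  proof
    assume "a = 0"
    then have "poly S' u = poly 0 u" if "u \<noteq> 0" for u using S'[OF that] by simp
    then have "S' = 0" by (rule poly_eq_off_zero)
    with S'0 show False by simp
  qed
  show ?thesis
  proof (rule ccontr)
    assume "c \<noteq> 1"
    then consider k where "c - 1 = int (Suc k)" | k where "1 - c = int (Suc k)"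
      by (cases "c > 1") (metis diff_gt_0_iff_gt zero_less_imp_eq_int gr0_implies_Suc linorder_neqE)+
    then show False
    proof cases
      case 1
      have "poly S' u = poly (monom a (Suc k) * [:1, - u0:]) u" if "u \<noteq> 0" for u
        using S'[OF that] unfolding 1 power_int_of_nat by (simp add: poly_monom algebra_simps)
      then have "S' = monom a (Suc k) * [:1, - u0:]" by (rule poly_eq_off_zero)
      then show False using S'0 by (simp add: poly_monom)
    next
      case 2
      have "c - 1 = - int (Suc k)" using 2 by simp
      then have "poly (monom 1 (Suc k) * S') u = poly [:a, - a * u0:] u" if "u \<noteq> 0" for u
        using S'[OF that] that by (simp only: power_int_minus power_int_of_nat) (simp add: poly_monom field_simps)
      then have "monom 1 (Suc k) * S' = [:a, - a * u0:]" by (rule poly_eq_off_zero)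
      then have "poly (monom 1 (Suc k) * S') 0 = a" by simp
      then show False using a by (simp add: poly_monom)
    qed
  qed
qed


section \<open>Foliations of small degree\<close>

text \<open>Choosing one zero per fibre maps the base coordinates injectively into the singular
  set.\<close>

lemma finite_Sing_imp_finite_fibres:
  assumes "finite (Sing r \<omega>)"
  shows "finite {u. \<exists>s t. (s \<noteq> 0 \<or> t \<noteq> 0) \<and> cpoint i u s t \<in> form_zeros \<omega>}" (is "finite ?U")
proof -
  have "\<exists>w. \<forall>u\<in>?U. cpoint i u (fst (w u)) (snd (w u)) \<in> form_zeros \<omega>"
    by (rule bchoice) auto
  then obtain w where w: "\<And>u. u \<in> ?U \<Longrightarrow> cpoint i u (fst (w u)) (snd (w u)) \<in> form_zeros \<omega>" by blast
  let ?h = "\<lambda>u. hpoint r (cpoint i u (fst (w u)) (snd (w u)))"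
  have inj: "inj_on ?h ?U" by (intro inj_onI) (rule hpoint_cpoint_eqD(1))
  have "?h ` ?U \<subseteq> Sing r \<omega>" unfolding Sing_eq using w by blast
  then have "finite (?h ` ?U)" using assms by (rule finite_subset)
  then show ?thesis using inj by (rule finite_imageD)
qed

lemma finite_Sing_imp_not_fibre:
  assumes fin: "finite (Sing r \<omega>)"
  shows "\<exists>t. cpoint i u 1 t \<notin> form_zeros \<omega>"
proof (rule ccontr)
  assume "\<not> ?thesis"
  then have "range (\<lambda>t. hpoint r (cpoint i u 1 t)) \<subseteq> Sing r \<omega>" by (auto simp: Sing_eq)
  then have "finite (range (\<lambda>t. hpoint r (cpoint i u 1 t)))" using fin finite_subset by blast
  moreover have "inj (\<lambda>t. hpoint r (cpoint i u 1 t))"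
    by (intro injI) (auto dest: hpoint_cpoint_eqD(2))
  ultimately show False using finite_imageD infinite_UNIV_char_0 by blast
qed

text \<open>A negative d2 leaves only the zero form. Otherwise g = 0 and the zeros are those of q,
  of degree d2 on each fibre: for d2 = 1 every fibre would contain one, and for d2 = 0 the
  coefficient q is a section of degree d1 - 2 over the line.\<close>

lemma low_degree_foliation:
  assumes F: "foliation r (d1, d2) \<omega>" and "d2 \<le> 1"
  shows "d1 = 2 \<and> d2 = 0"
proof -
  have tw: "twisted_form r (d1, d2) \<omega>" using F by (simp add: foliation_def)
  have fin: "finite (Sing r \<omega>)" by (rule foliation_finite_Sing[OF F])
  have "d2 \<ge> 0"
  proof (rule ccontr)
    assume neg: "\<not> d2 \<ge> 0"
    have "\<omega> v = 0" for v
    proof (rule homogeneous_negative)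
      show "homogeneous r (d1 - int (fst (zdeg r v)), d2 - int (snd (zdeg r v))) (\<omega> v)"
        using tw unfolding twisted_form_def by (metis fst_conv snd_conv)
    qed (use neg in simp)
    then have "cpoint 1 0 1 t \<in> form_zeros \<omega>" for t by (simp add: form_zeros_def)
    then show False using finite_Sing_imp_not_fibre[OF fin] by blast
  qed
  define D where "D = nat d2"
  have d2: "d2 = int D" using \<open>d2 \<ge> 0\<close> by (simp add: D_def)
  note tw' = tw[unfolded d2]
  have D: "D = 0 \<or> D = 1" using \<open>d2 \<le> 1\<close> d2 by auto
  have zero: "cpoint i u s t \<in> form_zeros \<omega> \<longleftrightarrow> form_eval (Suc D) (spec (Suc D) (Qco i \<omega>) u) s t = 0"
    if "s \<noteq> 0 \<or> t \<noteq> 0" for i u s t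
    using cpoint_zero_iff[OF tw' that] D by (auto simp: form_eval_def)
  show ?thesis
  proof (cases "D = 0")
    case False
    then have D1: "D = Suc 0" using D by simp
    have "\<exists>s t. (s \<noteq> 0 \<or> t \<noteq> 0) \<and> cpoint 1 u s t \<in> form_zeros \<omega>" for u
    proof -
      obtain s t where "s \<noteq> 0 \<or> t \<noteq> 0" "form_eval (Suc (Suc 0)) (spec (Suc (Suc 0)) (Qco 1 \<omega>) u) s t = 0"
        using form_has_zero[OF short_spec] by blast
      then show ?thesis using zero unfolding D1 by blast
    qed
    then have "finite (UNIV :: complex set)" using finite_Sing_imp_finite_fibres[OF fin, of 1] by simp
    then show ?thesis using infinite_UNIV_char_0 by blast
  next
    case True
    \<comment> \<open>Being of degree 0 in (s, t), q would vanish on a whole fibre if it vanished at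
      one of its points.\<close>
    have nz: "poly (Qco i \<omega> 0) u \<noteq> 0" for i u
    proof
      assume "poly (Qco i \<omega> 0) u = 0"
      then have "cpoint i u 1 t \<in> form_zeros \<omega>" for t using zero[of 1 t i u] True by (simp add: form_eval_spec)
      then show False using finite_Sing_imp_not_fibre[OF fin] by blast
    qed
    have "d1 - 2 = 0"
    proof (rule section_without_zeros[of "Qco 1 \<omega> 0" "Qco 2 \<omega> 0" "- 1"])
      show "poly (Qco 1 \<omega> 0) u = - 1 * u powi (d1 - 2) * poly (Qco 2 \<omega> 0) (1 / u)" if "u \<noteq> 0" for u
        using Qco_transition[OF tw' one_neq_two(1) that, of 0] by simp
    qed (rule nz)+
    then show ?thesis using d2 True by simp
  qed
qed

text \<open>Both pencils are treated at once, \<open>j'\<close> being the other column. The degree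
  leaves linear forms in column j as coefficients, that is, a constant 2 by 2 matrix; the
  contraction makes it skew-symmetric.\<close>

lemma pencil_foliation:
  assumes j: "proj_valid r j" and F: "foliation r (if j = 1 then (2, 0) else (0, 2)) \<omega>"
  shows "same_foliation \<omega> (pencil_form j)"
proof -
  let ?d = "if j = 1 then (2, 0) else (0, 2) :: int \<times> int"
  define j' :: 2 where "j' = (if j = 1 then 2 else 1)"
  have tw: "twisted_form r ?d \<omega>" using F by (simp add: foliation_def)
  have hom: "homogeneous r (fst ?d - int (fst (zdeg r v)), snd ?d - int (snd (zdeg r v))) (\<omega> v)" for v
    using tw unfolding twisted_form_def by blast
  have jj: "j \<noteq> j'" "j = 1 \<or> j = 2" "j = 2 \<Longrightarrow> r = 0" using j by (auto simp: j'_def proj_valid_def)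
  have zero: "\<omega> (i, j') = 0" for i
    by (rule homogeneous_negative[OF hom]) (use jj exhaust_2[of i] in \<open>auto simp: j'_def zdeg_def\<close>)
  have keys: "m = Poly_Mapping.single (1, j) 1 \<or> m = Poly_Mapping.single (2, j) 1"
    if m: "m \<in> Poly_Mapping.keys (\<omega> (i, j))" for m i
  proof -
    note h = homogeneous_monomial[OF hom m]
    have vals: "Poly_Mapping.lookup m (1, j') = 0" "Poly_Mapping.lookup m (2, j') = 0"
      "Poly_Mapping.lookup m (1, j) + Poly_Mapping.lookup m (2, j) = 1"
    proof -
      consider "j = 1" | "j = 2" "r = 0" using jj by blast
      then have "Poly_Mapping.lookup m (1, j') = 0 \<and> Poly_Mapping.lookup m (2, j') = 0 \<and>
        Poly_Mapping.lookup m (1, j) + Poly_Mapping.lookup m (2, j) = 1"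
      proof cases
        case 1
        then have "int (Poly_Mapping.lookup m (1, 2)) + int (Poly_Mapping.lookup m (2, 2)) = 0" using h(2) by simp
        then have 0: "Poly_Mapping.lookup m (1, 2) = 0" "Poly_Mapping.lookup m (2, 2) = 0" by linarith+
        with 1 h(1) have "int (Poly_Mapping.lookup m (1, 1)) + int (Poly_Mapping.lookup m (2, 1)) = 1" by simp
        then show ?thesis using 0 1 by (simp add: j'_def)
      next
        case 2
        then have "int (Poly_Mapping.lookup m (1, 1)) + int (Poly_Mapping.lookup m (2, 1)) = 0"
          "int (Poly_Mapping.lookup m (1, 2)) + int (Poly_Mapping.lookup m (2, 2)) = 1"
          using h exhaust_2[of i] by (auto simp: zdeg_def)
        then show ?thesis using 2 by (simp add: j'_def)
      qed
      then show "Poly_Mapping.lookup m (1, j') = 0" "Poly_Mapping.lookup m (2, j') = 0"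
        "Poly_Mapping.lookup m (1, j) + Poly_Mapping.lookup m (2, j) = 1" by blast+
    qed
    then consider "Poly_Mapping.lookup m (1, j) = 1" "Poly_Mapping.lookup m (2, j) = 0"
      | "Poly_Mapping.lookup m (1, j) = 0" "Poly_Mapping.lookup m (2, j) = 1" by linarith
    then show ?thesis
    proof cases
      case 1
      have "\<forall>v. Poly_Mapping.lookup m v = Poly_Mapping.lookup (Poly_Mapping.single (1, j) 1) v"
        unfolding all_idx using 1 vals jj by (auto simp: lookup_single when_def j'_def)
      then show ?thesis by (intro disjI1 poly_mapping_eqI) blast
    next
      case 2
      have "\<forall>v. Poly_Mapping.lookup m v = Poly_Mapping.lookup (Poly_Mapping.single (2, j) 1) v"
        unfolding all_idx using 2 vals jj by (auto simp: lookup_single when_def j'_def)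
      then show ?thesis by (intro disjI2 poly_mapping_eqI) blast
    qed
  qed
  have ne: "Poly_Mapping.single (2 :: 2, j) (Suc 0) \<noteq> Poly_Mapping.single (1 :: 2, j) (Suc 0)"
  proof
    assume "Poly_Mapping.single (2 :: 2, j) (Suc 0) = Poly_Mapping.single (1 :: 2, j) (Suc 0)"
    then have "Poly_Mapping.lookup (Poly_Mapping.single (2 :: 2, j) (Suc 0)) (1, j)
        = Poly_Mapping.lookup (Poly_Mapping.single (1 :: 2, j) (Suc 0)) (1, j)" by (rule arg_cong)
    then show False by (simp add: lookup_single)
  qed
  have lin: "\<omega> (i, j) = const (Poly_Mapping.lookup (\<omega> (i, j)) (Poly_Mapping.single (1, j) 1)) * zvar (1, j)
      + const (Poly_Mapping.lookup (\<omega> (i, j)) (Poly_Mapping.single (2, j) 1)) * zvar (2, j)" for i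
  proof (rule poly_mapping_eqI)
    fix m
    show "Poly_Mapping.lookup (\<omega> (i, j)) m = Poly_Mapping.lookup (const (Poly_Mapping.lookup (\<omega> (i, j)) (Poly_Mapping.single (1, j) 1)) * zvar (1, j)
      + const (Poly_Mapping.lookup (\<omega> (i, j)) (Poly_Mapping.single (2, j) 1)) * zvar (2, j)) m"
      using keys[of m i] ne
      by (auto simp: const_def zvar_def mult_single lookup_add lookup_single when_def in_keys_iff)
  qed
  define c where "c i k = Poly_Mapping.lookup (\<omega> (i, j)) (Poly_Mapping.single (k, j) 1)" for i k
  have lin': "\<omega> (i, j) = const (c i 1) * zvar (1, j) + const (c i 2) * zvar (2, j)" for i
    unfolding c_def by (rule lin)
  have rel: "z $ (1, j) * (c 1 1 * z $ (1, j) + c 1 2 * z $ (2, j)) + z $ (2, j) * (c 2 1 * z $ (1, j) + c 2 2 * z $ (2, j)) = 0" for z :: cpt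
  proof -
    have "eval_cox (contract (R1 r) \<omega>) z = 0" "eval_cox (contract R2 \<omega>) z = 0"
      using tw by (simp_all add: twisted_form_def)
    then have "z $ (1, j) * eval_cox (\<omega> (1, j)) z + z $ (2, j) * eval_cox (\<omega> (2, j)) z = 0"
      using jj zero unfolding contract_def
      by (auto simp: sum_idx R1_def R2_def eval_cox_add eval_cox_mult j'_def)
    then show ?thesis by (simp add: lin' eval_cox_add eval_cox_mult)
  qed
  \<comment> \<open>The values (1, 0), (0, 1) and (1, 1) of column j determine a binary quadratic
    form.\<close>
  define w :: "complex \<Rightarrow> complex \<Rightarrow> cpt" where "w a b = (\<chi> v. if v = (1, j) then a else b)" for a b
  have c: "c 1 1 = 0" "c 2 2 = 0" "c 2 1 = - c 1 2"
    using rel[of "w 1 0"] rel[of "w 0 1"] rel[of "w 1 1"]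
    by (simp_all add: w_def eq_neg_iff_add_eq_0 add.commute)
  have 0: "const 0 = 0" "const (- x) = - const x" for x by (simp_all add: const_def single_uminus)
  have form: "\<omega> v = const (c 1 2) * pencil_form j v" for v
  proof -
    have "\<forall>v. \<omega> v = const (c 1 2) * pencil_form j v"
      unfolding all_idx using lin'[of 1] lin'[of 2] zero[of 1] zero[of 2] c jj
      by (auto simp: pencil_form_def 0 j'_def)
    then show ?thesis by blast
  qed
  have "c 1 2 \<noteq> 0"
  proof
    assume "c 1 2 = 0"
    then have "\<omega> v = 0" for v using form[of v] by (simp add: 0)
    then have "cpoint 1 0 1 t \<in> form_zeros \<omega>" for t by (simp add: form_zeros_def)
    then show False using finite_Sing_imp_not_fibre[OF foliation_finite_Sing[OF F]] by blast
  qed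
  then show ?thesis unfolding same_foliation_def using form by blast
qed

lemma pencil_regular:
  assumes "same_foliation \<omega> (pencil_form j)"
  shows "regular_foliation r \<omega>"
proof -
  obtain c where c: "c \<noteq> 0" "\<And>v. \<omega> v = const c * pencil_form j v" using assms by (auto simp: same_foliation_def)
  have "z \<in> irrelevant" if "\<forall>v. eval_cox (\<omega> v) z = 0" for z
  proof -
    have "eval_cox (pencil_form j (1, j)) z = 0" "eval_cox (pencil_form j (2, j)) z = 0"
      using that c by (simp_all add: eval_cox_mult)
    then show ?thesis
      using exhaust_2[of j] by (auto simp: pencil_form_def irrelevant_def eval_cox_uminus)
  qed
  then show ?thesis by (auto simp: regular_foliation_def Sing_eq form_zeros_def)
qed


section \<open>Foliations of fibre degree at least two\<close>

context
  fixes r :: nat and d1 :: int and n :: nat and \<omega> :: "idx \<Rightarrow> cox"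
  assumes tw: "twisted_form r (d1, int (n + 2)) \<omega>"
begin

definition fibre_resultant :: "2 \<Rightarrow> complex poly" where
  "fibre_resultant i = family_resultant (n + 2) n (Gco i \<omega>) (Qco i \<omega>)"

lemma fibre_resultant_root_iff:
  "poly (fibre_resultant i) u = 0 \<longleftrightarrow> (\<exists>s t. (s \<noteq> 0 \<or> t \<noteq> 0) \<and> cpoint i u s t \<in> form_zeros \<omega>)"
proof -
  have "poly (fibre_resultant i) u = 0 \<longleftrightarrow>
    (\<exists>s t. (s \<noteq> 0 \<or> t \<noteq> 0) \<and> form_eval (Suc n) (spec (Suc n) (Gco i \<omega>) u) s t = 0
       \<and> form_eval (Suc (n + 2)) (spec (Suc (n + 2)) (Qco i \<omega>) u) s t = 0)"
    unfolding fibre_resultant_def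
    by (rule family_resultant_root_iff) (auto intro: Gco_eq_0[OF tw] Qco_eq_0[OF tw])
  also have "\<dots> \<longleftrightarrow> (\<exists>s t. (s \<noteq> 0 \<or> t \<noteq> 0) \<and> cpoint i u s t \<in> form_zeros \<omega>)"
    using cpoint_zero_iff[OF tw] by (intro ex_cong1 conj_cong) simp_all
  finally show ?thesis .
qed

text \<open>The number of singularities with multiplicity, \<open>c\<^sub>2(\<Omega>\<^sup>1(d)) = 2 + (d\<^sub>2 - 1) (2 (d\<^sub>1 - 1) - r d\<^sub>2)\<close>.\<close>

definition sing_number :: int where
  "sing_number = (d1 - int r) * int (n + 2) + (d1 - 2 - int (r * (n + 2))) * int n"

lemma sing_number_eq: "sing_number = 2 + (int n + 1) * (2 * (d1 - 1) - int r * (int n + 2))"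
  by (simp add: sing_number_def algebra_simps)

lemma even_sing_number: "even sing_number"
  unfolding sing_number_eq by auto

text \<open>The data for \<open>sylv_transition\<close> are e = d1 - r, d = d1 - 2 and \<rho> = r u,
  with \<open>m = n + 2\<close>.\<close>

lemma fibre_resultant_transition:
  assumes "i \<noteq> i'" "u \<noteq> 0"
  shows "poly (fibre_resultant i) u = (- 1) ^ n * u powi sing_number * poly (fibre_resultant i') (1 / u)"
  unfolding fibre_resultant_def poly_family_resultant sing_number_def
proof (rule sylv_transition)
  show "poly (Gco i \<omega> k) u = u powi (d1 - int r - int (r * k)) * poly (Gco i' \<omega> k) (1 / u)" for k
    by (rule Gco_transition[OF tw assms])
  show "poly (Qco i \<omega> k) u = u powi (d1 - 2 - int (r * k)) *
      (of_nat r * u * (if k = 0 then 0 else poly (Gco i' \<omega> (k - 1)) (1 / u)) - poly (Qco i' \<omega> k) (1 / u))" for k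
    by (rule Qco_transition[OF tw assms])
qed (use assms in simp_all)

text \<open>The coefficient of t^k in P_t has degree d1 - r - r k in the base coordinates: it is
  zero if this is negative, and constant if this is 0. For r > 0 the constant is killed by the
  contraction with \<open>R1\<close> where both base coordinates vanish.\<close>

lemma Gco_constant_coefficient:
  assumes "0 < r" "d1 - int r \<le> int (r * k)"
  shows "Gco i \<omega> k = 0"
proof -
  \<comment> \<open>This point lies in the irrelevant set, but the contraction is a polynomial
    identity and holds there too. Only monomials free of base coordinates survive at it.\<close>
  define z :: cpt where "z = (\<chi> v. if snd v = 1 then 0 else 1)"
  have "of_nat r * eval_cox (\<omega> (2, 2)) z = 0" using contract_R1[OF tw, of z] by (simp add: z_def)
  then have 0: "eval_cox (\<omega> (2, 2)) z = 0" using assms(1) by simp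
  let ?K = "Poly_Mapping.keys (\<omega> (2, 2))"
  have deg: "int (Poly_Mapping.lookup m (1, 1)) + int (Poly_Mapping.lookup m (2, 1)) + int (Poly_Mapping.lookup m (2, 2)) * int r
      = d1 - int r" if "m \<in> ?K" for m
    using homogeneous_monomial(1)[OF hom_fibre(2)[OF tw] that] by simp
  have mono: "mono_eval m z = (if Poly_Mapping.lookup m (1, 1) = 0 \<and> Poly_Mapping.lookup m (2, 1) = 0 then 1 else 0)" for m
    by (auto simp: mono_eval_def prod_idx z_def power_0_left)
  have "poly (coefp i (\<omega> (2, 2)) k) u = 0" for u
  proof (cases "d1 - int r = int (r * k)")
    case True
    have iff: "Poly_Mapping.lookup m (1, 1) = 0 \<and> Poly_Mapping.lookup m (2, 1) = 0 \<longleftrightarrow> Poly_Mapping.lookup m (2, 2) = k"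
      if "m \<in> ?K" for m
    proof
      assume "Poly_Mapping.lookup m (1, 1) = 0 \<and> Poly_Mapping.lookup m (2, 1) = 0"
      then have "int (Poly_Mapping.lookup m (2, 2) * r) = int (k * r)" using deg[OF that] True by (simp add: mult.commute)
      then show "Poly_Mapping.lookup m (2, 2) = k" using assms(1) by (simp only: of_nat_eq_iff) simp
    next
      assume "Poly_Mapping.lookup m (2, 2) = k"
      then have "int (Poly_Mapping.lookup m (1, 1)) + int (Poly_Mapping.lookup m (2, 1)) = 0"
        using deg[OF that] True by (simp add: mult.commute)
      then show "Poly_Mapping.lookup m (1, 1) = 0 \<and> Poly_Mapping.lookup m (2, 1) = 0" by simp
    qed
    have "poly (coefp i (\<omega> (2, 2)) k) u = (\<Sum>m\<in>?K. Poly_Mapping.lookup (\<omega> (2, 2)) m * mono_eval m z)"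
      unfolding poly_coefp
    proof (intro sum.cong refl)
      fix m assume m: "m \<in> ?K"
      have "Poly_Mapping.lookup m (i, 1) = 0" if "Poly_Mapping.lookup m (2, 2) = k"
        using iff[OF m] that exhaust_2[of i] by auto
      then show "(if Poly_Mapping.lookup m (2, 2) = k then Poly_Mapping.lookup (\<omega> (2, 2)) m * u ^ Poly_Mapping.lookup m (i, 1) else 0)
        = Poly_Mapping.lookup (\<omega> (2, 2)) m * mono_eval m z"
        unfolding mono using iff[OF m] by auto
    qed
    also have "\<dots> = eval_cox (\<omega> (2, 2)) z" by (rule eval_cox_superset[symmetric]) auto
    finally show ?thesis using 0 by simp
  next
    case False
    have "Poly_Mapping.lookup m (2, 2) \<noteq> k" if m: "m \<in> ?K" for m
    proof
      assume "Poly_Mapping.lookup m (2, 2) = k"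
      then have "int (r * k) \<le> d1 - int r" using deg[OF m] by (simp add: mult.commute)
      then show False using assms(2) False by simp
    qed
    then show ?thesis unfolding poly_coefp by (intro sum.neutral) auto
  qed
  then have "poly (Gco i \<omega> k) u = 0" for u by (simp add: coefp_fibre(2)[OF tw])
  then show ?thesis using poly_all_0_iff_0 by blast
qed

lemma regular_imp_degrees:
  assumes reg: "form_zeros \<omega> = {}"
  shows "r = 0 \<and> d1 = 0 \<and> n = 0"
proof -
  have "sing_number = 0"
  proof (rule section_without_zeros)
    show "poly (fibre_resultant 1) u = (- 1) ^ n * u powi sing_number * poly (fibre_resultant 2) (1 / u)" if "u \<noteq> 0" for u
      by (rule fibre_resultant_transition[OF one_neq_two(1) that])
  qed (use reg fibre_resultant_root_iff in auto)
  then have eq: "(int n + 1) * (2 * (d1 - 1) - int r * (int n + 2)) = - 2" unfolding sing_number_eq by simp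
  then have "int (n + 1) dvd 2" by (metis dvd_minus_iff dvd_triv_left of_nat_Suc Suc_eq_plus1 of_nat_add of_nat_1)
  then have "int (n + 1) \<le> 2" by (rule zdvd_imp_le) simp
  then have n: "n = 0 \<or> n = 1" by auto
  \<comment> \<open>If g vanished on a fibre, any zero of q there would be a singularity, and q has
    positive degree n + 2.\<close>
  have fibre: "spec (Suc n) (Gco i \<omega>) u \<noteq> 0" for i u
  proof
    assume g: "spec (Suc n) (Gco i \<omega>) u = 0"
    have "short (Suc (Suc (Suc n))) (spec (Suc (n + 2)) (Qco i \<omega>) u)" using short_spec[of "Suc (n + 2)"] by simp
    then obtain s t where st: "s \<noteq> 0 \<or> t \<noteq> 0" "form_eval (Suc (Suc (Suc n))) (spec (Suc (n + 2)) (Qco i \<omega>) u) s t = 0"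
      by (rule form_has_zero)
    then have "cpoint i u s t \<in> form_zeros \<omega>" unfolding cpoint_zero_iff[OF tw st(1)] using g by simp
    then show False using reg by blast
  qed
  show ?thesis
  proof (cases "n = 0")
    \<comment> \<open>The form g is a single coefficient, of degree d1 - r = 0 in the base
      coordinates; r > 0 would make it zero.\<close>
    case True
    then have d1: "d1 = int r" using eq by simp
    have "r = 0"
    proof (rule ccontr)
      assume "r \<noteq> 0"
      then have "Gco 1 \<omega> 0 = 0" using Gco_constant_coefficient[of 0] d1 by simp
      then have "spec (Suc n) (Gco 1 \<omega>) 0 = 0" using True by (simp add: spec_def)
      then show False using fibre by blast
    qed
    then show ?thesis using True d1 by simp
  next
    \<comment> \<open>Here r is odd, hence positive, and d1 - r = (r + 1) / 2 is at most r. So the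
      top coefficient of g is zero, and the other one is a section of degree d1 - r without zeros.
      This forces d1 = r, contrary to 2 d1 = 3 r + 1.\<close>
    case False
    then have n1: "n = 1" using n by simp
    then have d1: "2 * d1 = 3 * int r + 1" using eq by simp
    have r: "0 < r"
    proof (rule ccontr)
      assume "\<not> 0 < r"
      then have "2 * d1 = 1" using d1 by simp
      then show False by presburger
    qed
    have G1: "Gco i \<omega> (Suc 0) = 0" for i
      by (rule Gco_constant_coefficient[OF r]) (use d1 r in simp)
    have G0: "poly (Gco i \<omega> 0) u \<noteq> 0" for i u
    proof
      assume "poly (Gco i \<omega> 0) u = 0"
      then have "spec (Suc n) (Gco i \<omega>) u = 0" using G1 n1 by (simp add: spec_def lessThan_Suc)
      then show False using fibre by blast
    qed
    have "d1 - int r = 0"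
    proof (rule section_without_zeros[of "Gco 1 \<omega> 0" "Gco 2 \<omega> 0" 1])
      show "poly (Gco 1 \<omega> 0) u = 1 * u powi (d1 - int r) * poly (Gco 2 \<omega> 0) (1 / u)" if "u \<noteq> 0" for u
        using Gco_transition[OF tw one_neq_two(1) that, of 0] by simp
    qed (rule G0)+
    then show ?thesis using d1 by simp
  qed
qed

lemma no_unique_simple_singularity:
  assumes Sing: "Sing r \<omega> = {p}"
  shows "sing_mult r \<omega> p \<noteq> 1"
proof
  assume mult: "sing_mult r \<omega> p = 1"
  obtain z where z: "z \<in> form_zeros \<omega>" "p = hpoint r z" using Sing unfolding Sing_eq by blast
  then have "z \<notin> irrelevant" by (simp add: form_zeros_def)
  then obtain i u0 s0 t0 where st0: "s0 \<noteq> 0 \<or> t0 \<noteq> 0" "hpoint r z = hpoint r (cpoint i u0 s0 t0)"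
    by (rule chart_exists)
  have p: "p = hpoint r (cpoint i u0 s0 t0)" using z st0 by simp
  have zero0: "cpoint i u0 s0 t0 \<in> form_zeros \<omega>"
    using hpoint_in_Sing_iff[OF tw, of "cpoint i u0 s0 t0"] Sing p by simp
  have orbit: "hpoint r w = hpoint r (cpoint i u0 s0 t0)" if "w \<in> form_zeros \<omega>" for w
    using that Sing p unfolding Sing_eq by blast
  obtain i' where i': "i' \<noteq> i" using one_neq_two by metis
  have "sing_number = 1"
  proof (rule section_with_simple_zero[of "fibre_resultant i" u0 "fibre_resultant i'"])
    show "poly (fibre_resultant i) u = 0 \<longleftrightarrow> u = u0" for u
      unfolding fibre_resultant_root_iff
      using zero0 st0(1) hpoint_cpoint_eqD(1)[OF orbit] by blast
    \<comment> \<open>The second chart adds only the fibre at infinity. A zero on it would have to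
      be \<open>p\<close>, whose base coordinate in chart i is finite.\<close>
    show "poly (fibre_resultant i') 0 \<noteq> 0"
    proof
      assume "poly (fibre_resultant i') 0 = 0"
      then obtain s t where "cpoint i' 0 s t \<in> form_zeros \<omega>" unfolding fibre_resultant_root_iff by blast
      from hpoint_cpoint_transition[OF i' orbit[OF this]] show False by simp
    qed
    show "poly (fibre_resultant i') u = (- 1) ^ n * u powi sing_number * poly (fibre_resultant i) (1 / u)" if "u \<noteq> 0" for u
      by (rule fibre_resultant_transition[OF i' that])
    show "poly (pderiv (fibre_resultant i)) u0 \<noteq> 0"
      unfolding fibre_resultant_def
    proof (rule family_resultant_simple_root[OF _ _ _ st0(1)])
      show "Gco i \<omega> k = 0" if "n < k" for k using that by (intro Gco_eq_0[OF tw]) simp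
      show "Qco i \<omega> k = 0" if "n + 2 < k" for k using that by (intro Qco_eq_0[OF tw]) simp
      show "form_eval (Suc n) (spec (Suc n) (Gco i \<omega>) u0) s0 t0 = 0"
        "form_eval (Suc (n + 2)) (spec (Suc (n + 2)) (Qco i \<omega>) u0) s0 t0 = 0"
        using zero0 unfolding cpoint_zero_iff[OF tw st0(1)] by simp_all
      show "t0 * s = s0 * t" if "s \<noteq> 0 \<or> t \<noteq> 0" "form_eval (Suc n) (spec (Suc n) (Gco i \<omega>) u0) s t = 0"
        "form_eval (Suc (n + 2)) (spec (Suc (n + 2)) (Qco i \<omega>) u0) s t = 0" for s t
      proof -
        have "cpoint i u0 s t \<in> form_zeros \<omega>" unfolding cpoint_zero_iff[OF tw that(1)] using that by simp
        from hpoint_cpoint_eqD(2)[OF orbit[OF this]] show ?thesis .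
      qed
      show "\<alpha> = 0 \<and> \<beta> = 0"
        if "short n g" "short (n + 2) q" "spec (Suc n) (Gco i \<omega>) u0 = [:t0, - s0:] * g"
          "spec (Suc (n + 2)) (Qco i \<omega>) u0 = [:t0, - s0:] * q"
          "\<alpha> * form_eval (Suc n) (spec (Suc n) (\<lambda>k. pderiv (Gco i \<omega> k)) u0) s0 t0 + \<beta> * form_eval n g s0 t0 = 0"
          "\<alpha> * form_eval (Suc (n + 2)) (spec (Suc (n + 2)) (\<lambda>k. pderiv (Qco i \<omega> k)) u0) s0 t0
            + \<beta> * form_eval (n + 2) q s0 t0 = 0" for g q \<alpha> \<beta>
        using sing_mult_1_nondegenerate[OF tw st0(1) zero0 mult[unfolded p] that(1,3,2,4,5,6)] .
    qed simp
  qed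
  then show False using even_sing_number by simp
qed

end

theorem corollary4p4:
  fixes r :: nat and d1 d2 :: int
  shows "(\<forall>\<omega>. foliation r (d1, d2) \<omega> \<longrightarrow>
            (regular_foliation r \<omega> \<longleftrightarrow> (r = 0 \<and> d1 = 0 \<and> d2 = 2) \<or> (d1 = 2 \<and> d2 = 0)) \<and>
            (r = 0 \<and> d1 = 0 \<and> d2 = 2 \<longrightarrow> same_foliation \<omega> (pencil_form 2)) \<and>
            (d1 = 2 \<and> d2 = 0 \<longrightarrow> same_foliation \<omega> (pencil_form 1)) \<and>
            (regular_foliation r \<omega> \<longrightarrow>
              (\<exists>f. p1_fibration r f \<and> given_by r \<omega> f \<and> (f = proj 1 \<or> r = 0 \<and> f = proj 2)))) \<and>
         \<not> (\<exists>\<omega> p. foliation r (d1, d2) \<omega> \<and> Sing r \<omega> = {p} \<and> sing_mult r \<omega> p = 1)"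
proof (intro conjI allI impI)
  fix \<omega> assume F: "foliation r (d1, d2) \<omega>"
  have pencil1: "same_foliation \<omega> (pencil_form 1)" if "d1 = 2 \<and> d2 = 0"
    by (rule pencil_foliation[of r]) (use F that in \<open>simp_all add: proj_valid_def\<close>)
  have pencil2: "same_foliation \<omega> (pencil_form 2)" if "r = 0 \<and> d1 = 0 \<and> d2 = 2"
    by (rule pencil_foliation[of r]) (use F that in \<open>simp_all add: proj_valid_def\<close>)
  show "d1 = 2 \<and> d2 = 0 \<Longrightarrow> same_foliation \<omega> (pencil_form 1)" by (rule pencil1)
  show "r = 0 \<and> d1 = 0 \<and> d2 = 2 \<Longrightarrow> same_foliation \<omega> (pencil_form 2)" by (rule pencil2)
  show iff: "regular_foliation r \<omega> \<longleftrightarrow> (r = 0 \<and> d1 = 0 \<and> d2 = 2) \<or> (d1 = 2 \<and> d2 = 0)"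
  proof
    assume reg: "regular_foliation r \<omega>"
    show "(r = 0 \<and> d1 = 0 \<and> d2 = 2) \<or> (d1 = 2 \<and> d2 = 0)"
    proof (cases "d2 \<le> 1")
      case True
      then show ?thesis using low_degree_foliation[OF F] by blast
    next
      case False
      define n where "n = nat (d2 - 2)"
      have d2: "d2 = int (n + 2)" using False by (simp add: n_def)
      have "twisted_form r (d1, int (n + 2)) \<omega>" using F d2 by (simp add: foliation_def)
      moreover have "form_zeros \<omega> = {}" using reg by (simp add: regular_foliation_def Sing_eq)
      ultimately have "r = 0 \<and> d1 = 0 \<and> n = 0" by (rule regular_imp_degrees)
      then show ?thesis using d2 by simp
    qed
  next
    assume "(r = 0 \<and> d1 = 0 \<and> d2 = 2) \<or> (d1 = 2 \<and> d2 = 0)"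
    then show "regular_foliation r \<omega>" using pencil1 pencil2 pencil_regular by blast
  qed
  assume "regular_foliation r \<omega>"
  then consider "r = 0 \<and> d1 = 0 \<and> d2 = 2" | "d1 = 2 \<and> d2 = 0" using iff by blast
  then show "\<exists>f. p1_fibration r f \<and> given_by r \<omega> f \<and> (f = proj 1 \<or> r = 0 \<and> f = proj 2)"
  proof cases
    case 1
    then have "given_by r \<omega> (proj 2)" using given_by_proj[OF _ pencil2] by (simp add: proj_valid_def)
    then show ?thesis using p1_fibration_proj_2 1 by blast
  next
    case 2
    then have "given_by r \<omega> (proj 1)" using given_by_proj[OF _ pencil1] by (simp add: proj_valid_def)
    then show ?thesis using p1_fibration_proj_1 by blast
  qed
next
  show "\<not> (\<exists>\<omega> p. foliation r (d1, d2) \<omega> \<and> Sing r \<omega> = {p} \<and> sing_mult r \<omega> p = 1)"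
  proof safe
    fix \<omega> p assume F: "foliation r (d1, d2) \<omega>" and S: "Sing r \<omega> = {p}" and mult: "sing_mult r \<omega> p = 1"
    show False
    proof (cases "d2 \<le> 1")
      \<comment> \<open>In these degrees the foliation is a pencil and has no singularity at
        all.\<close>
      case True
      then have d: "d1 = 2 \<and> d2 = 0" using low_degree_foliation[OF F] by blast
      have "same_foliation \<omega> (pencil_form 1)"
        by (rule pencil_foliation[of r]) (use F d in \<open>simp_all add: proj_valid_def\<close>)
      then show False using pencil_regular[of \<omega> 1 r] S by (simp add: regular_foliation_def)
    next
      case False
      define n where "n = nat (d2 - 2)"
      have "d2 = int (n + 2)" using False by (simp add: n_def)
      then have "twisted_form r (d1, int (n + 2)) \<omega>" using F by (simp add: foliation_def)
      from no_unique_simple_singularity[OF this S] show False using mult by simp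
    qed
  qed
qed

end
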